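(* Let $\{Y_n;n\ge1\}$ be a sequence of independent and identically distributed random variables in a sub-linear expectation space $(\Omega,\mathscr H,\widehat{\mathbb E})$, let $\mathbb V$ be a sub-additive capacity on $\mathcal F$ satisfying the compatibility property (C), let $\widehat{\mathbb V}^*$ be the countably sub-additive extension of $\widehat{\mathbb V}$, and let $\widehat{\mathcal V}^*(A)=1-\widehat{\mathbb V}^*(A^c)$. Denote $\overline\sigma^2=\breve{\mathbb E}[Y_1^2]$, $\underline\sigma^2=\lim_{c\to\infty}\widehat{\mathcal E}[Y_1^2\wedge c]$, $T_n=\sum_{i=1}^nY_i$ and $d_n=\sqrt{2n\log\log n}$. Suppose that $$C_{\mathbb V}\left[\frac{Y_1^2}{\log\log|Y_1|}\right]<\infty,\qquad \breve{\mathbb E}[Y_1]=\breve{\mathbb E}[-Y_1]=0,\qquad \overline\sigma^2=\lim_{c\to\infty}\widehat{\mathbb E}[Y_1^2\wedge c]<\infty .$$ Then $$\widehat{\mathcal V}^*\Big(\underline\sigma\le\limsup_{n\to\infty}\frac{T_n}{d_n}\le\overline\sigma\Big)=1,\qquad \widehat{\mathcal V}^*\Big(-\overline\sigma\le\liminf_{n\to\infty}\frac{T_n}{d_n}\le-\underline\sigma\Big)=1$$ and $$\widehat{\mathcal V}^*\left([-\overline\sigma,\overline\sigma]\supset C\Big\{\frac{T_n}{d_n}\Big\}=\Big[\liminf_{n\to\infty}\frac{T_n}{d_n},\ \limsup_{n\to\infty}\frac{T_n}{d_n}\Big]\supset[-\underline\sigma,\underline\sigma]\right)=1,$$ where $C\{x_n\}$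 denotes the cluster set (set of limit points of subsequences) of a sequence $\{x_n\}$ in $\mathbb R$.
   Context: Sub-linear expectation space: $(\Omega,\mathcal F)$ is a measurable space and $\mathscr H$ is a linear space of real measurable functions on it such that $\varphi(X_1,\dots,X_n)\in\mathscr H$ whenever $X_1,\dots,X_n\in\mathscr H$ and $\varphi\in C_{l,Lip}(\mathbb R^n)$, where $C_{l,Lip}(\mathbb R^n)$ is the set of $\varphi$ with $|\varphi(x)-\varphi(y)|\le C(1+|x|^m+|y|^m)|x-y|$ for some $C>0$, $m\in\mathbb N$ depending on $\varphi$. A sub-linear expectation is a map $\widehat{\mathbb E}:\mathscr H\to[-\infty,\infty]$ such that: $X\ge Y$ implies $\widehat{\mathbb E}[X]\ge\widehat{\mathbb E}[Y]$; $\widehat{\mathbb E}[c]=c$ for constants $c$; $\widehat{\mathbb E}[X+Y]\le\widehat{\mathbb E}[X]+\widehat{\mathbb E}[Y]$ whenever the right side is not of the form $\infty-\infty$; $\widehat{\mathbb E}[\lambda X]=\lambda\widehat{\mathbb E}[X]$ for $\lambda\ge0$ (with $0\cdot\infty=0$). The conjugate expectation is $\widehat{\mathcal E}[X]=-\widehat{\mathbb E}[-X]$. Elements of $\mathscr H$ are called random variables. Independence: a random vector $\bm Y\in\mathscr H^n$ is independent to $\bm X\in\mathscr H^m$ if $\widehat{\mathbb E}[\varphi(\bm X,\bm Y)]=\widehat{\mathbb E}\big[\widehat{\mathbb E}[\varphi(\bm x,\bm Y)]|_{\bm x=\bm X}\big]$ for each $\varphi\in C_{l,Lip}(\mathbb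 R^m\times\mathbb R^n)$ with $\overline\varphi(\bm x):=\widehat{\mathbb E}[|\varphi(\bm x,\bm Y)|]<\infty$ for all $\bm x$ and $\widehat{\mathbb E}[|\overline\varphi(\bm X)|]<\infty$. A sequence $\{Y_n\}$ is independent if $Y_{i+1}$ is independent to $(Y_1,\dots,Y_i)$ for each $i\ge1$; it is identically distributed if $\widehat{\mathbb E}[\varphi(Y_i)]=\widehat{\mathbb E}[\varphi(Y_1)]$ for all bounded Lipschitz $\varphi$ and all $i$. Capacities: a capacity is a monotone set function $V:\mathcal F\to[0,1]$ with $V(\emptyset)=0$, $V(\Omega)=1$; it is sub-additive if $V(A\cup B)\le V(A)+V(B)$. Property (C) for $\mathbb V$: $\widehat{\mathbb E}[f]\le\mathbb V(A)\le\widehat{\mathbb E}[g]$ whenever $f\le I_A\le g$, $f,g\in\mathscr H$, $A\in\mathcal F$. Define $\widehat{\mathbb V}(A)=\inf\{\widehat{\mathbb E}[\xi]:I_A\le\xi,\ \xi\in\mathscr H\}$ and $\widehat{\mathbb V}^*(A)=\inf\{\sum_{n=1}^\infty\widehat{\mathbb V}(A_n):A\subset\bigcup_{n=1}^\infty A_n\}$, $A,A_n\in\mathcal F$. The Choquet integral is $C_V[X]=\int_0^\infty V(X\ge t)\,dt+\int_{-\infty}^0[V(X\ge t)-1]\,dt$. For a random variable $X$, $\breve{\mathbb E}[X]=\lim_{c\to\infty}\widehat{\mathbb E}[(-c)\vee(X\wedge c)]$ if the limit exists. Conventions: $\log x=\ln\max(e,x)$; $x\wedge y=\min(x,y)$,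 $x\vee y=\max(x,y)$. *)

theory Defs
  imports "HOL-Analysis.Analysis"
begin

text \<open>
  Points of \<open>\<real>\<^sup>n\<close>, for varying \<open>n\<close>, are functions \<open>nat \<Rightarrow> real\<close> of which only the coordinates
  \<open>0, \<dots>, n - 1\<close> matter. The inequality below is required for all \<open>x\<close> and \<open>y\<close>, so it forces
  \<open>\<phi>\<close> to depend on these coordinates only: if \<open>x\<close> and \<open>y\<close> agree there, its right-hand side is 0.
\<close>

definition C_lLip :: "nat \<Rightarrow> ((nat \<Rightarrow> real) \<Rightarrow> real) set" where
  "C_lLip n = {\<phi>. \<exists>C>0. \<exists>m::nat. \<forall>x y.
     \<bar>\<phi> x - \<phi> y\<bar> \<le> C * (1 + L2_set x {..<n} ^ m + L2_set y {..<n} ^ m)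
                        * L2_set (\<lambda>i. x i - y i) {..<n}}"

text \<open>
  The measurable space is \<open>(space M, sets M)\<close>; the measure carried by \<open>M\<close> plays no role.
  Random variables are total functions on the type \<open>'a\<close>, compared on \<open>space M\<close> only, and
  \<open>E\<close> is meaningful on \<open>H\<close> only.
\<close>

locale sublinear_expectation_space =
  fixes M :: "'a measure" and H :: "('a \<Rightarrow> real) set" and E :: "('a \<Rightarrow> real) \<Rightarrow> ereal"
  assumes H_measurable: "X \<in> H \<Longrightarrow> X \<in> borel_measurable M"
    and H_zero: "(\<lambda>_. 0) \<in> H"
    and H_add: "X \<in> H \<Longrightarrow> Y \<in> H \<Longrightarrow> (\<lambda>\<omega>. X \<omega> + Y \<omega>) \<in> H"
    and H_scale: "X \<in> H \<Longrightarrow> (\<lambda>\<omega>. a * X \<omega>) \<in> H"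
    and H_C_lLip: "(\<And>i. i < n \<Longrightarrow> Z i \<in> H) \<Longrightarrow> \<phi> \<in> C_lLip n \<Longrightarrow> (\<lambda>\<omega>. \<phi> (\<lambda>i. Z i \<omega>)) \<in> H"
    and E_mono: "X \<in> H \<Longrightarrow> Y \<in> H \<Longrightarrow> (\<And>\<omega>. \<omega> \<in> space M \<Longrightarrow> Y \<omega> \<le> X \<omega>) \<Longrightarrow> E Y \<le> E X"
    and E_const: "E (\<lambda>_. c) = ereal c"
    and E_subadd: "X \<in> H \<Longrightarrow> Y \<in> H \<Longrightarrow> \<not> (E X = \<infinity> \<and> E Y = -\<infinity>) \<Longrightarrow> \<not> (E X = -\<infinity> \<and> E Y = \<infinity>)
        \<Longrightarrow> E (\<lambda>\<omega>. X \<omega> + Y \<omega>) \<le> E X + E Y"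
    and E_pos_homogeneous: "X \<in> H \<Longrightarrow> 0 \<le> a \<Longrightarrow> E (\<lambda>\<omega>. a * X \<omega>) = ereal a * E X"

definition conj_expectation :: "(('a \<Rightarrow> real) \<Rightarrow> ereal) \<Rightarrow> ('a \<Rightarrow> real) \<Rightarrow> ereal" where
  "conj_expectation E X = - E (\<lambda>\<omega>. - X \<omega>)"

definition vec_append :: "nat \<Rightarrow> (nat \<Rightarrow> real) \<Rightarrow> (nat \<Rightarrow> real) \<Rightarrow> nat \<Rightarrow> real" where
  "vec_append m x y = (\<lambda>i. if i < m then x i else y (i - m))"

text \<open>
  \<open>independent_to H E n Y m X\<close>: the \<open>n\<close>-dimensional random vector \<open>Y\<close> is independent to the
  \<open>m\<close>-dimensional random vector \<open>X\<close>.  The defining identity is required for those test functions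
  for which its terms are defined, that is, for which \<open>\<phi>bar(X)\<close> and the inner expectation evaluated
  at \<open>X\<close> belong to \<open>H\<close>, the domain of \<open>E\<close>. The inner expectation is finite, because its absolute
  value is bounded by \<open>\<phi>bar(x)\<close>, so \<open>real_of_ereal\<close> loses nothing.
\<close>

definition independent_to ::
    "('a \<Rightarrow> real) set \<Rightarrow> (('a \<Rightarrow> real) \<Rightarrow> ereal) \<Rightarrow> nat \<Rightarrow> (nat \<Rightarrow> 'a \<Rightarrow> real) \<Rightarrow> nat \<Rightarrow> (nat \<Rightarrow> 'a \<Rightarrow> real) \<Rightarrow> bool"
  where
  "independent_to H E n Y m X \<longleftrightarrow>
     (\<forall>j<n. Y j \<in> H) \<and> (\<forall>i<m. X i \<in> H) \<and>
     (\<forall>\<phi>\<in>C_lLip (m + n).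
        let \<phi>bar = (\<lambda>x. E (\<lambda>\<omega>. \<bar>\<phi> (vec_append m x (\<lambda>j. Y j \<omega>))\<bar>));
            \<phi>barX = (\<lambda>\<omega>. \<bar>real_of_ereal (\<phi>bar (\<lambda>i. X i \<omega>))\<bar>);
            inner = (\<lambda>x. real_of_ereal (E (\<lambda>\<omega>. \<phi> (vec_append m x (\<lambda>j. Y j \<omega>)))));
            innerX = (\<lambda>\<omega>. inner (\<lambda>i. X i \<omega>))
        in (\<forall>x. \<phi>bar x < \<infinity>) \<longrightarrow> \<phi>barX \<in> H \<longrightarrow> E \<phi>barX < \<infinity> \<longrightarrow> innerX \<in> H \<longrightarrow>
           E (\<lambda>\<omega>. \<phi> (vec_append m (\<lambda>i. X i \<omega>) (\<lambda>j. Y j \<omega>))) = E innerX)"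

text \<open>Sequences start at index 1; \<open>Y 0\<close> is ignored.\<close>

definition independent_seq ::
    "('a \<Rightarrow> real) set \<Rightarrow> (('a \<Rightarrow> real) \<Rightarrow> ereal) \<Rightarrow> (nat \<Rightarrow> 'a \<Rightarrow> real) \<Rightarrow> bool" where
  "independent_seq H E Y \<longleftrightarrow>
     (\<forall>i\<ge>1. independent_to H E 1 (\<lambda>_. Y (i + 1)) i (\<lambda>j. Y (j + 1)))"

definition identically_distributed_seq ::
    "(('a \<Rightarrow> real) \<Rightarrow> ereal) \<Rightarrow> (nat \<Rightarrow> 'a \<Rightarrow> real) \<Rightarrow> bool" where
  "identically_distributed_seq E Y \<longleftrightarrow>
     (\<forall>i\<ge>1. \<forall>\<phi>::real \<Rightarrow> real. bounded (range \<phi>) \<longrightarrow> (\<exists>L. L-lipschitz_on UNIV \<phi>) \<longrightarrow>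
        E (\<lambda>\<omega>. \<phi> (Y i \<omega>)) = E (\<lambda>\<omega>. \<phi> (Y 1 \<omega>)))"

definition capacity :: "'a measure \<Rightarrow> ('a set \<Rightarrow> real) \<Rightarrow> bool" where
  "capacity M V \<longleftrightarrow>
     (\<forall>A\<in>sets M. 0 \<le> V A \<and> V A \<le> 1) \<and> V {} = 0 \<and> V (space M) = 1 \<and>
     (\<forall>A\<in>sets M. \<forall>B\<in>sets M. A \<subseteq> B \<longrightarrow> V A \<le> V B)"

definition subadditive_on_sets :: "'a measure \<Rightarrow> ('a set \<Rightarrow> real) \<Rightarrow> bool" where
  "subadditive_on_sets M V \<longleftrightarrow> (\<forall>A\<in>sets M. \<forall>B\<in>sets M. V (A \<union> B) \<le> V A + V B)"

definition property_C ::
    "'a measure \<Rightarrow> ('a \<Rightarrow> real) set \<Rightarrow> (('a \<Rightarrow> real) \<Rightarrow> ereal) \<Rightarrow> ('a set \<Rightarrow> real) \<Rightarrow> bool" where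
  "property_C M H E V \<longleftrightarrow>
     (\<forall>f\<in>H. \<forall>g\<in>H. \<forall>A\<in>sets M.
        (\<forall>\<omega>\<in>space M. f \<omega> \<le> indicator A \<omega> \<and> indicator A \<omega> \<le> g \<omega>) \<longrightarrow>
        E f \<le> ereal (V A) \<and> ereal (V A) \<le> E g)"

definition V_hat ::
    "'a measure \<Rightarrow> ('a \<Rightarrow> real) set \<Rightarrow> (('a \<Rightarrow> real) \<Rightarrow> ereal) \<Rightarrow> 'a set \<Rightarrow> ereal" where
  "V_hat M H E A = Inf {E \<xi> | \<xi>. \<xi> \<in> H \<and> (\<forall>\<omega>\<in>space M. indicator A \<omega> \<le> \<xi> \<omega>)}"

definition V_hat_star ::
    "'a measure \<Rightarrow> ('a \<Rightarrow> real) set \<Rightarrow> (('a \<Rightarrow> real) \<Rightarrow> ereal) \<Rightarrow> 'a set \<Rightarrow> ereal" where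
  "V_hat_star M H E A =
     Inf {(\<Sum>n. V_hat M H E (B n)) | B :: nat \<Rightarrow> 'a set. (\<forall>n. B n \<in> sets M) \<and> A \<subseteq> (\<Union>n. B n)}"

definition V_hat_star_lower ::
    "'a measure \<Rightarrow> ('a \<Rightarrow> real) set \<Rightarrow> (('a \<Rightarrow> real) \<Rightarrow> ereal) \<Rightarrow> 'a set \<Rightarrow> ereal" where
  "V_hat_star_lower M H E A = 1 - V_hat_star M H E (space M - A)"

text \<open>
  The integral of \<open>V(X \<ge> t) - 1 \<le> 0\<close> over the negative half-line is written as minus the integral
  of \<open>1 - V(X \<ge> t)\<close>, so that both parts are integrals of nonnegative functions and may be infinite.
\<close>

definition choquet :: "'a measure \<Rightarrow> ('a set \<Rightarrow> real) \<Rightarrow> ('a \<Rightarrow> real) \<Rightarrow> ereal" where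
  "choquet M V X =
     enn2ereal (\<integral>\<^sup>+t\<in>{0..}. ennreal (V {\<omega>\<in>space M. t \<le> X \<omega>}) \<partial>lborel) -
     enn2ereal (\<integral>\<^sup>+t\<in>{..0}. ennreal (1 - V {\<omega>\<in>space M. t \<le> X \<omega>}) \<partial>lborel)"

definition trunc_expectation ::
    "(('a \<Rightarrow> real) \<Rightarrow> ereal) \<Rightarrow> ('a \<Rightarrow> real) \<Rightarrow> real \<Rightarrow> ereal" where
  "trunc_expectation E X c = E (\<lambda>\<omega>. max (- c) (min (X \<omega>) c))"

text \<open>
  \<open>breve_expectation E X\<close> is meaningful only if the limit exists, which is recorded separately.
\<close>

definition breve_exists :: "(('a \<Rightarrow> real) \<Rightarrow> ereal) \<Rightarrow> ('a \<Rightarrow> real) \<Rightarrow> bool" where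
  "breve_exists E X \<longleftrightarrow> (\<exists>l. (trunc_expectation E X \<longlongrightarrow> l) at_top)"

definition breve_expectation :: "(('a \<Rightarrow> real) \<Rightarrow> ereal) \<Rightarrow> ('a \<Rightarrow> real) \<Rightarrow> ereal" where
  "breve_expectation E X = Lim at_top (trunc_expectation E X)"

text \<open>
  For the two variances the limits always exist in \<open>[0, \<infinity>]\<close>, by monotonicity in the truncation
  level. The deviations below are the real ones when the variances are finite.
\<close>

definition upper_variance :: "(('a \<Rightarrow> real) \<Rightarrow> ereal) \<Rightarrow> ('a \<Rightarrow> real) \<Rightarrow> ereal" where
  "upper_variance E X = breve_expectation E (\<lambda>\<omega>. (X \<omega>)\<^sup>2)"

definition lower_variance :: "(('a \<Rightarrow> real) \<Rightarrow> ereal) \<Rightarrow> ('a \<Rightarrow> real) \<Rightarrow> ereal" where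
  "lower_variance E X = Lim at_top (\<lambda>c::real. conj_expectation E (\<lambda>\<omega>. min ((X \<omega>)\<^sup>2) c))"

definition upper_sigma :: "(('a \<Rightarrow> real) \<Rightarrow> ereal) \<Rightarrow> ('a \<Rightarrow> real) \<Rightarrow> real" where
  "upper_sigma E X = sqrt (real_of_ereal (upper_variance E X))"

definition lower_sigma :: "(('a \<Rightarrow> real) \<Rightarrow> ereal) \<Rightarrow> ('a \<Rightarrow> real) \<Rightarrow> real" where
  "lower_sigma E X = sqrt (real_of_ereal (lower_variance E X))"

text \<open>The convention \<open>log x = ln (max e x)\<close>.\<close>

definition clog :: "real \<Rightarrow> real" where
  "clog x = ln (max (exp 1) x)"

definition lil_norm :: "nat \<Rightarrow> real" where
  "lil_norm n = sqrt (2 * real n * clog (clog (real n)))"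

definition partial_sum :: "(nat \<Rightarrow> 'a \<Rightarrow> real) \<Rightarrow> nat \<Rightarrow> 'a \<Rightarrow> real" where
  "partial_sum Y n \<omega> = (\<Sum>i=1..n. Y i \<omega>)"

definition cluster_set :: "(nat \<Rightarrow> real) \<Rightarrow> real set" where
  "cluster_set x = {l. \<exists>r::nat \<Rightarrow> nat. strict_mono r \<and> (x \<circ> r) \<longlonglongrightarrow> l}"

end

theory Submission
  imports Defs "HOL-Real_Asymp.Real_Asymp"
begin

text \<open>
  Every expectation below is taken of a bounded Lipschitz function of finitely many \<open>Y\<^sub>i\<close>; on such
  functions independence lets one integrate out the last variable, so that a family \<open>\<phi>\<^sub>j\<close> with
  \<open>E[\<phi>\<^sub>j\<^sub>+\<^sub>1(x, Y)] \<le> \<phi>\<^sub>j(x)\<close> behaves like a supermartingale. Write \<open>d\<^sub>n\<close> for the norming sequence and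
  \<open>\<ell> = log log n\<close>, so \<open>d\<^sub>n\<^sup>2 = 2 n \<ell>\<close>. The Choquet condition implies the summability of
  \<open>\<beta>\<^sub>n = E[(\<bar>Y\<^sub>1\<bar> / d\<^sub>n \<and> 1)\<^sup>4]\<close>, hence of \<open>\<alpha>\<^sub>k = n\<^sub>k \<beta>\<close> at \<open>n\<^sub>k\<close> along geometric sequences.

  Upper half: Chernoff's method for the variables truncated at \<open>\<delta> d\<^sub>n\<close> bounds the capacity that
  \<open>T\<^sub>i \<ge> \<tau> d\<^sub>n\<close> for some \<open>i \<le> n\<close> by a constant times
  \<open>exp (- \<ell> \<tau>\<^sup>2 / \<sigma>\<^sup>2) + \<alpha>\<close>, for any \<open>\<sigma>\<close> above the upper deviation, and Borel-Cantelli applies.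

  Lower half: for \<open>\<kappa>\<close> large enough, \<open>exp (- \<kappa> (m - j) / n - (y - u)\<^sup>2 / (2 R\<^sub>j))\<close>, where
  \<open>R\<^sub>j = v (m - j) + r n\<close> and \<open>v\<close> is below the lower variance, is a subsolution of the recursion for
  the lower expectation in the relevant range of \<open>u\<close>, for all \<open>n\<close> with \<open>n \<beta>\<^sub>n \<ell>\<^sup>4 \<le> 1\<close>: where the Gaussian
  is convex, larger variances only help, and where it is concave the loss is of order \<open>1 / n\<close> per step.
  So a block of length comparable to \<open>n\<close> has an increment \<open>\<ge> \<tau> d\<^sub>n\<close> with lower capacity at least
  a constant times \<open>1 / log n\<close>. The remaining \<open>n = n\<^sub>k\<close> satisfy \<open>1 / k \<le> \<alpha>\<^sub>k\<close> eventually, so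
  the sum over the good blocks diverges. Finally \<open>T\<^sub>n / d\<^sub>n\<close> has increments tending to 0,
  so its cluster set is an interval.
\<close>

section \<open>Bounded Lipschitz functions\<close>

text \<open>The class \<open>bl\<close> is stable under every operation used, including integration
  of one variable, because a sub-linear expectation is nonexpansive for the sup norm. So both
  functions of \<open>X\<close> that \<open>independent_to\<close> wants in \<open>H\<close> are
  there automatically, \<open>E\<close> is finite, and equality in law applies. The obstacle is the
  weak moment condition. Second moments alone do not control truncation errors at the two scales in
  play, \<open>d\<^sub>n\<close> and the much smaller \<open>n / d\<^sub>n\<close>. Fourth powers
  capped at \<open>d\<^sub>n\<close> do: the sum of \<open>d\<^sub>n ^ (- 4)\<close> over
  \<open>n \<ge> m\<close> is of order \<open>m / d\<^sub>m ^ 4\<close>, which matches the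
  capacities of \<open>\<bar>Y\<^sub>1\<bar> \<ge> d\<^sub>m\<close>. Lowering the truncation level
  from \<open>d\<^sub>n\<close> to \<open>n / d\<^sub>n\<close> costs the fourth power of
  \<open>d\<^sub>n\<^sup>2 / n = 2 \<ell>\<close>, whence the factor \<open>\<ell>\<^sup>4\<close>
  in the condition on \<open>n\<close>. In the lower half, per-step losses of order
  \<open>1 / n\<close> over at most \<open>n\<close> steps leave a constant factor
  \<open>exp (- \<kappa>)\<close>. The place of the second Borel-Cantelli lemma is taken by a
  product of block functions, whose expectation is at most \<open>exp\<close> of minus the sum of
  the block bounds.\<close>

text \<open>The absolute value around \<open>D x y\<close> spares a nonnegativity assumption on \<open>D\<close>.\<close>

definition bl :: "('b \<Rightarrow> 'b \<Rightarrow> real) \<Rightarrow> ('b \<Rightarrow> real) set" where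
  "bl D = {f. \<exists>K. \<forall>x y. \<bar>f x\<bar> \<le> K \<and> \<bar>f x - f y\<bar> \<le> K * \<bar>D x y\<bar>}"

definition line_dist :: "real \<Rightarrow> real \<Rightarrow> real" where
  "line_dist x y = x - y"

text \<open>Only coordinates below \<open>n\<close> enter, so a member of
  \<open>bl (path_dist n)\<close> ignores all later coordinates (\<open>bl_path_cong\<close>). The
  l1 form makes the distance of two points that differ in one coordinate exactly the difference
  there.\<close>

definition path_dist :: "nat \<Rightarrow> (nat \<Rightarrow> real) \<Rightarrow> (nat \<Rightarrow> real) \<Rightarrow> real" where
  "path_dist n x y = (\<Sum>i<n. \<bar>x i - y i\<bar>)"

lemma blI:
  assumes "\<And>x. \<bar>f x\<bar> \<le> K" and "\<And>x y. \<bar>f x - f y\<bar> \<le> L * \<bar>D x y\<bar>"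
  shows "f \<in> bl D"
proof -
  have "\<bar>f x\<bar> \<le> max K L \<and> \<bar>f x - f y\<bar> \<le> max K L * \<bar>D x y\<bar>" for x y
    using assms(1)[of x] order_trans[OF assms(2)[of x y] mult_right_mono[of L "max K L"]]
    by auto
  then show ?thesis unfolding bl_def by blast
qed

lemma bl_bounds:
  assumes "f \<in> bl D"
  shows "\<exists>K\<ge>0. (\<forall>x. \<bar>f x\<bar> \<le> K) \<and> (\<forall>x y. \<bar>f x - f y\<bar> \<le> K * \<bar>D x y\<bar>)"
proof -
  obtain K where K: "\<And>x y. \<bar>f x\<bar> \<le> K \<and> \<bar>f x - f y\<bar> \<le> K * \<bar>D x y\<bar>"
    using assms unfolding bl_def by blast
  moreover have "0 \<le> K" using K[of undefined] abs_ge_zero order_trans by blast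
  ultimately show ?thesis by blast
qed

lemma bl_const [simp, intro]: "(\<lambda>_. c) \<in> bl D"
  by (rule blI[where K = "\<bar>c\<bar>" and L = 0]) auto

lemma bl_add [intro]:
  assumes "f \<in> bl D" "g \<in> bl D" shows "(\<lambda>x. f x + g x) \<in> bl D"
proof -
  obtain K where K: "\<And>x. \<bar>f x\<bar> \<le> K" "\<And>x y. \<bar>f x - f y\<bar> \<le> K * \<bar>D x y\<bar>" "0 \<le> K" using bl_bounds[OF assms(1)] by blast
  obtain L where L: "\<And>x. \<bar>g x\<bar> \<le> L" "\<And>x y. \<bar>g x - g y\<bar> \<le> L * \<bar>D x y\<bar>" "0 \<le> L" using bl_bounds[OF assms(2)] by blast
  show ?thesis
  proof (rule blI[where K = "K + L" and L = "K + L"])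
    show "\<bar>f x + g x\<bar> \<le> K + L" for x using K(1)[of x] L(1)[of x] by linarith
    show "\<bar>f x + g x - (f y + g y)\<bar> \<le> (K + L) * \<bar>D x y\<bar>" for x y
      using K(2)[of x y] L(2)[of x y] by (simp add: distrib_right)
  qed
qed

lemma bl_mult [intro]:
  assumes "f \<in> bl D" "g \<in> bl D" shows "(\<lambda>x. f x * g x) \<in> bl D"
proof -
  obtain K where K: "\<And>x. \<bar>f x\<bar> \<le> K" "\<And>x y. \<bar>f x - f y\<bar> \<le> K * \<bar>D x y\<bar>" "0 \<le> K" using bl_bounds[OF assms(1)] by blast
  obtain L where L: "\<And>x. \<bar>g x\<bar> \<le> L" "\<And>x y. \<bar>g x - g y\<bar> \<le> L * \<bar>D x y\<bar>" "0 \<le> L" using bl_bounds[OF assms(2)] by blast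
  show ?thesis
  proof (rule blI[where K = "K * L" and L = "2 * (K * L)"])
    show "\<bar>f x * g x\<bar> \<le> K * L" for x using K(1)[of x] L(1)[of x] K(3) by (simp add: abs_mult mult_mono)
    show "\<bar>f x * g x - f y * g y\<bar> \<le> 2 * (K * L) * \<bar>D x y\<bar>" for x y
    proof -
      have "f x * g x - f y * g y = f x * (g x - g y) + (f x - f y) * g y" by (simp add: algebra_simps)
      then have "\<bar>f x * g x - f y * g y\<bar> \<le> \<bar>f x\<bar> * \<bar>g x - g y\<bar> + \<bar>f x - f y\<bar> * \<bar>g y\<bar>"
        by (metis abs_mult abs_triangle_ineq)
      also have "\<dots> \<le> K * (L * \<bar>D x y\<bar>) + (K * \<bar>D x y\<bar>) * L"
        by (intro add_mono mult_mono K L) (use K L in auto)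
      finally show ?thesis by (simp add: algebra_simps)
    qed
  qed
qed

lemma bl_cmult [intro]: "f \<in> bl D \<Longrightarrow> (\<lambda>x. c * f x) \<in> bl D"
  by (rule bl_mult[OF bl_const])

lemma bl_uminus [intro]: "f \<in> bl D \<Longrightarrow> (\<lambda>x. - f x) \<in> bl D"
  using bl_cmult[of f D "- 1"] by simp

lemma bl_diff [intro]: "f \<in> bl D \<Longrightarrow> g \<in> bl D \<Longrightarrow> (\<lambda>x. f x - g x) \<in> bl D"
  using bl_add[of f D "\<lambda>x. - g x"] by auto

lemma bl_power [intro]: "f \<in> bl D \<Longrightarrow> (\<lambda>x. f x ^ n) \<in> bl D"
  by (induction n) auto

lemma bl_prod [intro]: "(\<And>i. i \<in> A \<Longrightarrow> f i \<in> bl D) \<Longrightarrow> (\<lambda>x. \<Prod>i\<in>A. f i x) \<in> bl D"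
  by (induction A rule: infinite_finite_induct) auto

text \<open>Since \<open>f\<close> is bounded, \<open>g\<close> is evaluated on a bounded interval
  only, so a Lipschitz constant for each bounded range is enough; this admits
  \<open>exp\<close>.\<close>

lemma bl_compose:
  assumes f: "f \<in> bl D"
    and g: "\<And>K. \<exists>L. \<forall>a b. \<bar>a\<bar> \<le> K \<longrightarrow> \<bar>b\<bar> \<le> K \<longrightarrow> \<bar>g a - g b\<bar> \<le> L * \<bar>a - b\<bar>"
  shows "(\<lambda>x. g (f x)) \<in> bl D"
proof -
  obtain K where K: "\<And>x. \<bar>f x\<bar> \<le> K" "\<And>x y. \<bar>f x - f y\<bar> \<le> K * \<bar>D x y\<bar>" "0 \<le> K" using bl_bounds[OF f] by blast
  obtain L0 where L0: "\<forall>a b. \<bar>a\<bar> \<le> K \<longrightarrow> \<bar>b\<bar> \<le> K \<longrightarrow> \<bar>g a - g b\<bar> \<le> L0 * \<bar>a - b\<bar>" using g by blast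
  define L where "L = max 0 L0"
  have L: "\<bar>g a - g b\<bar> \<le> L * \<bar>a - b\<bar>" if "\<bar>a\<bar> \<le> K" "\<bar>b\<bar> \<le> K" for a b
  proof -
    have "\<bar>g a - g b\<bar> \<le> L0 * \<bar>a - b\<bar>" using L0 that by blast
    also have "\<dots> \<le> L * \<bar>a - b\<bar>" unfolding L_def by (intro mult_right_mono) auto
    finally show ?thesis .
  qed
  have "0 \<le> L" by (simp add: L_def)
  show ?thesis
  proof (rule blI[where K = "\<bar>g 0\<bar> + L * K" and L = "L * K"])
    show "\<bar>g (f x)\<bar> \<le> \<bar>g 0\<bar> + L * K" for x
    proof -
      have "\<bar>g (f x) - g 0\<bar> \<le> L * \<bar>f x - 0\<bar>" by (rule L) (use K(1)[of x] K(3) in simp_all)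
      also have "\<dots> \<le> L * K" using K(1)[of x] \<open>0 \<le> L\<close> by (simp add: mult_left_mono)
      finally show ?thesis by linarith
    qed
    show "\<bar>g (f x) - g (f y)\<bar> \<le> L * K * \<bar>D x y\<bar>" for x y
      using order_trans[OF L[OF K(1) K(1)] mult_left_mono[OF K(2)[of x y] \<open>0 \<le> L\<close>]]
      by (simp add: mult.assoc)
  qed
qed

lemma bl_exp [intro]:
  assumes "f \<in> bl D" shows "(\<lambda>x. exp (f x)) \<in> bl D"
proof (rule bl_compose[OF assms])
  fix K :: real
  have *: "exp a - exp b \<le> exp K * \<bar>a - b\<bar>" if "a \<le> K" for a b :: real
  proof -
    have "exp a * (1 + (b - a)) \<le> exp a * exp (b - a)" by (intro mult_left_mono exp_ge_add_one_self) auto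
    then have "exp a - exp b \<le> exp a * (a - b)" by (simp add: algebra_simps flip: exp_add)
    also have "\<dots> \<le> exp a * \<bar>a - b\<bar>" by (intro mult_left_mono) auto
    also have "\<dots> \<le> exp K * \<bar>a - b\<bar>" using that by (intro mult_right_mono) auto
    finally show ?thesis .
  qed
  have "\<bar>exp a - exp b\<bar> \<le> exp K * \<bar>a - b\<bar>" if "\<bar>a\<bar> \<le> K" "\<bar>b\<bar> \<le> K" for a b
    using *[of a b] *[of b a] that by (auto simp: abs_le_iff abs_minus_commute)
  then show "\<exists>L. \<forall>a b. \<bar>a\<bar> \<le> K \<longrightarrow> \<bar>b\<bar> \<le> K \<longrightarrow> \<bar>exp a - exp b\<bar> \<le> L * \<bar>a - b\<bar>" by blast
qed

lemma bl_max [intro]: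
  assumes "f \<in> bl D" "g \<in> bl D" shows "(\<lambda>x. max (f x) (g x)) \<in> bl D"
proof -
  have "(\<lambda>x. \<bar>f x - g x\<bar>) \<in> bl D"
    by (rule bl_compose[where g = abs, OF bl_diff[OF assms]]) (rule exI[of _ 1], auto)
  then have "(\<lambda>x. 1/2 * (f x + g x + \<bar>f x - g x\<bar>)) \<in> bl D" by (intro bl_cmult bl_add assms)
  moreover have "(\<lambda>x. 1/2 * (f x + g x + \<bar>f x - g x\<bar>)) = (\<lambda>x. max (f x) (g x))" by (auto simp: max_def)
  ultimately show ?thesis by simp
qed

lemma bl_lipschitz_compose:
  assumes g: "g \<in> bl line_dist" and h: "\<And>x y. \<bar>h x - h y\<bar> \<le> L * \<bar>D x y\<bar>"
  shows "(\<lambda>x. g (h x)) \<in> bl D"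
proof -
  obtain K where K: "\<And>x. \<bar>g x\<bar> \<le> K" "\<And>x y. \<bar>g x - g y\<bar> \<le> K * \<bar>line_dist x y\<bar>" "0 \<le> K" using bl_bounds[OF g] by blast
  show ?thesis
  proof (rule blI[where K = K and L = "K * L"])
    show "\<bar>g (h x) - g (h y)\<bar> \<le> K * L * \<bar>D x y\<bar>" for x y
      using order_trans[OF K(2)[of "h x" "h y", unfolded line_dist_def] mult_left_mono[OF h K(3)]]
      by (simp add: mult.assoc)
  qed (rule K)
qed

lemma bl_affine [intro]:
  assumes "g \<in> bl line_dist" shows "(\<lambda>y. g (a + b * y)) \<in> bl line_dist"
proof -
  have "\<bar>a + b * x - (a + b * y)\<bar> \<le> \<bar>b\<bar> * \<bar>line_dist x y\<bar>" for x y
    by (simp add: line_dist_def flip: abs_mult right_diff_distrib)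
  then show ?thesis by (rule bl_lipschitz_compose[OF assms])
qed

lemma bl_shift [intro]: "g \<in> bl line_dist \<Longrightarrow> (\<lambda>y. g (a + y)) \<in> bl line_dist"
  using bl_affine[of g a 1] by simp

lemma bl_line_trunc [intro]: "0 \<le> c \<Longrightarrow> (\<lambda>y. max (- c) (min y c)) \<in> bl line_dist"
  by (rule blI[where K = c and L = 1]) (auto simp: line_dist_def)

lemma path_dist_nonneg [simp]: "0 \<le> path_dist n x y"
  by (simp add: path_dist_def sum_nonneg)

lemma bl_path_sum:
  assumes g: "g \<in> bl line_dist" and h: "\<And>i s t. \<bar>h i s - h i t\<bar> \<le> L * \<bar>s - t\<bar>" and "A \<subseteq> {..<n}"
  shows "(\<lambda>x. g (\<Sum>i\<in>A. h i (x i))) \<in> bl (path_dist n)"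
proof (rule bl_lipschitz_compose[OF g])
  fix x y :: "nat \<Rightarrow> real"
  have "\<bar>(\<Sum>i\<in>A. h i (x i)) - (\<Sum>i\<in>A. h i (y i))\<bar> \<le> (\<Sum>i\<in>A. \<bar>h i (x i) - h i (y i)\<bar>)"
    by (simp flip: sum_subtractf)
  also have "\<dots> \<le> (\<Sum>i\<in>A. \<bar>L\<bar> * \<bar>x i - y i\<bar>)"
    by (rule sum_mono) (rule order_trans[OF h mult_right_mono], auto)
  also have "\<dots> \<le> (\<Sum>i<n. \<bar>L\<bar> * \<bar>x i - y i\<bar>)"
    using assms(3) by (intro sum_mono2) auto
  finally show "\<bar>(\<Sum>i\<in>A. h i (x i)) - (\<Sum>i\<in>A. h i (y i))\<bar> \<le> \<bar>L\<bar> * \<bar>path_dist n x y\<bar>"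
    by (simp add: path_dist_def sum_distrib_left)
qed

lemma path_dist_mono: "m \<le> n \<Longrightarrow> path_dist m x y \<le> path_dist n x y"
  unfolding path_dist_def by (rule sum_mono2) auto

lemma bl_path_mono:
  assumes "f \<in> bl (path_dist m)" "m \<le> n" shows "f \<in> bl (path_dist n)"
proof -
  obtain K where K: "\<And>x. \<bar>f x\<bar> \<le> K" "\<And>x y. \<bar>f x - f y\<bar> \<le> K * \<bar>path_dist m x y\<bar>" "0 \<le> K"
    using bl_bounds[OF assms(1)] by blast
  show ?thesis
  proof (rule blI[where K = K and L = K])
    show "\<bar>f x - f y\<bar> \<le> K * \<bar>path_dist n x y\<bar>" for x y
      using order_trans[OF K(2)[of x y] mult_left_mono[OF _ K(3)], of "path_dist n x y"]
        path_dist_mono[OF assms(2), of x y] by simp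
  qed (rule K)
qed

lemma bl_path_C_lLip:
  assumes "f \<in> bl (path_dist n)" shows "f \<in> C_lLip n"
proof -
  obtain K where K: "\<And>x. \<bar>f x\<bar> \<le> K" "\<And>x y. \<bar>f x - f y\<bar> \<le> K * \<bar>path_dist n x y\<bar>" "0 \<le> K"
    using bl_bounds[OF assms(1)] by blast
  \<comment> \<open>Growth exponent 0 makes the polynomial factor the constant 3. The summand 1 in
    \<open>K * n + 1\<close> keeps the constant positive when \<open>K\<close> or \<open>n\<close>
    is 0.\<close>
  have "\<bar>f x - f y\<bar> \<le> (K * n + 1) * (1 + L2_set x {..<n} ^ 0 + L2_set y {..<n} ^ 0) * L2_set (\<lambda>i. x i - y i) {..<n}" for x y
  proof -
    let ?l = "L2_set (\<lambda>i. x i - y i) {..<n}"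
    have "path_dist n x y \<le> (\<Sum>i<n. ?l)"
      unfolding path_dist_def
    proof (rule sum_mono)
      fix i assume "i \<in> {..<n}"
      then have "L2_set (\<lambda>i. x i - y i) {i} \<le> ?l" unfolding L2_set_def
        by (intro real_sqrt_le_mono sum_mono2) auto
      then show "\<bar>x i - y i\<bar> \<le> ?l" by (simp add: L2_set_def)
    qed
    then have "\<bar>f x - f y\<bar> \<le> K * (n * ?l)"
      using order_trans[OF K(2)[of x y] mult_left_mono[OF _ K(3)]] by simp
    also have "\<dots> \<le> (K * n + 1) * 3 * ?l"
    proof -
      have "0 \<le> K * n * ?l" "0 \<le> ?l" using K(3) by (auto simp: L2_set_nonneg)
      then show ?thesis by (simp add: algebra_simps)
    qed
    finally show ?thesis by simp
  qed
  moreover have "0 < K * n + 1" using K(3) by (simp add: add_nonneg_pos)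
  ultimately show ?thesis unfolding C_lLip_def by blast
qed

lemma bl_path_cong:
  assumes "f \<in> bl (path_dist n)" "\<And>i. i < n \<Longrightarrow> x i = y i" shows "f x = f y"
proof -
  obtain K where K: "\<And>x. \<bar>f x\<bar> \<le> K" "\<And>x y. \<bar>f x - f y\<bar> \<le> K * \<bar>path_dist n x y\<bar>" "0 \<le> K"
    using bl_bounds[OF assms(1)] by blast
  have "path_dist n x y = 0" using assms(2) by (simp add: path_dist_def)
  then show ?thesis using K(2)[of x y] by simp
qed

lemma bl_path_slice:
  assumes "f \<in> bl (path_dist (Suc n))"
  shows "(\<lambda>y. f (x(n := y))) \<in> bl line_dist"
proof -
  obtain K where K: "\<And>x. \<bar>f x\<bar> \<le> K" "\<And>x y. \<bar>f x - f y\<bar> \<le> K * \<bar>path_dist (Suc n) x y\<bar>" "0 \<le> K"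
    using bl_bounds[OF assms(1)] by blast
  have "path_dist (Suc n) (x(n := s)) (x(n := t)) = \<bar>s - t\<bar>" for s t
    unfolding path_dist_def by simp
  then have "\<bar>f (x(n := s)) - f (x(n := t))\<bar> \<le> K * \<bar>line_dist s t\<bar>" for s t
    using K(2)[of "x(n := s)" "x(n := t)"] by (simp add: line_dist_def)
  then show ?thesis by (rule blI[OF K(1)])
qed

section \<open>Null sets of the countably sub-additive extension\<close>

context sublinear_expectation_space
begin

abbreviation Vhat :: "'a set \<Rightarrow> ereal" where "Vhat \<equiv> V_hat M H E"

text \<open>Vanishing of \<open>V_hat_star\<close>, unfolded to countable covers. The sums live in
  \<open>ennreal\<close>, where they can be rearranged freely; \<open>null_lower_eq_1\<close>
  translates back. Null sets need not be measurable, only the covering sets are.\<close>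

definition null :: "'a set \<Rightarrow> bool" where
  "null A \<longleftrightarrow> (\<forall>\<epsilon>>0. \<exists>B. (\<forall>n::nat. B n \<in> sets M) \<and> A \<subseteq> (\<Union>n. B n) \<and> (\<Sum>n. e2ennreal (Vhat (B n))) \<le> ennreal \<epsilon>)"

lemma Vhat_nonneg: "0 \<le> Vhat A"
  unfolding V_hat_def
proof (rule Inf_greatest, clarsimp)
  fix \<xi> assume "\<xi> \<in> H" "\<forall>\<omega>\<in>space M. indicator A \<omega> \<le> \<xi> \<omega>"
  then have "0 \<le> \<xi> \<omega>" if "\<omega> \<in> space M" for \<omega>
    using that indicator_pos_le[of A \<omega>] order_trans by blast
  then have "E (\<lambda>_. 0) \<le> E \<xi>" using \<open>\<xi> \<in> H\<close> by (intro E_mono H_zero) auto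
  then show "0 \<le> E \<xi>" by (simp add: E_const flip: zero_ereal_def)
qed

lemma Vhat_le:
  assumes "\<xi> \<in> H" "\<And>\<omega>. \<omega> \<in> space M \<Longrightarrow> indicator A \<omega> \<le> \<xi> \<omega>"
  shows "Vhat A \<le> E \<xi>"
  unfolding V_hat_def using assms by (intro Inf_lower) auto

lemma Vhat_empty: "Vhat {} = 0"
  using Vhat_le[OF H_zero, of "{}"] Vhat_nonneg[of "{}"] by (intro antisym) (simp_all add: E_const flip: zero_ereal_def)

lemma enn2ereal_Vhat: "enn2ereal (e2ennreal (Vhat A)) = Vhat A"
  using Vhat_nonneg by (simp add: enn2ereal_e2ennreal)

lemma null_lower_eq_1:
  assumes "null (space M - A)" shows "V_hat_star_lower M H E A = 1"
proof -
  let ?v = "V_hat_star M H E (space M - A)"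
  have "0 \<le> ?v" unfolding V_hat_star_def
  proof (rule Inf_greatest, elim CollectE exE conjE)
    fix x and B :: "nat \<Rightarrow> 'a set" assume "x = (\<Sum>n. Vhat (B n))"
    then show "0 \<le> x" using suminf_0_le[of "\<lambda>n. Vhat (B n)"] Vhat_nonneg by simp
  qed
  moreover have "?v \<le> ereal \<epsilon>" if "0 < \<epsilon>" for \<epsilon> :: real
  proof -
    obtain B where B: "\<forall>n::nat. B n \<in> sets M" "space M - A \<subseteq> (\<Union>n. B n)"
      "(\<Sum>n. e2ennreal (Vhat (B n))) \<le> ennreal \<epsilon>"
      using assms \<open>0 < \<epsilon>\<close> unfolding null_def by blast
    have "?v \<le> (\<Sum>n. Vhat (B n))"
      unfolding V_hat_star_def using B(1,2) by (intro Inf_lower) blast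
    also have "\<dots> = enn2ereal (\<Sum>n. e2ennreal (Vhat (B n)))"
      by (simp flip: suminf_enn2ereal add: enn2ereal_Vhat)
    also have "\<dots> \<le> enn2ereal (ennreal \<epsilon>)" using B(3) by (simp add: less_eq_ennreal.rep_eq)
    finally show ?thesis using that by simp
  qed
  then have "?v \<le> 0" using ereal_le_epsilon2[of ?v 0] by simp
  ultimately have "?v = 0" by (rule antisym[rotated])
  then show ?thesis by (simp add: V_hat_star_lower_def)
qed

lemma null_mono: "null B \<Longrightarrow> A \<subseteq> B \<Longrightarrow> null A"
  unfolding null_def by (metis subset_trans)

lemma null_UN:
  fixes A :: "nat \<Rightarrow> 'a set"
  assumes "\<And>i. null (A i)" shows "null (\<Union>i. A i)"
  unfolding null_def
proof (intro allI impI)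
  fix \<epsilon> :: real assume "0 < \<epsilon>"
  have "\<exists>B. (\<forall>n::nat. B n \<in> sets M) \<and> A i \<subseteq> (\<Union>n. B n) \<and>
      (\<Sum>n. e2ennreal (Vhat (B n))) \<le> ennreal (\<epsilon> * (1/2) ^ Suc i)" for i
    by (rule assms[of i, unfolded null_def, rule_format]) (use \<open>0 < \<epsilon>\<close> in simp)
  then obtain B where B: "\<And>i n::nat. B i n \<in> sets M" "\<And>i. A i \<subseteq> (\<Union>n. B i n)"
      "\<And>i. (\<Sum>n. e2ennreal (Vhat (B i n))) \<le> ennreal (\<epsilon> * (1/2) ^ Suc i)"
    by metis
  let ?C = "\<lambda>k. B (fst (prod_decode k)) (snd (prod_decode k))"
  have "(\<Union>i. A i) \<subseteq> (\<Union>k. ?C k)"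
  proof
    fix \<omega> assume "\<omega> \<in> (\<Union>i. A i)"
    then obtain i n where "\<omega> \<in> B i n" using B(2) by blast
    then have "\<omega> \<in> ?C (prod_encode (i, n))" by simp
    then show "\<omega> \<in> (\<Union>k. ?C k)" by blast
  qed
  moreover have "(\<Sum>k. e2ennreal (Vhat (?C k))) \<le> ennreal \<epsilon>"
  proof -
    have "(\<Sum>k. e2ennreal (Vhat (?C k))) = (\<Sum>i. \<Sum>n. e2ennreal (Vhat (B i n)))"
      using suminf_ennreal_2dimen[of "\<lambda>i. \<Sum>n. e2ennreal (Vhat (B i n))" "\<lambda>p. e2ennreal (Vhat (B (fst p) (snd p)))"]
      by simp
    moreover have "\<dots> \<le> (\<Sum>i. ennreal (\<epsilon> * (1/2) ^ Suc i))"
      by (rule suminf_le[OF B(3)]) simp_all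
    moreover have "\<dots> = ennreal \<epsilon>"
      using sums_mult[OF power_half_series, of \<epsilon>] \<open>0 < \<epsilon>\<close>
      by (intro suminf_ennreal_eq) simp_all
    ultimately show ?thesis by simp
  qed
  ultimately show "\<exists>C. (\<forall>k::nat. C k \<in> sets M) \<and> (\<Union>i. A i) \<subseteq> (\<Union>k. C k) \<and>
      (\<Sum>k. e2ennreal (Vhat (C k))) \<le> ennreal \<epsilon>"
    using B(1) by (intro exI[of _ ?C] conjI allI) blast+
qed

lemma null_Un: "null A \<Longrightarrow> null B \<Longrightarrow> null (A \<union> B)"
  using null_UN[of "\<lambda>i. if i = 0 then A else B"] by (rule null_mono) auto

text \<open>The events from some index on already form a countable cover of the limsup event, and
  its cost is a tail of a convergent series. No countable sub-additivity of \<open>Vhat\<close>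
  enters.\<close>

lemma null_Borel_Cantelli:
  assumes A: "\<And>n. n \<ge> start \<Longrightarrow> A n \<in> sets M \<and> Vhat (A n) \<le> ereal (a n)" and a: "summable a"
  shows "null {\<omega>. \<exists>\<^sub>\<infinity>n. \<omega> \<in> A n}"
  unfolding null_def
proof (intro allI impI)
  fix \<epsilon> :: real assume "0 < \<epsilon>"
  have a0: "0 \<le> a n" if "n \<ge> start" for n
    using order_trans[OF Vhat_nonneg, of "A n" "ereal (a n)"] A[OF that] by simp
  obtain N where N: "\<And>m. m \<ge> N \<Longrightarrow> \<bar>\<Sum>i. a (i + m)\<bar> < \<epsilon>"
    using suminf_exist_split[OF \<open>0 < \<epsilon>\<close> a] by auto
  define m where "m = max start N"
  have "(\<Sum>i. e2ennreal (Vhat (A (i + m)))) \<le> (\<Sum>i. ennreal (a (i + m)))"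
  proof (intro suminf_le)
    show "e2ennreal (Vhat (A (i + m))) \<le> ennreal (a (i + m))" for i
      using e2ennreal_mono[of "Vhat (A (i + m))" "ereal (a (i + m))"] A[of "i + m"]
      by (simp add: m_def)
  qed auto
  also have "\<dots> = ennreal (\<Sum>i. a (i + m))"
    using a0 a by (intro suminf_ennreal2) (auto simp: m_def summable_iff_shift)
  also have "\<dots> \<le> ennreal \<epsilon>" using N[of m] by (intro ennreal_leI) (auto simp: m_def)
  finally have "(\<Sum>i. e2ennreal (Vhat (A (i + m)))) \<le> ennreal \<epsilon>" .
  moreover have "{\<omega>. \<exists>\<^sub>\<infinity>n. \<omega> \<in> A n} \<subseteq> (\<Union>i. A (i + m))"
  proof
    fix \<omega> assume "\<omega> \<in> {\<omega>. \<exists>\<^sub>\<infinity>n. \<omega> \<in> A n}"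
    then obtain n where "m \<le> n" "\<omega> \<in> A n" by (auto simp: INFM_nat_le)
    then show "\<omega> \<in> (\<Union>i. A (i + m))" by (intro UN_I[of "n - m"]) auto
  qed
  ultimately show "\<exists>B. (\<forall>n::nat. B n \<in> sets M) \<and> {\<omega>. \<exists>\<^sub>\<infinity>n. \<omega> \<in> A n} \<subseteq> (\<Union>n. B n) \<and>
      (\<Sum>n. e2ennreal (Vhat (B n))) \<le> ennreal \<epsilon>"
    using A by (intro exI[of _ "\<lambda>i. A (i + m)"] conjI allI) (auto simp: m_def)
qed

text \<open>Borel-Cantelli for the constant sequence \<open>A\<close> with bounds 0: its limsup
  event is \<open>A\<close> itself.\<close>

lemma null_of_Vhat_small:
  assumes "A \<in> sets M" "\<And>\<epsilon>. 0 < \<epsilon> \<Longrightarrow> Vhat A \<le> ereal \<epsilon>"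
  shows "null A"
proof -
  have "Vhat A \<le> 0"
  proof (rule ereal_le_epsilon2)
    show "Vhat A \<le> 0 + ereal \<epsilon>" if "0 < \<epsilon>" for \<epsilon> using assms(2)[OF that] by simp
  qed
  then have "null {\<omega>. \<exists>\<^sub>\<infinity>n::nat. \<omega> \<in> A}"
    using assms(1) by (intro null_Borel_Cantelli[where a = "\<lambda>_. 0" and start = 0]) (simp_all flip: zero_ereal_def)
  then show ?thesis by (rule null_mono) (auto simp only: INFM_const mem_Collect_eq)
qed

section \<open>The expectation on bounded random variables\<close>

text \<open>On this class \<open>E\<close> is finite (\<open>E_ER\<close>), so \<open>ER\<close>
  loses nothing and sub-additivity needs no exclusion of infinity minus infinity.\<close>

definition Hb :: "('a \<Rightarrow> real) set" where
  "Hb = {X \<in> H. \<exists>K. \<forall>\<omega>. \<bar>X \<omega>\<bar> \<le> K}"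

definition ER :: "('a \<Rightarrow> real) \<Rightarrow> real" where
  "ER X = real_of_ereal (E X)"

lemma bl_path_Hb:
  assumes "f \<in> bl (path_dist n)" "\<And>i. i < n \<Longrightarrow> Z i \<in> H"
  shows "(\<lambda>\<omega>. f (\<lambda>i. Z i \<omega>)) \<in> Hb"
  using H_C_lLip[where Z = Z, OF assms(2) bl_path_C_lLip[OF assms(1)]] bl_bounds[OF assms(1)]
  unfolding Hb_def by blast

lemma bl_line_Hb:
  assumes "f \<in> bl line_dist" "X \<in> H" shows "(\<lambda>\<omega>. f (X \<omega>)) \<in> Hb"
proof -
  have "(\<lambda>x. f (x 0)) \<in> bl (path_dist 1)"
    using bl_lipschitz_compose[OF assms(1), of "\<lambda>x. x 0" 1 "path_dist 1"] by (simp add: path_dist_def)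
  from bl_path_Hb[OF this, of "\<lambda>_. X"] show ?thesis using assms(2) by simp
qed

text \<open>A constant is a test function of zero random variables.\<close>

lemma const_H: "(\<lambda>_. c) \<in> H"
  using H_C_lLip[of 0 undefined "\<lambda>_. c"] bl_path_C_lLip[OF bl_const] by auto

lemma E_ER:
  assumes "X \<in> Hb" shows "E X = ereal (ER X)"
proof -
  obtain K where X: "X \<in> H" and K: "\<And>\<omega>. \<bar>X \<omega>\<bar> \<le> K" using assms by (auto simp: Hb_def)
  have "X \<omega> \<le> K" "- K \<le> X \<omega>" for \<omega> using K[of \<omega>] by auto
  then have "E X \<le> E (\<lambda>_. K)" "E (\<lambda>_. - K) \<le> E X" using X const_H by (auto intro!: E_mono)
  then show ?thesis unfolding ER_def E_const by (cases "E X") auto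
qed

lemma ER_mono:
  assumes "X \<in> Hb" "Z \<in> Hb" "\<And>\<omega>. \<omega> \<in> space M \<Longrightarrow> X \<omega> \<le> Z \<omega>" shows "ER X \<le> ER Z"
proof -
  have "E X \<le> E Z" using assms by (intro E_mono) (auto simp: Hb_def)
  then show ?thesis using assms by (simp add: E_ER)
qed

lemma ER_add:
  assumes "X \<in> Hb" "Z \<in> Hb" shows "ER (\<lambda>\<omega>. X \<omega> + Z \<omega>) \<le> ER X + ER Z"
proof -
  obtain K L where KL: "\<And>\<omega>. \<bar>X \<omega>\<bar> \<le> K" "\<And>\<omega>. \<bar>Z \<omega>\<bar> \<le> L" using assms by (auto simp: Hb_def)
  have "\<bar>X \<omega> + Z \<omega>\<bar> \<le> K + L" for \<omega> using KL(1)[of \<omega>] KL(2)[of \<omega>] by linarith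
  moreover have H: "X \<in> H" "Z \<in> H" using assms by (auto simp: Hb_def)
  ultimately have "(\<lambda>\<omega>. X \<omega> + Z \<omega>) \<in> Hb" using H_add unfolding Hb_def by blast
  moreover have "E (\<lambda>\<omega>. X \<omega> + Z \<omega>) \<le> E X + E Z"
    using H by (intro E_subadd) (simp_all add: E_ER assms)
  ultimately show ?thesis using assms by (simp add: E_ER)
qed

lemma ER_cmult:
  assumes "X \<in> Hb" "0 \<le> c" shows "ER (\<lambda>\<omega>. c * X \<omega>) = c * ER X"
proof -
  have "E (\<lambda>\<omega>. c * X \<omega>) = ereal c * E X"
    using assms by (intro E_pos_homogeneous) (auto simp: Hb_def)
  then show ?thesis by (simp add: ER_def)
qed

lemma ER_const [simp]: "ER (\<lambda>_. c) = c"
  by (simp add: ER_def E_const)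

end

section \<open>Independent identically distributed sequences\<close>

lemma bl_lipschitz_on:
  assumes "f \<in> bl line_dist"
  shows "bounded (range f)" "\<exists>L. L-lipschitz_on UNIV f"
proof -
  obtain K where K: "0 \<le> K" "\<And>x. \<bar>f x\<bar> \<le> K" "\<And>x y. \<bar>f x - f y\<bar> \<le> K * \<bar>line_dist x y\<bar>"
    using bl_bounds[OF assms] by blast
  show "bounded (range f)" using K(2) by (auto simp: bounded_iff)
  have "K-lipschitz_on UNIV f"
    using K(1,3) by (intro lipschitz_onI) (auto simp: dist_real_def line_dist_def)
  then show "\<exists>L. L-lipschitz_on UNIV f" by blast
qed

lemma path_dist_upd:
  "path_dist (Suc j) (x(j := t)) (y(j := t)) = path_dist j x y"
  unfolding path_dist_def by simp

locale iid_seq = sublinear_expectation_space M H E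
  for M :: "'a measure" and H :: "('a \<Rightarrow> real) set" and E :: "('a \<Rightarrow> real) \<Rightarrow> ereal" +
  fixes Y :: "nat \<Rightarrow> 'a \<Rightarrow> real"
  assumes Y_H: "1 \<le> n \<Longrightarrow> Y n \<in> H"
    and Y_independent: "independent_seq H E Y"
    and Y_identical: "identically_distributed_seq E Y"
begin

text \<open>Sequences start at 1 and coordinates at 0, hence the shift: \<open>path_dist n\<close>
  sees exactly \<open>Y 1\<close> to \<open>Y n\<close>.\<close>

abbreviation path :: "'a \<Rightarrow> nat \<Rightarrow> real" where
  "path \<omega> \<equiv> (\<lambda>i. Y (Suc i) \<omega>)"

definition e :: "(real \<Rightarrow> real) \<Rightarrow> real" where
  "e f = ER (\<lambda>\<omega>. f (Y 1 \<omega>))"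

definition e_path :: "((nat \<Rightarrow> real) \<Rightarrow> real) \<Rightarrow> real" where
  "e_path \<phi> = ER (\<lambda>\<omega>. \<phi> (path \<omega>))"

lemma path_Hb: "\<phi> \<in> bl (path_dist n) \<Longrightarrow> (\<lambda>\<omega>. \<phi> (path \<omega>)) \<in> Hb"
  by (rule bl_path_Hb) (simp_all add: Y_H)

lemma Y_Hb: "f \<in> bl line_dist \<Longrightarrow> 1 \<le> n \<Longrightarrow> (\<lambda>\<omega>. f (Y n \<omega>)) \<in> Hb"
  by (rule bl_line_Hb) (simp_all add: Y_H)

lemma e_mono: "f \<in> bl line_dist \<Longrightarrow> g \<in> bl line_dist \<Longrightarrow> (\<And>y. f y \<le> g y) \<Longrightarrow> e f \<le> e g"
  unfolding e_def by (intro ER_mono Y_Hb) simp_all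

lemma e_add: "f \<in> bl line_dist \<Longrightarrow> g \<in> bl line_dist \<Longrightarrow> e (\<lambda>y. f y + g y) \<le> e f + e g"
  unfolding e_def by (intro ER_add Y_Hb) simp_all

lemma e_cmult: "f \<in> bl line_dist \<Longrightarrow> 0 \<le> c \<Longrightarrow> e (\<lambda>y. c * f y) = c * e f"
  unfolding e_def by (intro ER_cmult Y_Hb) simp_all

lemma e_const [simp]: "e (\<lambda>_. c) = c"
  by (simp add: e_def)

lemma e_add_const:
  assumes "f \<in> bl line_dist" shows "e (\<lambda>y. c + f y) = c + e f"
proof (rule antisym)
  show "e (\<lambda>y. c + f y) \<le> c + e f" using e_add[OF bl_const assms, of c] by simp
  have "e (\<lambda>y. - c + (c + f y)) \<le> - c + e (\<lambda>y. c + f y)"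
    using e_add[of "\<lambda>_. - c" "\<lambda>y. c + f y"] assms by (simp add: bl_add)
  then show "c + e f \<le> e (\<lambda>y. c + f y)" by simp
qed

lemma e_uminus:
  assumes "f \<in> bl line_dist" shows "- e (\<lambda>y. - f y) \<le> e f"
  using e_add[OF assms bl_uminus[OF assms]] by simp

lemma e_lipschitz:
  assumes "f \<in> bl line_dist" "g \<in> bl line_dist" "\<And>y. \<bar>f y - g y\<bar> \<le> c"
  shows "\<bar>e f - e g\<bar> \<le> c"
proof -
  have "f y \<le> c + g y" "g y \<le> c + f y" for y using assms(3)[of y] by (auto simp: abs_le_iff)
  then have "e f \<le> e (\<lambda>y. c + g y)" "e g \<le> e (\<lambda>y. c + f y)"
    using assms(1,2) by (auto intro!: e_mono bl_add)
  then show ?thesis using e_add_const[OF assms(1), of c] e_add_const[OF assms(2), of c] by (simp add: abs_le_iff)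
qed

lemma e_path_const [simp]: "e_path (\<lambda>_. c) = c"
  by (simp add: e_path_def)

lemma e_path_mono:
  assumes "\<phi> \<in> bl (path_dist n)" "\<psi> \<in> bl (path_dist n)" "\<And>x. \<phi> x \<le> \<psi> x"
  shows "e_path \<phi> \<le> e_path \<psi>"
  unfolding e_path_def using assms by (intro ER_mono path_Hb) auto

lemma Y_distr:
  assumes "f \<in> bl line_dist" "1 \<le> n" shows "ER (\<lambda>\<omega>. f (Y n \<omega>)) = e f"
proof -
  have "E (\<lambda>\<omega>. f (Y n \<omega>)) = E (\<lambda>\<omega>. f (Y 1 \<omega>))"
    using Y_identical assms(2) bl_lipschitz_on[OF assms(1)] unfolding identically_distributed_seq_def by blast
  then show ?thesis by (simp add: ER_def e_def)
qed

lemma inner_bl: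
  assumes "\<phi> \<in> bl (path_dist (Suc j))"
  shows "(\<lambda>x. e (\<lambda>t. \<phi> (x(j := t)))) \<in> bl (path_dist j)"
proof -
  obtain K where K: "0 \<le> K" "\<And>x. \<bar>\<phi> x\<bar> \<le> K" "\<And>x y. \<bar>\<phi> x - \<phi> y\<bar> \<le> K * \<bar>path_dist (Suc j) x y\<bar>"
    using bl_bounds[OF assms] by blast
  note bl = bl_path_slice[OF assms]
  show ?thesis
  proof (rule blI[where K = K and L = K])
    show "\<bar>e (\<lambda>t. \<phi> (x(j := t))) - e (\<lambda>t. \<phi> (y(j := t)))\<bar> \<le> K * \<bar>path_dist j x y\<bar>" for x y
    proof (rule e_lipschitz[OF bl bl])
      show "\<bar>\<phi> (x(j := t)) - \<phi> (y(j := t))\<bar> \<le> K * \<bar>path_dist j x y\<bar>" for t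
        using K(3)[of "x(j := t)" "y(j := t)"] by (simp only: path_dist_upd)
    qed
    show "\<bar>e (\<lambda>t. \<phi> (x(j := t)))\<bar> \<le> K" for x
      using e_lipschitz[OF bl bl_const, of x 0 K] K(2) by simp
  qed
qed

text \<open>The membership conditions in \<open>independent_to\<close> hold because the inner
  expectations of \<phi> and of its absolute value are bounded Lipschitz in the first
  \<open>j\<close> coordinates.\<close>

lemma e_path_step:
  assumes \<phi>: "\<phi> \<in> bl (path_dist (Suc j))"
  shows "e_path \<phi> = e_path (\<lambda>x. e (\<lambda>t. \<phi> (x(j := t))))"
proof (cases "j = 0")
  case True
  \<comment> \<open>\<open>independent_seq\<close> says nothing about an empty past. Here \<phi>
    depends on coordinate 0 alone, so the inner expectation is a constant.\<close>
  have eq: "\<phi> x = \<phi> (y(0 := x 0))" for x y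
    by (rule bl_path_cong[OF \<phi>]) (simp add: True)
  have "e_path \<phi> = e (\<lambda>t. \<phi> ((\<lambda>_. 0)(0 := t)))"
    unfolding e_path_def e_def by (subst eq[where y = "\<lambda>_. 0"]) simp
  moreover have "(\<lambda>t. \<phi> (x(0 := t))) = (\<lambda>t. \<phi> ((\<lambda>_. 0)(0 := t)))" for x
    by (rule ext, subst eq[where y = "\<lambda>_. 0"]) simp
  then have "(\<lambda>x. e (\<lambda>t. \<phi> (x(j := t)))) = (\<lambda>x. e (\<lambda>t. \<phi> ((\<lambda>_. 0)(0 := t))))"
    unfolding True by metis
  then have "e_path (\<lambda>x. e (\<lambda>t. \<phi> (x(j := t)))) = e_path (\<lambda>x. e (\<lambda>t. \<phi> ((\<lambda>_. 0)(0 := t))))"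
    by (rule arg_cong)
  then have "e_path (\<lambda>x. e (\<lambda>t. \<phi> (x(j := t)))) = e (\<lambda>t. \<phi> ((\<lambda>_. 0)(0 := t)))"
    by (simp only: e_path_const)
  ultimately show ?thesis by simp
next
  case False
  let ?Y = "\<lambda>_::nat. Y (j + 1)" and ?X = "\<lambda>i. Y (i + 1)"
  have app: "\<psi> (vec_append j x (\<lambda>i. t)) = \<psi> (x(j := t))" if "\<psi> \<in> bl (path_dist (Suc j))" for \<psi> x t
    by (rule bl_path_cong[OF that]) (auto simp: vec_append_def)
  have abs: "(\<lambda>x. \<bar>\<phi> x\<bar>) \<in> bl (path_dist (Suc j))"
  proof -
    have "(\<lambda>x. max (\<phi> x) (- \<phi> x)) \<in> bl (path_dist (Suc j))" by (intro bl_max bl_uminus \<phi>)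
    then show ?thesis by (simp add: abs_real_def max_def if_distrib cong: if_cong) (smt (verit) bl_def mem_Collect_eq)
  qed
  have inner: "E (\<lambda>\<omega>. \<psi> (vec_append j x (\<lambda>i. ?Y i \<omega>))) = ereal (e (\<lambda>t. \<psi> (x(j := t))))"
    if "\<psi> \<in> bl (path_dist (Suc j))" for \<psi> x
    unfolding app[OF that] using E_ER[OF Y_Hb[OF bl_path_slice[OF that], of "j + 1" x]]
      Y_distr[OF bl_path_slice[OF that], of "j + 1" x] by simp
  have ind: "independent_to H E 1 ?Y j ?X"
    using Y_independent False by (simp add: independent_seq_def)
  have C: "\<phi> \<in> C_lLip (j + 1)" using bl_path_C_lLip[OF \<phi>] by simp
  have pH: "(\<lambda>\<omega>. \<psi> (\<lambda>i. ?X i \<omega>)) \<in> Hb" if "\<psi> \<in> bl (path_dist j)" for \<psi>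
    using path_Hb[OF that] by simp
  note bA = inner_bl[OF abs] and bI = inner_bl[OF \<phi>]
  let ?A = "\<lambda>x. e (\<lambda>t. \<bar>\<phi> (x(j := t))\<bar>)" and ?I = "\<lambda>x. e (\<lambda>t. \<phi> (x(j := t)))"
  have pos: "0 \<le> ?A x" for x
    using e_mono[OF bl_const[of 0] bl_path_slice[OF abs, of x]] by simp
  have "E (\<lambda>\<omega>. \<phi> (vec_append j (\<lambda>i. ?X i \<omega>) (\<lambda>i. ?Y i \<omega>))) = E (\<lambda>\<omega>. ?I (\<lambda>i. ?X i \<omega>))"
    using ind[unfolded independent_to_def Let_def, THEN conjunct2, THEN conjunct2, rule_format, OF C]
      pH[OF bA] pH[OF bI] E_ER[OF pH[OF bA]]
    unfolding inner[OF abs] inner[OF \<phi>] by (simp add: Hb_def pos)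
  moreover have "\<phi> (vec_append j (\<lambda>i. ?X i \<omega>) (\<lambda>i. ?Y i \<omega>)) = \<phi> (path \<omega>)" for \<omega>
    by (rule bl_path_cong[OF \<phi>]) (auto simp: vec_append_def less_Suc_eq)
  ultimately show ?thesis unfolding e_path_def ER_def by simp
qed

lemma e_path_supermartingale:
  assumes "m \<le> n" and bl: "\<And>j. m \<le> j \<Longrightarrow> j \<le> n \<Longrightarrow> \<phi> j \<in> bl (path_dist j)"
    and step: "\<And>j x. m \<le> j \<Longrightarrow> j < n \<Longrightarrow> e (\<lambda>t. \<phi> (Suc j) (x(j := t))) \<le> \<phi> j x"
  shows "e_path (\<phi> n) \<le> e_path (\<phi> m)"
  using assms
proof (induction n rule: dec_induct)
  case base then show ?case by simp
next
  case (step k)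
  have bl: "\<phi> j \<in> bl (path_dist j)" if "m \<le> j" "j \<le> Suc k" for j using step.prems(1) that by blast
  have \<phi>: "\<phi> (Suc k) \<in> bl (path_dist (Suc k))" "\<phi> k \<in> bl (path_dist k)"
    using bl step.hyps by auto
  have "e_path (\<phi> (Suc k)) = e_path (\<lambda>x. e (\<lambda>t. \<phi> (Suc k) (x(k := t))))" by (rule e_path_step[OF \<phi>(1)])
  also have "\<dots> \<le> e_path (\<phi> k)"
    by (rule e_path_mono[OF inner_bl[OF \<phi>(1)] \<phi>(2)]) (use step.prems(2) step.hyps in blast)
  also have "\<dots> \<le> e_path (\<phi> m)" by (rule step.IH) (use step.prems in auto)
  finally show ?case .
qed

lemma Vhat_le_e_path:
  assumes "\<phi> \<in> bl (path_dist n)" "\<And>\<omega>. \<omega> \<in> space M \<Longrightarrow> indicator A \<omega> \<le> \<phi> (path \<omega>)"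
  shows "Vhat A \<le> ereal (e_path \<phi>)"
  using Vhat_le[of "\<lambda>\<omega>. \<phi> (path \<omega>)" A] path_Hb[OF assms(1)] assms(2) E_ER[OF path_Hb[OF assms(1)]]
  by (simp add: Hb_def e_path_def)

lemma Vhat_le_e:
  assumes "f \<in> bl line_dist" "1 \<le> n" "\<And>\<omega>. \<omega> \<in> space M \<Longrightarrow> indicator A \<omega> \<le> f (Y n \<omega>)"
  shows "Vhat A \<le> ereal (e f)"
  using Vhat_le[of "\<lambda>\<omega>. f (Y n \<omega>)" A] Y_Hb[OF assms(1,2)] assms(3) E_ER[OF Y_Hb[OF assms(1,2)]]
    Y_distr[OF assms(1,2)]
  by (simp add: Hb_def)

end

section \<open>The norming sequence\<close>

abbreviation llog :: "real \<Rightarrow> real" where "llog t \<equiv> clog (clog t)"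

lemma max_exp_pos [simp]: "0 < max (exp 1) (x::real)"
  by (simp add: less_max_iff_disj)

lemma clog_ge_1: "1 \<le> clog x"
proof -
  have "ln (exp 1) \<le> ln (max (exp 1) x)" by (subst ln_le_cancel_iff) auto
  then show ?thesis by (simp add: clog_def)
qed

lemma clog_mono: "x \<le> y \<Longrightarrow> clog x \<le> clog y"
  unfolding clog_def by (subst ln_le_cancel_iff) auto

text \<open>From \<open>ln r \<le> r - 1\<close> and \<open>1 \<le> clog s\<close>. A linear bound
  is crude for a logarithm, but it reproduces its own form and can therefore be iterated, which
  gives \<open>llog_scale\<close>.\<close>

lemma clog_scale:
  assumes "1 \<le> r" shows "clog (r * s) \<le> r * clog s"
proof -
  have pos: "0 < max (exp 1) s" by (meson exp_gt_zero less_max_iff_disj)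
  have "max (exp 1) (r * s) \<le> r * max (exp 1) s"
  proof (rule max.boundedI)
    have "1 * exp 1 \<le> r * max (exp 1) s" by (rule mult_mono) (use assms in auto)
    then show "exp 1 \<le> r * max (exp 1) s" by simp
    show "r * s \<le> r * max (exp 1) s" by (rule mult_left_mono) (use assms in auto)
  qed
  then have "clog (r * s) \<le> ln (r * max (exp 1) s)"
    unfolding clog_def by (subst ln_le_cancel_iff) (use assms pos in auto)
  also have "\<dots> = ln r + clog s" unfolding clog_def by (rule ln_mult_pos) (use assms pos in auto)
  also have "\<dots> \<le> (r - 1) + clog s" using assms ln_le_minus_one[of r] by simp
  also have "\<dots> \<le> (r - 1) * clog s + clog s"
    using mult_left_mono[OF clog_ge_1[of s], of "r - 1"] assms by simp
  finally show ?thesis by (simp add: algebra_simps)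
qed

lemma llog_scale:
  assumes "1 \<le> r" shows "llog (r * s) \<le> r * llog s"
  using clog_mono[OF clog_scale[OF assms]] clog_scale[OF assms] by (rule order_trans)

lemma llog_ge_1: "1 \<le> llog x" by (rule clog_ge_1)

lemma llog_pos: "0 < llog x" using llog_ge_1[of x] by linarith

lemma llog_mono: "x \<le> y \<Longrightarrow> llog x \<le> llog y" by (intro clog_mono)

text \<open>If \<open>t = r * s\<close>, the square grows by \<open>r\<^sup>2\<close> while
  \<open>llog\<close> grows by at most \<open>r\<close>. It turns a lower bound on \<bar>Y\<bar>
  into one on the integrand of the Choquet condition.\<close>

lemma square_div_llog_mono:
  assumes "0 \<le> s" "s \<le> t" shows "s\<^sup>2 / llog s \<le> t\<^sup>2 / llog t"
proof (cases "s = 0")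
  case True then show ?thesis using llog_pos[of t] by simp
next
  case False
  then have s: "0 < s" using assms by simp
  define r where "r = t / s"
  have r: "1 \<le> r" "t = r * s" using s assms by (auto simp: r_def field_simps)
  have "s\<^sup>2 / llog s \<le> r * (s\<^sup>2 / llog s)"
    using mult_right_mono[OF r(1), of "s\<^sup>2 / llog s"] llog_pos[of s] by simp
  also have "\<dots> = t\<^sup>2 / (r * llog s)" using r s llog_pos[of s] by (simp add: power2_eq_square field_simps)
  also have "\<dots> \<le> t\<^sup>2 / llog t"
    using llog_scale[OF r(1), of s] llog_pos[of t] r(2) by (intro divide_left_mono) (auto intro!: mult_pos_pos llog_pos simp: r(1) less_le_trans[OF zero_less_one r(1)])
  finally show ?thesis .
qed

lemma lil_norm_sq: "(lil_norm n)\<^sup>2 = 2 * real n * llog (real n)"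
  unfolding lil_norm_def using llog_pos[of "real n"] by (subst real_sqrt_pow2) auto

lemma lil_norm_nonneg: "0 \<le> lil_norm n"
  unfolding lil_norm_def using llog_pos[of "real n"] by simp

lemma lil_norm_pos: "1 \<le> n \<Longrightarrow> 0 < lil_norm n"
  unfolding lil_norm_def using llog_pos[of "real n"] by simp

lemma lil_norm_0 [simp]: "lil_norm 0 = 0"
  unfolding lil_norm_def by simp

lemma lil_norm_mono: "m \<le> n \<Longrightarrow> lil_norm m \<le> lil_norm n"
  unfolding lil_norm_def using llog_mono[of "real m" "real n"] llog_pos[of "real m"]
  by (intro real_sqrt_le_mono mult_mono) auto

text \<open>After squaring, the linear factor contributes \<open>n / m\<close> and
  \<open>llog\<close> at most another \<open>n / m\<close>.\<close>

lemma lil_norm_scale: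
  assumes "1 \<le> m" "m \<le> n" shows "lil_norm n \<le> real n / real m * lil_norm m"
proof -
  have r: "1 \<le> real n / real m" "real n = (real n / real m) * real m" using assms by auto
  have "(lil_norm n)\<^sup>2 = 2 * real n * llog ((real n / real m) * real m)" unfolding lil_norm_sq using r(2) by simp
  also have "\<dots> \<le> 2 * real n * ((real n / real m) * llog (real m))"
    by (rule mult_left_mono[OF llog_scale[OF r(1)]]) simp
  also have "\<dots> = (real n / real m * lil_norm m)\<^sup>2"
    unfolding power_mult_distrib lil_norm_sq using assms by (simp add: power2_eq_square)
  finally show ?thesis by (rule power2_le_imp_le) (simp add: lil_norm_nonneg)
qed

lemma lil_norm_le: "1 \<le> n \<Longrightarrow> lil_norm n \<le> sqrt 2 * real n"
proof -
  assume n: "1 \<le> n"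
  have "llog 1 = 1" unfolding clog_def by (simp add: max_def)
  then have "llog (real n) \<le> real n" using llog_scale[of "real n" 1] n by simp
  then have "(lil_norm n)\<^sup>2 \<le> (sqrt 2 * real n)\<^sup>2"
    unfolding lil_norm_sq power_mult_distrib
    using mult_left_mono[of "llog (real n)" "real n" "2 * real n"] by (simp add: power2_eq_square)
  then show ?thesis by (rule power2_le_imp_le) simp
qed

text \<open>As \<open>lil_norm n \<le> sqrt 2 * n\<close>, its \<open>llog\<close> is at most twice
  \<open>llog n\<close>, which the factor 2 in the squared norm absorbs exactly.\<close>

lemma lil_norm_square_div_llog:
  assumes "1 \<le> n" shows "real n \<le> (lil_norm n)\<^sup>2 / llog (lil_norm n)"
proof -
  have s2: "1 \<le> sqrt 2" "sqrt 2 \<le> 2" using real_sqrt_le_mono[of 2 4] by auto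
  have "llog (lil_norm n) \<le> llog (sqrt 2 * real n)" by (intro llog_mono lil_norm_le assms)
  also have "\<dots> \<le> sqrt 2 * llog (real n)" using llog_scale s2(1) by blast
  also have "\<dots> \<le> 2 * llog (real n)" using s2(2) llog_pos[of "real n"] by simp
  finally have "real n * llog (lil_norm n) \<le> real n * (2 * llog (real n))" by (intro mult_left_mono) auto
  then show ?thesis unfolding lil_norm_sq using llog_pos[of "lil_norm n"] by (simp add: field_simps)
qed

text \<open>The correction \<open>- 1 / N\<close> makes the bound inductive, since
  \<open>1 / N - 1 / (N + 1)\<close> dominates the next term.\<close>

lemma sum_inverse_squares_le:
  assumes "1 \<le> m" "m \<le> N" shows "(\<Sum>n=m..N. 1 / (real n)\<^sup>2) \<le> 2 / real m - 1 / real N"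
  using assms(2)
proof (induction N rule: dec_induct)
  case base
  have "1 / (real m)\<^sup>2 \<le> 1 / real m" using assms(1) by (simp add: power2_eq_square field_simps)
  then show ?case by simp
next
  case (step N)
  have "0 < real N" using step assms by simp
  then have "1 / (real (Suc N))\<^sup>2 \<le> 1 / real N - 1 / real (Suc N)"
    by (simp add: power2_eq_square divide_simps)
  then show ?case using step by simp
qed

text \<open>As \<open>llog\<close> is monotone, \<open>lil_norm n ^ 4\<close> grows at least like
  \<open>n\<^sup>2\<close>. The fourth power is essential here: the inverse squares of the norms
  have a divergent sum.\<close>

lemma sum_inverse_lil_norm_pow4:
  assumes "1 \<le> m" shows "(\<Sum>n=m..N. 1 / lil_norm n ^ 4) \<le> 2 * real m / lil_norm m ^ 4"
proof (cases "m \<le> N")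
  case True
  have "(\<Sum>n=m..N. 1 / lil_norm n ^ 4) \<le> (\<Sum>n=m..N. (real m)\<^sup>2 / lil_norm m ^ 4 * (1 / (real n)\<^sup>2))"
  proof (rule sum_mono)
    fix n assume n: "n \<in> {m..N}"
    have pw: "lil_norm k ^ 4 = (2 * real k * llog (real k))\<^sup>2" for k
      using lil_norm_sq[of k] by (metis power_mult mult_2 numeral_Bit0)
    have "(llog (real m))\<^sup>2 \<le> (llog (real n))\<^sup>2"
      using n llog_mono[of m n] llog_pos[of "real m"] by (intro power_mono) auto
    then have "(4 * (real m)\<^sup>2 * (real n)\<^sup>2) * (llog (real m))\<^sup>2 \<le> (4 * (real m)\<^sup>2 * (real n)\<^sup>2) * (llog (real n))\<^sup>2"
      by (intro mult_left_mono) auto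
    then have "lil_norm m ^ 4 * (real n)\<^sup>2 \<le> (real m)\<^sup>2 * lil_norm n ^ 4"
      unfolding pw power_mult_distrib by (simp add: ac_simps)
    then show "1 / lil_norm n ^ 4 \<le> (real m)\<^sup>2 / lil_norm m ^ 4 * (1 / (real n)\<^sup>2)"
      using n assms lil_norm_pos[of n] lil_norm_pos[of m] by (simp add: divide_simps mult.commute)
  qed
  also have "\<dots> = (real m)\<^sup>2 / lil_norm m ^ 4 * (\<Sum>n=m..N. 1 / (real n)\<^sup>2)" by (rule sum_distrib_left[symmetric])
  also have "\<dots> \<le> (real m)\<^sup>2 / lil_norm m ^ 4 * (2 / real m)"
    using sum_inverse_squares_le[OF assms True] by (intro mult_left_mono) (auto intro: order_trans)
  also have "\<dots> = 2 * real m / lil_norm m ^ 4" using assms by (simp add: power2_eq_square)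
  finally show ?thesis .
qed (simp add: lil_norm_nonneg)

text \<open>Scaling gives \<open>lil_norm (m - 1) \<ge> (1 - 1 / m) * lil_norm m\<close>, and
  Bernoulli's inequality bounds the fourth power. For \<open>m = 1\<close> the previous norm is 0
  and the factor 4 is ample.\<close>

lemma lil_norm_pow4_increment:
  assumes "1 \<le> m" shows "lil_norm m ^ 4 - lil_norm (m - 1) ^ 4 \<le> 4 / real m * lil_norm m ^ 4"
proof (cases "m = 1")
  case False
  let ?q = "(real m - 1) / real m"
  have m: "2 \<le> m" using False assms by simp
  have "?q * lil_norm m \<le> lil_norm (m - 1)"
    using lil_norm_scale[of "m - 1" m] m by (simp add: field_simps of_nat_diff)
  then have "(?q * lil_norm m) ^ 4 \<le> lil_norm (m - 1) ^ 4"
    using m lil_norm_nonneg by (intro power_mono) auto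
  moreover have "1 + real 4 * (- 1 / real m) \<le> (1 + (- 1 / real m)) ^ 4"
    using m by (intro Bernoulli_inequality) (simp add: field_simps)
  moreover have "1 + (- 1 / real m) = ?q" using m by (simp add: field_simps)
  ultimately have "(1 - 4 / real m) * lil_norm m ^ 4 \<le> lil_norm (m - 1) ^ 4"
    using mult_right_mono[of "1 - 4 / real m" "?q ^ 4" "lil_norm m ^ 4"] lil_norm_nonneg[of m]
    unfolding power_mult_distrib by simp
  then show ?thesis by (simp add: algebra_simps)
qed (simp add: lil_norm_nonneg)

text \<open>After exchanging the sums, the weight \<open>w m\<close> is multiplied by at most
  \<open>4 / m * d ^ 4\<close> times \<open>2 * m / d ^ 4\<close>, where
  \<open>d = lil_norm m\<close>; this is the 8. In the application \<open>w m\<close> is the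
  capacity of \<open>lil_norm (m - 1) \<le> \<bar>Y 1\<bar>\<close>.\<close>

lemma lil_norm_weighted_sum:
  assumes w: "\<And>m. 0 \<le> w m" and C: "\<And>N. (\<Sum>m=1..N. w m) \<le> C"
    and b: "\<And>n. 1 \<le> n \<Longrightarrow> b n \<le> (\<Sum>m=1..n. (lil_norm m ^ 4 - lil_norm (m - 1) ^ 4) * w m) / lil_norm n ^ 4"
  shows "(\<Sum>n=1..N. b n) \<le> 8 * C"
proof -
  let ?d = "\<lambda>m. lil_norm m ^ 4 - lil_norm (m - 1) ^ 4"
  have d0: "0 \<le> ?d m" for m
    using power_mono[OF lil_norm_mono[of "m - 1" m] lil_norm_nonneg, of 4] by simp
  have "(\<Sum>n=1..N. b n) \<le> (\<Sum>n=1..N. \<Sum>m=1..n. ?d m * w m * (1 / lil_norm n ^ 4))"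
    using b by (intro sum_mono) (simp add: sum_divide_distrib)
  also have "\<dots> = (\<Sum>m=1..N. \<Sum>n=m..N. ?d m * w m * (1 / lil_norm n ^ 4))"
    unfolding sum.Sigma[OF finite_atLeastAtMost ballI, OF finite_atLeastAtMost]
    by (rule sum.reindex_bij_witness[where i = prod.swap and j = prod.swap]) auto
  also have "\<dots> = (\<Sum>m=1..N. ?d m * w m * (\<Sum>n=m..N. 1 / lil_norm n ^ 4))"
    by (simp only: sum_distrib_left)
  also have "\<dots> \<le> (\<Sum>m=1..N. 8 * w m)"
  proof (rule sum_mono)
    fix m assume m: "m \<in> {1..N}"
    have pos: "0 < lil_norm m ^ 4" using m lil_norm_pos[of m] by simp
    have "?d m * w m * (\<Sum>n=m..N. 1 / lil_norm n ^ 4) \<le> ?d m * w m * (2 * real m / lil_norm m ^ 4)"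
      using d0 w sum_inverse_lil_norm_pow4[of m N] m by (intro mult_left_mono) auto
    also have "\<dots> \<le> (4 / real m * lil_norm m ^ 4) * w m * (2 * real m / lil_norm m ^ 4)"
      using lil_norm_pow4_increment[of m] m w pos by (intro mult_right_mono) auto
    also have "\<dots> = 8 * w m" using m pos by (simp add: field_simps)
    finally show "?d m * w m * (\<Sum>n=m..N. 1 / lil_norm n ^ 4) \<le> 8 * w m" .
  qed
  also have "\<dots> \<le> 8 * C" using C[of N] by (simp flip: sum_distrib_left)
  finally show ?thesis .
qed

lemma tendsto_SUP_at_top:
  fixes F :: "real \<Rightarrow> ereal"
  assumes "\<And>a b. 0 \<le> a \<Longrightarrow> a \<le> b \<Longrightarrow> F a \<le> F b"
  shows "(F \<longlongrightarrow> (SUP c\<in>{0..}. F c)) at_top"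
proof (rule increasing_tendsto)
  show "\<forall>\<^sub>F c in at_top. F c \<le> (SUP c\<in>{0..}. F c)"
    using eventually_ge_at_top[of 0] by eventually_elim (auto intro: SUP_upper)
  fix x assume "x < (SUP c\<in>{0..}. F c)"
  then obtain c0 where c0: "0 \<le> c0" "x < F c0" by (auto simp: less_SUP_iff)
  show "\<forall>\<^sub>F c in at_top. x < F c"
    using eventually_ge_at_top[of c0] by eventually_elim (use c0 assms in \<open>blast intro: less_le_trans\<close>)
qed

section \<open>Truncated moments\<close>

abbreviation clip :: "real \<Rightarrow> real \<Rightarrow> real" where "clip c y \<equiv> max (- c) (min y c)"

abbreviation capped :: "real \<Rightarrow> real \<Rightarrow> real" where "capped c y \<equiv> min \<bar>y\<bar> c"

lemma bl_capped [intro]: "0 \<le> c \<Longrightarrow> capped c \<in> bl line_dist"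
  by (rule blI[where K = c and L = 1]) (auto simp: line_dist_def)

lemma bl_clip [intro]: "0 \<le> c \<Longrightarrow> clip c \<in> bl line_dist"
  by (rule bl_line_trunc)

lemma abs_clip: "0 \<le> c \<Longrightarrow> \<bar>clip c y\<bar> = capped c y"
  by (auto simp: max_def min_def)

lemma clip_square: "0 \<le> c \<Longrightarrow> (clip c y)\<^sup>2 = (capped c y)\<^sup>2"
  using abs_clip[of c y] by (metis power2_abs)

lemma clip_pow4: "0 \<le> c \<Longrightarrow> (clip c y) ^ 4 = (capped c y) ^ 4"
  using clip_square[of c y] by (metis power_mult mult_2 numeral_Bit0)

lemma capped_square:
  assumes "0 \<le> c" shows "(capped c y)\<^sup>2 = min (y\<^sup>2) (c\<^sup>2)"
proof (cases "\<bar>y\<bar> \<le> c")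
  case True
  then have "y\<^sup>2 \<le> c\<^sup>2" using power_mono[OF True, of 2] by simp
  then show ?thesis using True by (simp add: min_absorb1)
next
  case False
  then have "c\<^sup>2 \<le> y\<^sup>2" using power_mono[of c "\<bar>y\<bar>" 2] assms by simp
  then show ?thesis using False by (simp add: min_absorb2)
qed

lemma excess_le_square:
  fixes t b :: real
  assumes "0 < b" shows "max 0 (t - b) \<le> t\<^sup>2 / b"
proof -
  have "0 \<le> (t - b / 2)\<^sup>2 + 3 / 4 * b\<^sup>2" by simp
  then have "(t - b) * b \<le> t\<^sup>2" by (simp add: power2_eq_square algebra_simps)
  then have "t - b \<le> t\<^sup>2 / b" using assms by (simp add: pos_le_divide_eq)
  then show ?thesis using assms by simp
qed

lemma excess_le_pow4:
  fixes t b :: real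
  assumes "0 < b" "0 \<le> t" shows "max 0 (t - b) \<le> t ^ 4 / b ^ 3"
proof (cases "t \<le> b")
  case False
  then have "b ^ 3 \<le> t ^ 3" using assms by (intro power_mono) auto
  then have "t * b ^ 3 \<le> t * t ^ 3" using assms by (intro mult_left_mono) auto
  moreover have "t * t ^ 3 = t ^ 4" by (simp add: eval_nat_numeral)
  ultimately have "t \<le> t ^ 4 / b ^ 3" using assms by (simp add: field_simps)
  then show ?thesis using assms False by simp
qed (use assms in auto)

text \<open>The hypotheses of the theorem in terms of bounded Lipschitz functions only, with real
  numbers \<open>S\<close> and \<open>s\<close> for the two variances. Both mean conditions are
  listed because \<open>e\<close> is not linear. The list is invariant under
  \<open>Y \<mapsto> - Y\<close> (\<open>lil_seq_uminus\<close>), so every limsup statement also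
  yields one for the liminf.\<close>

locale lil_seq = iid_seq +
  fixes S s :: real
  assumes capped_second_moment: "0 \<le> c \<Longrightarrow> e (\<lambda>y. (capped c y)\<^sup>2) \<le> S"
    and lower_second_moment: "((\<lambda>c. - e (\<lambda>y. - (capped c y)\<^sup>2)) \<longlongrightarrow> s) at_top"
    and mean_zero: "((\<lambda>c. e (clip c)) \<longlongrightarrow> 0) at_top"
    and mean_zero_uminus: "((\<lambda>c. e (\<lambda>y. - clip c y)) \<longlongrightarrow> 0) at_top"
    and summable_fourth_moments: "summable (\<lambda>n. e (\<lambda>y. (capped (lil_norm n) y) ^ 4) / lil_norm n ^ 4)"
begin

lemma S_nonneg: "0 \<le> S"
  using capped_second_moment[of 0] by (simp add: min_absorb2)

text \<open>The quantity \<open>\<beta>\<^sub>n\<close>, with the norm pulled out of the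
  expectation. At \<open>n = 0\<close> the division by zero makes it 0.\<close>

definition tail :: "nat \<Rightarrow> real" where
  "tail n = e (\<lambda>y. (capped (lil_norm n) y) ^ 4) / lil_norm n ^ 4"

lemma bl_capped_pow: "0 \<le> c \<Longrightarrow> (\<lambda>y. (capped c y) ^ k) \<in> bl line_dist"
  by (intro bl_power bl_capped)

lemma fourth_moment_nonneg: "0 \<le> c \<Longrightarrow> 0 \<le> e (\<lambda>y. (capped c y) ^ 4)"
  using e_mono[OF bl_const[of 0] bl_capped_pow[of c 4]] by simp

lemma tail_nonneg: "0 \<le> tail n"
  unfolding tail_def using fourth_moment_nonneg[OF lil_norm_nonneg[of n]] lil_norm_nonneg[of n] by simp

lemma summable_tail: "summable tail"
  unfolding tail_def by (rule summable_fourth_moments)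

lemma fourth_moment_eq: "1 \<le> n \<Longrightarrow> e (\<lambda>y. (capped (lil_norm n) y) ^ 4) = lil_norm n ^ 4 * tail n"
  unfolding tail_def using lil_norm_pos[of n] by simp

lemma e_cmult_pow: "0 \<le> c \<Longrightarrow> 0 \<le> a \<Longrightarrow> e (\<lambda>y. a * (capped c y) ^ k) = a * e (\<lambda>y. (capped c y) ^ k)"
  by (intro e_cmult bl_capped_pow)

text \<open>The two truncations differ by at most the excess of \<open>capped c y\<close> over
  \<open>b\<close>, which is dominated by a multiple of a power. The sign \<sigma> treats
  \<open>Y\<close> and \<open>- Y\<close> at once; the powers used are 2 and 4.\<close>

lemma clip_mean_compare:
  assumes b: "0 < b" "b \<le> c" and \<sigma>: "\<sigma> = 1 \<or> \<sigma> = -1"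
    and k: "0 \<le> a" "\<And>t. 0 \<le> t \<Longrightarrow> max 0 (t - b) \<le> a * t ^ k"
  shows "e (\<lambda>y. \<sigma> * clip b y) \<le> e (\<lambda>y. \<sigma> * clip c y) + a * e (\<lambda>y. (capped c y) ^ k)"
proof -
  have c: "0 \<le> c" using b by simp
  have bl: "(\<lambda>y. \<sigma> * clip b y) \<in> bl line_dist" "(\<lambda>y. \<sigma> * clip c y) \<in> bl line_dist"
      "(\<lambda>y. a * (capped c y) ^ k) \<in> bl line_dist"
    using b by (auto intro!: bl_cmult bl_clip bl_capped_pow)
  have "\<sigma> * clip b y \<le> \<sigma> * clip c y + a * (capped c y) ^ k" for y
  proof -
    have "\<sigma> * clip b y \<le> \<sigma> * clip c y + max 0 (capped c y - b)"
      using \<sigma> b by (auto simp: max_def min_def)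
    also have "max 0 (capped c y - b) \<le> a * (capped c y) ^ k" using k(2)[of "capped c y"] c by simp
    finally show ?thesis by simp
  qed
  then have "e (\<lambda>y. \<sigma> * clip b y) \<le> e (\<lambda>y. \<sigma> * clip c y + a * (capped c y) ^ k)"
    using bl by (intro e_mono bl_add) auto
  also have "\<dots> \<le> e (\<lambda>y. \<sigma> * clip c y) + e (\<lambda>y. a * (capped c y) ^ k)" by (rule e_add[OF bl(2,3)])
  finally show ?thesis using e_cmult_pow[OF c k(1)] by simp
qed

text \<open>Let the upper level \<open>c\<close> tend to infinity: the mean at level
  \<open>c\<close> vanishes in the limit, and the excess over \<open>b\<close> costs at most
  \<open>S / b\<close> uniformly in \<open>c\<close>.\<close>

lemma clip_mean_le:
  assumes b: "0 < b" and \<sigma>: "\<sigma> = 1 \<or> \<sigma> = -1"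
  shows "e (\<lambda>y. \<sigma> * clip b y) \<le> S / b"
proof (rule tendsto_le[OF trivial_limit_at_top_linorder])
  have "((\<lambda>c. e (\<lambda>y. \<sigma> * clip c y)) \<longlongrightarrow> 0) at_top" using \<sigma> mean_zero mean_zero_uminus by auto
  then show "((\<lambda>c. e (\<lambda>y. \<sigma> * clip c y) + S / b) \<longlongrightarrow> S / b) at_top"
    by (auto intro!: tendsto_eq_intros)
  show "((\<lambda>c. e (\<lambda>y. \<sigma> * clip b y)) \<longlongrightarrow> e (\<lambda>y. \<sigma> * clip b y)) at_top" by simp
  show "\<forall>\<^sub>F c in at_top. e (\<lambda>y. \<sigma> * clip b y) \<le> e (\<lambda>y. \<sigma> * clip c y) + S / b"
    using eventually_ge_at_top[of b]
  proof eventually_elim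
    fix c assume c: "b \<le> c"
    have "e (\<lambda>y. \<sigma> * clip b y) \<le> e (\<lambda>y. \<sigma> * clip c y) + 1 / b * e (\<lambda>y. (capped c y)\<^sup>2)"
      by (rule clip_mean_compare[OF b c \<sigma>]) (use b excess_le_square[OF b] in auto)
    moreover have "1 / b * e (\<lambda>y. (capped c y)\<^sup>2) \<le> 1 / b * S"
      using capped_second_moment[of c] b c by (intro mult_left_mono) auto
    ultimately show "e (\<lambda>y. \<sigma> * clip b y) \<le> e (\<lambda>y. \<sigma> * clip c y) + S / b" by simp
  qed
qed

text \<open>For \<open>b\<close> of order \<open>n / lil_norm n\<close> the bound
  \<open>S / b\<close> would be too large by a factor of order \<open>llog n\<close>. So the second
  moment is used only down to the level \<open>lil_norm n\<close>, and the fourth moment pays for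
  the rest.\<close>

lemma clip_mean_le_tail:
  assumes b: "0 < b" "b \<le> lil_norm n" and n: "1 \<le> n" and \<sigma>: "\<sigma> = 1 \<or> \<sigma> = -1"
  shows "e (\<lambda>y. \<sigma> * clip b y) \<le> S / lil_norm n + lil_norm n ^ 4 * tail n / b ^ 3"
proof -
  have "e (\<lambda>y. \<sigma> * clip b y) \<le> e (\<lambda>y. \<sigma> * clip (lil_norm n) y) + 1 / b ^ 3 * e (\<lambda>y. (capped (lil_norm n) y) ^ 4)"
    by (rule clip_mean_compare[OF b \<sigma>]) (use b excess_le_pow4[OF b(1)] in auto)
  then show ?thesis
    using clip_mean_le[OF lil_norm_pos[OF n] \<sigma>] fourth_moment_eq[OF n] by simp
qed

lemma capped_fourth_moment_le:
  assumes "0 \<le> c" "c \<le> lil_norm n" "1 \<le> n"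
  shows "e (\<lambda>y. (capped c y) ^ 4) \<le> lil_norm n ^ 4 * tail n"
  unfolding fourth_moment_eq[OF assms(3), symmetric]
  using assms by (intro e_mono bl_capped_pow power_mono) (auto simp: lil_norm_nonneg)

text \<open>Markov's inequality for the capped fourth power; \<open>\<delta> \<le> 1\<close> keeps
  the level below the cap.\<close>

lemma Vhat_exceed:
  assumes i: "1 \<le> i" and n: "1 \<le> n" and \<delta>: "0 < \<delta>" "\<delta> \<le> 1"
  shows "Vhat {\<omega> \<in> space M. \<delta> * lil_norm n \<le> \<bar>Y i \<omega>\<bar>} \<le> ereal (tail n / \<delta> ^ 4)"
proof -
  let ?d = "lil_norm n"
  have d: "0 < ?d" using n by (rule lil_norm_pos)
  have "Vhat {\<omega> \<in> space M. \<delta> * ?d \<le> \<bar>Y i \<omega>\<bar>} \<le> ereal (e (\<lambda>y. 1 / (\<delta> * ?d) ^ 4 * (capped ?d y) ^ 4))"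
  proof (rule Vhat_le_e[OF _ i])
    show "(\<lambda>y. 1 / (\<delta> * ?d) ^ 4 * (capped ?d y) ^ 4) \<in> bl line_dist"
      using d by (intro bl_cmult bl_capped_pow) simp
    fix \<omega>
    show "indicator {\<omega> \<in> space M. \<delta> * ?d \<le> \<bar>Y i \<omega>\<bar>} \<omega> \<le> 1 / (\<delta> * ?d) ^ 4 * (capped ?d (Y i \<omega>)) ^ 4"
    proof (cases "\<delta> * ?d \<le> \<bar>Y i \<omega>\<bar>")
      case True
      have "\<delta> * ?d \<le> ?d" using \<delta> d by simp
      then have "(\<delta> * ?d) ^ 4 \<le> (capped ?d (Y i \<omega>)) ^ 4" using True \<delta> d by (intro power_mono) auto
      then have "1 \<le> 1 / (\<delta> * ?d) ^ 4 * (capped ?d (Y i \<omega>)) ^ 4" using \<delta> d by (simp add: field_simps)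
      then show ?thesis by (simp add: indicator_def)
    next
      case False
      have "0 \<le> 1 / (\<delta> * ?d) ^ 4 * (capped ?d (Y i \<omega>)) ^ 4" using \<delta> d by simp
      then show ?thesis using False by (simp add: indicator_def)
    qed
  qed
  also have "e (\<lambda>y. 1 / (\<delta> * ?d) ^ 4 * (capped ?d y) ^ 4) = tail n / \<delta> ^ 4"
    using e_cmult_pow[of ?d "1 / (\<delta> * ?d) ^ 4" 4] fourth_moment_eq[OF n] d \<delta>
    by (simp add: power_mult_distrib)
  finally show ?thesis .
qed

lemma Y_measurable [measurable]: "1 \<le> i \<Longrightarrow> Y i \<in> borel_measurable M"
  by (intro H_measurable Y_H)

lemma partial_sum_measurable [measurable]: "partial_sum Y n \<in> borel_measurable M"
  unfolding partial_sum_def[abs_def] by (intro borel_measurable_sum) (simp add: Y_measurable)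

text \<open>For each level \<open>1 / (k + 1)\<close> the capacities are at most a constant times
  \<open>tail n\<close>, which is summable; countably many levels suffice.\<close>

lemma null_large_jumps: "null {\<omega> \<in> space M. \<not> (\<lambda>n. Y n \<omega> / lil_norm n) \<longlonglongrightarrow> 0}"
proof -
  let ?A = "\<lambda>k n. {\<omega> \<in> space M. (1 / real (Suc k)) * lil_norm n \<le> \<bar>Y n \<omega>\<bar>}"
  have null_k: "null {\<omega>. \<exists>\<^sub>\<infinity>n. \<omega> \<in> ?A k n}" for k
  proof (rule null_Borel_Cantelli[where start = 1])
    show "summable (\<lambda>n. tail n / (1 / real (Suc k)) ^ 4)" by (intro summable_divide summable_tail)
    fix n :: nat assume n: "1 \<le> n"
    have "?A k n \<in> sets M" using Y_measurable[OF n] by measurable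
    then show "?A k n \<in> sets M \<and> Vhat (?A k n) \<le> ereal (tail n / (1 / real (Suc k)) ^ 4)"
      using Vhat_exceed[OF n n, of "1 / real (Suc k)"] by simp
  qed
  have "null (\<Union>k. {\<omega>. \<exists>\<^sub>\<infinity>n. \<omega> \<in> ?A k n})" by (rule null_UN) (rule null_k)
  then show ?thesis
  proof (rule null_mono, intro subsetI)
    fix \<omega> assume "\<omega> \<in> {\<omega> \<in> space M. \<not> (\<lambda>n. Y n \<omega> / lil_norm n) \<longlonglongrightarrow> 0}"
    then have \<omega>: "\<omega> \<in> space M" "\<not> (\<lambda>n. Y n \<omega> / lil_norm n) \<longlonglongrightarrow> 0" by auto
    show "\<omega> \<in> (\<Union>k. {\<omega>. \<exists>\<^sub>\<infinity>n. \<omega> \<in> ?A k n})"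
    proof (rule ccontr)
      assume "\<omega> \<notin> (\<Union>k. {\<omega>. \<exists>\<^sub>\<infinity>n. \<omega> \<in> ?A k n})"
      then have ev: "\<forall>\<^sub>F n in sequentially. \<omega> \<notin> ?A k n" for k
        by (auto simp: frequently_def cofinite_eq_sequentially)
      have "(\<lambda>n. Y n \<omega> / lil_norm n) \<longlonglongrightarrow> 0"
      proof (rule tendstoI)
        fix \<epsilon> :: real assume "0 < \<epsilon>"
        then obtain k where k: "1 / real (Suc k) < \<epsilon>" using nat_approx_posE by blast
        show "\<forall>\<^sub>F n in sequentially. dist (Y n \<omega> / lil_norm n) 0 < \<epsilon>"
          using ev[of k] eventually_ge_at_top[of 1]
        proof eventually_elim
          fix n :: nat assume n: "\<omega> \<notin> ?A k n" "1 \<le> n"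
          then have "\<bar>Y n \<omega>\<bar> < (1 / real (Suc k)) * lil_norm n" using \<omega>(1) by simp
          then have "\<bar>Y n \<omega>\<bar> / lil_norm n < 1 / real (Suc k)"
            using lil_norm_pos[OF n(2)] by (simp add: field_simps)
          then show "dist (Y n \<omega> / lil_norm n) 0 < \<epsilon>"
            using k lil_norm_pos[OF n(2)] by (simp add: dist_real_def)
        qed
      qed
      then show False using \<omega>(2) by simp
    qed
  qed
qed

end

section \<open>The upper exponential inequality\<close>

text \<open>The cubic Taylor term would involve a third moment. It is split into a small multiple of
  the square and a multiple of the fourth power, the two moments under control.\<close>

lemma exp_le_quadratic_quartic:
  fixes x \<eta> :: real
  assumes "0 < \<eta>"
  shows "exp x \<le> 1 + x + (1 + \<eta>) * x\<^sup>2 / 2 + (1 / 24 + 1 / (72 * \<eta>)) * x ^ 4 * exp \<bar>x\<bar>"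
proof -
  obtain t where t: "\<bar>t\<bar> \<le> \<bar>x\<bar>" "exp x = (\<Sum>m<4. x ^ m / fact m) + exp t / fact 4 * x ^ 4"
    using Maclaurin_exp_le[of x 4] by auto
  have sum: "(\<Sum>m<4. x ^ m / fact m) = 1 + x + x\<^sup>2 / 2 + x ^ 3 / 6"
    by (simp add: eval_nat_numeral fact_numeral)
  \<comment> \<open>Completing the square: the cross term of this square is the cubic term, with
    coefficient 1/6.\<close>
  have "0 \<le> (x\<^sup>2 / 12 - \<eta> * x / 2)\<^sup>2 / (\<eta> / 2)" using assms by simp
  also have "\<dots> = x ^ 4 / (72 * \<eta>) - x ^ 3 / 6 + \<eta> * x\<^sup>2 / 2"
    using assms by (simp add: eval_nat_numeral field_simps)
  finally have c: "x ^ 3 / 6 \<le> \<eta> * x\<^sup>2 / 2 + x ^ 4 / (72 * \<eta>)" by simp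
  have "x ^ 4 / (72 * \<eta>) * 1 \<le> x ^ 4 / (72 * \<eta>) * exp \<bar>x\<bar>" using assms by (intro mult_left_mono) auto
  moreover have "exp t * (x ^ 4 / 24) \<le> exp \<bar>x\<bar> * (x ^ 4 / 24)" using t(1) by (intro mult_right_mono) auto
  ultimately have "exp x \<le> 1 + x + x\<^sup>2 / 2 + \<eta> * x\<^sup>2 / 2 + x ^ 4 / (72 * \<eta>) * exp \<bar>x\<bar> + exp \<bar>x\<bar> * (x ^ 4 / 24)"
    using c unfolding t(2) sum by (simp add: fact_numeral)
  also have "\<dots> = 1 + x + (1 + \<eta>) * x\<^sup>2 / 2 + (1 / 24 + 1 / (72 * \<eta>)) * x ^ 4 * exp \<bar>x\<bar>"
    by (simp add: algebra_simps add_divide_distrib)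
  finally show ?thesis .
qed

text \<open>From \<open>(1 + u / 8) ^ 4 \<le> exp (u / 2)\<close>; the constant is
  \<open>8 ^ 4\<close>.\<close>

lemma pow4_le_exp_half:
  fixes u :: real
  assumes "0 \<le> u" shows "u ^ 4 * exp (- u / 2) \<le> 4096"
proof -
  have "(u / 8) ^ 4 \<le> (1 + (u / 2) / real 4) ^ 4" using assms by (intro power_mono) auto
  also have "\<dots> \<le> exp (u / 2)" using assms by (intro exp_ge_one_plus_x_over_n_power_n) auto
  finally have "u ^ 4 \<le> 4096 * exp (u / 2)" by (simp add: power_divide)
  then have "u ^ 4 * exp (- u / 2) \<le> 4096 * exp (u / 2) * exp (- u / 2)" by (intro mult_right_mono) auto
  also have "\<dots> = 4096" by (simp flip: exp_add)
  finally show ?thesis .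
qed

lemma bl_exp_min: "(\<lambda>u. exp (min 0 u)) \<in> bl line_dist"
proof (rule blI[where K = 1 and L = 1])
  show "\<bar>exp (min 0 u)\<bar> \<le> 1" for u :: real by simp
  have *: "exp a - exp b \<le> \<bar>a - b\<bar>" if "a \<le> 0" for a b :: real
  proof -
    have "exp a * (1 + (b - a)) \<le> exp a * exp (b - a)" by (intro mult_left_mono exp_ge_add_one_self) auto
    then have "exp a - exp b \<le> exp a * (a - b)" by (simp add: algebra_simps flip: exp_add)
    also have "\<dots> \<le> exp a * \<bar>a - b\<bar>" by (intro mult_left_mono) auto
    also have "\<dots> \<le> 1 * \<bar>a - b\<bar>" using that by (intro mult_right_mono) auto
    finally show ?thesis by simp
  qed
  fix x y :: real
  have "\<bar>exp (min 0 x) - exp (min 0 y)\<bar> \<le> \<bar>min 0 x - min 0 y\<bar>"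
    using *[of "min 0 x" "min 0 y"] *[of "min 0 y" "min 0 x"] by (simp add: abs_le_iff abs_minus_commute)
  also have "\<dots> \<le> \<bar>x - y\<bar>" by (auto simp: min_def)
  finally show "\<bar>exp (min 0 x) - exp (min 0 y)\<bar> \<le> 1 * \<bar>line_dist x y\<bar>"
    by (simp add: line_dist_def)
qed

lemma bl_unit_clamp: "(\<lambda>u. max 0 (min 1 u)) \<in> bl line_dist"
  by (rule blI[where K = 1 and L = 1]) (auto simp: line_dist_def)

lemma clip_lipschitz: "\<bar>clip c u - clip c v\<bar> \<le> 1 * \<bar>u - v\<bar>"
  by (auto simp: max_def min_def)

section \<open>Monotonicity and finite sub-additivity of \<open>Vhat\<close>\<close>

context sublinear_expectation_space
begin

lemma Vhat_Un_le:
  assumes "Vhat A \<le> ereal a" "Vhat B \<le> ereal b" shows "Vhat (A \<union> B) \<le> ereal (a + b)"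
proof (rule ereal_le_epsilon2)
  fix \<epsilon> :: real assume \<epsilon>: "0 < \<epsilon>"
  have *: "\<exists>\<xi>\<in>H. (\<forall>\<omega>\<in>space M. indicator A \<omega> \<le> \<xi> \<omega>) \<and> E \<xi> < ereal (a + \<epsilon> / 2)"
    if "Vhat A \<le> ereal a" for A a
  proof -
    have "Vhat A < ereal (a + \<epsilon> / 2)" using that \<epsilon> by (auto intro: le_less_trans)
    then show ?thesis unfolding V_hat_def Inf_less_iff by blast
  qed
  obtain \<xi> where \<xi>: "\<xi> \<in> H" "\<forall>\<omega>\<in>space M. indicator A \<omega> \<le> \<xi> \<omega>" "E \<xi> < ereal (a + \<epsilon> / 2)"
    using *[OF assms(1)] by blast
  obtain \<eta> where \<eta>: "\<eta> \<in> H" "\<forall>\<omega>\<in>space M. indicator B \<omega> \<le> \<eta> \<omega>" "E \<eta> < ereal (b + \<epsilon> / 2)"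
    using *[OF assms(2)] by blast
  have "Vhat (A \<union> B) \<le> E (\<lambda>\<omega>. \<xi> \<omega> + \<eta> \<omega>)"
  proof (rule Vhat_le)
    show "(\<lambda>\<omega>. \<xi> \<omega> + \<eta> \<omega>) \<in> H" using \<xi>(1) \<eta>(1) by (rule H_add)
    show "indicator (A \<union> B) \<omega> \<le> \<xi> \<omega> + \<eta> \<omega>" if "\<omega> \<in> space M" for \<omega>
    proof -
      have "indicator (A \<union> B) \<omega> \<le> (indicator A \<omega> + indicator B \<omega> :: real)" by (auto simp: indicator_def)
      then show ?thesis using \<xi>(2) \<eta>(2) that by (meson add_mono order_trans)
    qed
  qed
  also have "\<dots> \<le> E \<xi> + E \<eta>" using \<xi> \<eta> by (intro E_subadd) auto
  also have "\<dots> \<le> ereal (a + \<epsilon> / 2) + ereal (b + \<epsilon> / 2)" using \<xi>(3) \<eta>(3) by (intro add_mono) auto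
  finally show "Vhat (A \<union> B) \<le> ereal (a + b) + ereal \<epsilon>" by (simp add: algebra_simps)
qed

lemma Vhat_mono: "A \<subseteq> B \<Longrightarrow> Vhat A \<le> Vhat B"
  unfolding V_hat_def
proof (rule Inf_superset_mono, intro subsetI, elim CollectE exE conjE)
  fix x \<xi> assume AB: "A \<subseteq> B" and \<xi>: "x = E \<xi>" "\<xi> \<in> H" "\<forall>\<omega>\<in>space M. indicator B \<omega> \<le> \<xi> \<omega>"
  have "indicator A \<omega> \<le> \<xi> \<omega>" if "\<omega> \<in> space M" for \<omega>
  proof -
    have "indicator A \<omega> \<le> (indicator B \<omega> :: real)" using AB by (auto simp: indicator_def)
    then show ?thesis using \<xi>(3) that by (meson order_trans)
  qed
  then show "x \<in> {E \<xi> |\<xi>. \<xi> \<in> H \<and> (\<forall>\<omega>\<in>space M. indicator A \<omega> \<le> \<xi> \<omega>)}" using \<xi> by blast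
qed

lemma Vhat_finite_UN_le:
  assumes "\<And>i. i \<in> {1..n} \<Longrightarrow> Vhat (A i) \<le> ereal a"
  shows "Vhat (\<Union>i\<in>{1..n}. A i) \<le> ereal (real n * a)"
  using assms
proof (induction n)
  case 0 then show ?case by (simp add: Vhat_empty)
next
  case (Suc n)
  have "(\<Union>i\<in>{1..Suc n}. A i) = (\<Union>i\<in>{1..n}. A i) \<union> A (Suc n)"
    by (simp add: atLeastAtMostSuc_conv Un_commute)
  moreover have "Vhat ((\<Union>i\<in>{1..n}. A i) \<union> A (Suc n)) \<le> ereal (real n * a + a)"
    using Suc by (intro Vhat_Un_le) auto
  ultimately show ?case by (simp add: algebra_simps)
qed

end

section \<open>A maximal inequality of Chernoff type\<close>

context iid_seq
begin

text \<open>
  \<open>G j\<close> below is 1 once the partial sums have passed the level and the exponential bound before that;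
  \<open>cut\<close> is a continuous version of the indicator of having passed, which is positive only where
  \<open>g j = 1\<close>, so that replacing the supremum by a product of factors \<open>1 - cut\<close> costs nothing.
\<close>

lemma maximal_inequality:
  assumes y: "0 < y" and lam: "0 < lam" and a: "0 \<le> a" and exp_moment: "e (\<lambda>t. exp (lam * clip y t)) \<le> exp a"
  shows "Vhat {\<omega> \<in> space M. \<exists>i\<in>{1..n}. x + 1 / lam \<le> (\<Sum>l<i. clip y (path \<omega> l))} \<le> ereal (exp (real n * a - lam * x))"
proof -
  define Sm where "Sm = (\<lambda>i (p :: nat \<Rightarrow> real). \<Sum>l<i. clip y (p l))"
  \<comment> \<open>The remaining \<open>n - j\<close> steps each cost a factor of at most
    \<open>exp a\<close>; capping the exponent at 0 expresses that no capacity exceeds 1.\<close>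
  define g where "g = (\<lambda>j s. exp (min 0 (lam * (s - x) + a * (real n - real j))))"
  \<comment> \<open>A ramp rising from 0 at \<open>x\<close> to 1 at \<open>x + 1 / lam\<close>. Its
    width is the reason for the level \<open>x + 1 / lam\<close> and costs only a factor
    \<open>exp 1\<close>.\<close>
  define cut where "cut = (\<lambda>s. max 0 (min 1 (lam * (s - x))))"
  define P where "P = (\<lambda>j p. \<Prod>i\<in>{1..j}. 1 - cut (Sm i p))"
  define G where "G = (\<lambda>j p. 1 - (1 - g j (Sm j p)) * P j p)"
  have g_bl: "g j \<in> bl line_dist" for j
    using bl_affine[OF bl_exp_min, of "- lam * x + a * (real n - real j)" lam]
    unfolding g_def by (simp add: algebra_simps)
  have cut_bl: "cut \<in> bl line_dist"
    using bl_affine[OF bl_unit_clamp, of "- lam * x" lam]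
    unfolding cut_def by (simp add: algebra_simps)
  have Sm_bl: "(\<lambda>p. f (Sm i p)) \<in> bl (path_dist j)" if "i \<le> j" "f \<in> bl line_dist" for f i j
    unfolding Sm_def by (rule bl_path_sum[OF that(2) clip_lipschitz]) (use that in auto)
  have P_bl: "P i \<in> bl (path_dist j)" if "i \<le> j" for i j
    unfolding P_def by (intro bl_prod bl_diff bl_const Sm_bl cut_bl) (use that in auto)
  have G_bl: "G j \<in> bl (path_dist j)" for j
    unfolding G_def by (intro bl_diff bl_const bl_mult Sm_bl g_bl P_bl) auto
  have P01: "0 \<le> P j p" "P j p \<le> 1" for j p
    unfolding P_def cut_def by (auto intro!: prod_nonneg prod_le_1)
  have g01: "0 \<le> g j t" "g j t \<le> 1" for j t unfolding g_def by auto
  have clip_bl: "(\<lambda>t. f (c + clip y t)) \<in> bl line_dist" if "f \<in> bl line_dist" for f c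
    by (rule bl_lipschitz_compose[OF that, where L = 1])
       (use clip_lipschitz[of y] in \<open>simp add: line_dist_def\<close>)
  have g_step: "e (\<lambda>t. g (Suc j) (c + clip y t)) \<le> g j c" if "j < n" for j c
  proof -
    define u where "u = lam * (c - x) + a * (real n - real (Suc j))"
    have bl: "(\<lambda>t. g (Suc j) (c + clip y t)) \<in> bl line_dist" by (rule clip_bl[OF g_bl])
    have bl2: "(\<lambda>t. exp (lam * clip y t)) \<in> bl line_dist" using y by (intro bl_exp bl_cmult bl_clip) simp
    have "e (\<lambda>t. g (Suc j) (c + clip y t)) \<le> 1"
      using e_mono[OF bl bl_const[of 1]] g01 by simp
    moreover have "e (\<lambda>t. g (Suc j) (c + clip y t)) \<le> exp (u + a)"
    proof -
      have "g (Suc j) (c + clip y t) \<le> exp u * exp (lam * clip y t)" for t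
        unfolding g_def u_def exp_add[symmetric] by (simp add: algebra_simps)
      then have "e (\<lambda>t. g (Suc j) (c + clip y t)) \<le> e (\<lambda>t. exp u * exp (lam * clip y t))"
        by (intro e_mono bl bl_cmult bl2)
      also have "\<dots> = exp u * e (\<lambda>t. exp (lam * clip y t))" by (rule e_cmult[OF bl2]) simp
      also have "\<dots> \<le> exp u * exp a" using exp_moment by (intro mult_left_mono) auto
      finally show ?thesis by (simp add: exp_add)
    qed
    moreover have "u + a = lam * (c - x) + a * (real n - real j)" by (simp add: u_def algebra_simps)
    ultimately show ?thesis unfolding g_def by (simp add: min_def)
  qed
  have step: "e (\<lambda>t. G (Suc j) (p(j := t))) \<le> G j p" if "j < n" for j p
  proof -
    have Sm_same: "Sm i (p(j := t)) = Sm i p" if "i \<le> j" for i t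
      unfolding Sm_def using that by (intro sum.cong) auto
    have Sm_Suc: "Sm (Suc j) (p(j := t)) = Sm j p + clip y t" for t
      using Sm_same[of j t] unfolding Sm_def by simp
    have P_same: "P j (p(j := t)) = P j p" for t
      unfolding P_def using Sm_same by (intro prod.cong) auto
    have absorb: "(1 - g (Suc j) c) * (1 - cut c) = 1 - g (Suc j) c" for c
    proof (cases "lam * (c - x) \<le> 0")
      case True then show ?thesis by (simp add: cut_def)
    next
      case False
      then have "0 \<le> lam * (c - x) + a * (real n - real (Suc j))" using a that by simp
      then show ?thesis by (simp add: g_def)
    qed
    have "G (Suc j) (p(j := t)) = (1 - P j p) + P j p * g (Suc j) (Sm j p + clip y t)" for t
    proof -
      have "P (Suc j) (p(j := t)) = (1 - cut (Sm j p + clip y t)) * P j p"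
        using P_same[of t] Sm_Suc[of t] unfolding P_def by (simp add: prod.nat_ivl_Suc')
      then have "G (Suc j) (p(j := t)) = 1 - ((1 - g (Suc j) (Sm j p + clip y t)) * (1 - cut (Sm j p + clip y t))) * P j p"
        unfolding G_def Sm_Suc by (simp add: mult.assoc)
      then show ?thesis unfolding absorb by (simp add: algebra_simps)
    qed
    then have "e (\<lambda>t. G (Suc j) (p(j := t))) = e (\<lambda>t. (1 - P j p) + P j p * g (Suc j) (Sm j p + clip y t))" by simp
    also have "\<dots> = (1 - P j p) + e (\<lambda>t. P j p * g (Suc j) (Sm j p + clip y t))"
      by (intro e_add_const bl_cmult clip_bl g_bl)
    also have "\<dots> = (1 - P j p) + P j p * e (\<lambda>t. g (Suc j) (Sm j p + clip y t))"
      using P01 e_cmult[OF clip_bl[OF g_bl]] by simp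
    also have "\<dots> \<le> (1 - P j p) + P j p * g j (Sm j p)"
      using g_step[OF that] P01 by (intro add_left_mono mult_left_mono) auto
    also have "\<dots> = G j p" by (simp add: G_def algebra_simps)
    finally show ?thesis .
  qed
  have "Vhat {\<omega> \<in> space M. \<exists>i\<in>{1..n}. x + 1 / lam \<le> (\<Sum>l<i. clip y (path \<omega> l))} \<le> ereal (e_path (G n))"
  proof (rule Vhat_le_e_path[OF G_bl])
    fix \<omega>
    let ?A = "{\<omega> \<in> space M. \<exists>i\<in>{1..n}. x + 1 / lam \<le> (\<Sum>l<i. clip y (path \<omega> l))}"
    have "(1 - g n (Sm n (path \<omega>))) * P n (path \<omega>) \<le> 1 * 1" using g01 P01 by (intro mult_mono) auto
    then have "0 \<le> G n (path \<omega>)" by (simp add: G_def)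
    moreover have "G n (path \<omega>) = 1" if "\<omega> \<in> ?A"
    proof -
      from that obtain i where i: "i \<in> {1..n}" "x + 1 / lam \<le> Sm i (path \<omega>)" unfolding Sm_def by auto
      then have "1 \<le> lam * (Sm i (path \<omega>) - x)" using lam by (simp add: field_simps)
      then have "1 - cut (Sm i (path \<omega>)) = 0" by (simp add: cut_def)
      then have "P n (path \<omega>) = 0" unfolding P_def using i(1) by (intro prod_zero) auto
      then show ?thesis by (simp add: G_def)
    qed
    ultimately show "indicator ?A \<omega> \<le> G n (path \<omega>)" by (cases "\<omega> \<in> ?A") auto
  qed
  also have "e_path (G n) \<le> e_path (G 0)"
    by (rule e_path_supermartingale[OF le0 G_bl step])
  also have "e_path (G 0) = exp (min 0 (lam * (0 - x) + a * real n))"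
    unfolding G_def P_def g_def Sm_def by simp
  also have "\<dots> \<le> exp (real n * a - lam * x)" by (simp add: algebra_simps)
  finally show ?thesis by simp
qed

end

context lil_seq
begin

lemma partial_sum_path: "partial_sum Y i \<omega> = (\<Sum>l<i. path \<omega> l)"
  unfolding partial_sum_def using sum.atLeast1_atMost_eq[of "\<lambda>i. Y i \<omega>" i] by simp

text \<open>The pointwise bound of \<open>exp_le_quadratic_quartic\<close> is split by
  sub-additivity into the three truncated moments. The mean need not vanish after truncation, so
  \<open>clip_mean_le\<close> supplies the first summand.\<close>

lemma exp_moment_le:
  assumes n: "1 \<le> n" and \<delta>: "0 < \<delta>" "\<delta> \<le> 1" and lam: "0 < lam" and \<eta>: "0 < \<eta>"
  shows "e (\<lambda>t. exp (lam * clip (\<delta> * lil_norm n) t)) \<le>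
    exp (lam * S / (\<delta> * lil_norm n) + (1 + \<eta>) * lam\<^sup>2 * S / 2 +
      (1 / 24 + 1 / (72 * \<eta>)) * exp (lam * (\<delta> * lil_norm n)) * lam ^ 4 * (lil_norm n ^ 4 * tail n))"
proof -
  define y where "y = \<delta> * lil_norm n"
  define C where "C = 1 / 24 + 1 / (72 * \<eta>)"
  define B where "B = (1 + \<eta>) * lam\<^sup>2 / 2"
  define D where "D = C * exp (lam * y) * lam ^ 4"
  have y: "0 < y" "y \<le> lil_norm n" using \<delta> lil_norm_pos[OF n] by (auto simp: y_def)
  have C: "0 \<le> C" using \<eta> by (simp add: C_def)
  have BD: "0 \<le> B" "0 \<le> D" using C \<eta> by (auto simp: B_def D_def)
  have bl1: "(\<lambda>t. lam * clip y t) \<in> bl line_dist" using y by (intro bl_cmult bl_clip) simp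
  have bl2: "(\<lambda>t. B * (capped y t)\<^sup>2) \<in> bl line_dist" using y by (intro bl_cmult bl_capped_pow) simp
  have bl4: "(\<lambda>t. D * (capped y t) ^ 4) \<in> bl line_dist" using y by (intro bl_cmult bl_capped_pow) simp
  have "exp (lam * clip y t) \<le> 1 + (lam * clip y t + (B * (capped y t)\<^sup>2 + D * (capped y t) ^ 4))" for t
  proof -
    let ?x = "lam * clip y t"
    have "\<bar>?x\<bar> = lam * capped y t" using lam y by (simp add: abs_mult abs_clip)
    also have "\<dots> \<le> lam * y" using lam by (intro mult_left_mono) auto
    finally have x: "\<bar>?x\<bar> \<le> lam * y" .
    have "exp ?x \<le> 1 + ?x + (1 + \<eta>) * ?x\<^sup>2 / 2 + C * ?x ^ 4 * exp \<bar>?x\<bar>"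
      unfolding C_def by (rule exp_le_quadratic_quartic[OF \<eta>])
    also have "C * ?x ^ 4 * exp \<bar>?x\<bar> \<le> C * ?x ^ 4 * exp (lam * y)"
      using x C by (intro mult_left_mono) auto
    also have "C * ?x ^ 4 * exp (lam * y) = D * (capped y t) ^ 4"
      using clip_pow4[of y t] y by (simp add: D_def power_mult_distrib)
    also have "(1 + \<eta>) * ?x\<^sup>2 / 2 = B * (capped y t)\<^sup>2"
      using clip_square[of y t] y by (simp add: B_def power_mult_distrib)
    finally show ?thesis by simp
  qed
  then have "e (\<lambda>t. exp (lam * clip y t)) \<le> e (\<lambda>t. 1 + (lam * clip y t + (B * (capped y t)\<^sup>2 + D * (capped y t) ^ 4)))"
    by (intro e_mono bl_exp bl_add bl_const bl1 bl2 bl4)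
  also have "\<dots> = 1 + e (\<lambda>t. lam * clip y t + (B * (capped y t)\<^sup>2 + D * (capped y t) ^ 4))"
    by (intro e_add_const bl_add bl1 bl2 bl4)
  also have "e (\<lambda>t. lam * clip y t + (B * (capped y t)\<^sup>2 + D * (capped y t) ^ 4))
      \<le> e (\<lambda>t. lam * clip y t) + e (\<lambda>t. B * (capped y t)\<^sup>2 + D * (capped y t) ^ 4)"
    by (intro e_add bl_add bl1 bl2 bl4)
  also have "e (\<lambda>t. B * (capped y t)\<^sup>2 + D * (capped y t) ^ 4) \<le> e (\<lambda>t. B * (capped y t)\<^sup>2) + e (\<lambda>t. D * (capped y t) ^ 4)"
    by (intro e_add bl2 bl4)
  also have "e (\<lambda>t. lam * clip y t) = lam * e (clip y)"
    using y lam by (intro e_cmult bl_clip) auto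
  also have "e (\<lambda>t. B * (capped y t)\<^sup>2) = B * e (\<lambda>t. (capped y t)\<^sup>2)"
    using y BD by (intro e_cmult_pow) auto
  also have "e (\<lambda>t. D * (capped y t) ^ 4) = D * e (\<lambda>t. (capped y t) ^ 4)"
    using y BD by (intro e_cmult_pow) auto
  also have "lam * e (clip y) \<le> lam * (S / y)"
    using clip_mean_le[OF y(1), of 1] lam by (intro mult_left_mono) auto
  also have "B * e (\<lambda>t. (capped y t)\<^sup>2) \<le> B * S"
    using capped_second_moment[of y] y BD by (intro mult_left_mono) auto
  also have "D * e (\<lambda>t. (capped y t) ^ 4) \<le> D * (lil_norm n ^ 4 * tail n)"
    using capped_fourth_moment_le[of y n] y n BD by (intro mult_left_mono) auto
  also have "1 + (lam * (S / y) + (B * S + D * (lil_norm n ^ 4 * tail n))) \<le> exp (lam * (S / y) + (B * S + D * (lil_norm n ^ 4 * tail n)))"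
    by (rule exp_ge_add_one_self)
  also have "lam * (S / y) + (B * S + D * (lil_norm n ^ 4 * tail n)) =
      lam * S / y + (1 + \<eta>) * lam\<^sup>2 * S / 2 + C * exp (lam * y) * lam ^ 4 * (lil_norm n ^ 4 * tail n)"
    by (simp add: B_def D_def)
  finally show ?thesis unfolding y_def C_def by simp
qed

text \<open>Here \<open>exp (- u)\<close> is an upper bound for \<open>n * tail n\<close>; a free
  \<open>u\<close> avoids the logarithm of a tail that may be 0.\<close>

lemma upper_exponential_inequality:
  assumes \<tau>: "0 < \<tau>" and s2: "S < s2"
  shows "\<exists>K\<ge>0. \<forall>n\<ge>1. \<forall>u>0. real n * tail n \<le> exp (- u) \<longrightarrow>
    Vhat {\<omega> \<in> space M. \<exists>i\<in>{1..n}. \<tau> * lil_norm n \<le> partial_sum Y i \<omega>}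
      \<le> ereal (K * (exp (- llog (real n) * (\<tau>\<^sup>2 / s2)) + exp (- u)))"
proof -
  \<comment> \<open>With \<open>\<delta> \<le> \<tau> / 4\<close> the lowered Chernoff parameter
    still gives an exponent of at most \<open>- u\<close>, because
    \<open>\<tau> / (4 * \<delta>) \<ge> 1\<close>.\<close>
  define \<delta> where "\<delta> = min 1 (\<tau> / 4)"
  have \<delta>: "0 < \<delta>" "\<delta> \<le> 1" "4 * \<delta> \<le> \<tau>" using \<tau> by (auto simp: \<delta>_def)
  have s2pos: "0 < s2" using S_nonneg s2 by simp
  \<comment> \<open>The gap between \<open>S\<close> and \<open>s2\<close> pays for the part of the
    cubic term moved into the square.\<close>
  define \<eta> where "\<eta> = (if S = 0 then 1 else s2 / S - 1)"
  have \<eta>: "0 < \<eta>" "(1 + \<eta>) * S \<le> s2" using S_nonneg s2 s2pos by (auto simp: \<eta>_def field_simps)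
  define C where "C = 1 / 24 + 1 / (72 * \<eta>)"
  have C: "0 \<le> C" using \<eta> by (simp add: C_def)
  \<comment> \<open>The minimiser of \<open>s2 * \<theta>\<^sup>2 / 4 - \<tau> * \<theta>\<close>;
    the minimum is \<open>- \<tau>\<^sup>2 / s2\<close>.\<close>
  define \<theta>0 where "\<theta>0 = 2 * \<tau> / s2"
  have \<theta>0: "0 < \<theta>0" using \<tau> s2pos by (simp add: \<theta>0_def)
  \<comment> \<open>The mean term, the fourth-moment term (256 is \<open>4096 / 2 ^ 4\<close>), and
    1 for the width of the ramp in \<open>maximal_inequality\<close>.\<close>
  define K1 where "K1 = \<theta>0 * S / (2 * \<delta>) + C * 256 / \<delta> ^ 4 + 1"
  define K where "K = exp K1 + 1 / \<delta> ^ 4"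
  have "0 \<le> K" using \<delta> by (simp add: K_def)
  moreover have "Vhat {\<omega> \<in> space M. \<exists>i\<in>{1..n}. \<tau> * lil_norm n \<le> partial_sum Y i \<omega>}
      \<le> ereal (K * (exp (- llog (real n) * (\<tau>\<^sup>2 / s2)) + exp (- u)))"
    if n: "1 \<le> n" and u: "0 < u" and tail_u: "real n * tail n \<le> exp (- u)" for n :: nat and u
  proof -
    let ?l = "llog (real n)" and ?d = "lil_norm n"
    let ?q = "exp (- ?l * (\<tau>\<^sup>2 / s2))"
    have l: "0 < ?l" by (rule llog_pos)
    have d: "0 < ?d" using n by (rule lil_norm_pos)
    have d2: "?d\<^sup>2 = 2 * real n * ?l" by (rule lil_norm_sq)
    define \<theta> where "\<theta> = min \<theta>0 (u / (2 * \<delta> * ?l))"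
    txt \<open>
      \<open>\<theta>0\<close> is the optimal Chernoff parameter. If the tail is too heavy for it, the parameter is
      lowered until the fourth-moment term stays bounded; the exponent then still gives \<open>exp (- u)\<close>.
    \<close>
    have \<theta>: "0 < \<theta>" "\<theta> \<le> \<theta>0" "\<theta> \<le> u / (2 * \<delta> * ?l)" using \<theta>0 u \<delta> l by (auto simp: \<theta>_def)
    have \<theta>l: "\<theta> * ?l \<le> u / (2 * \<delta>)" using mult_right_mono[OF \<theta>(3), of ?l] l \<delta> by simp
    define lam where "lam = \<theta> * ?l / ?d"
    have lam: "0 < lam" "lam * ?d = \<theta> * ?l" using \<theta> l d by (auto simp: lam_def)
    have lam4: "lam ^ 4 * ?d ^ 4 = (\<theta> * ?l) ^ 4" using lam(2) by (metis power_mult_distrib)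
    define a where "a = lam * S / (\<delta> * ?d) + (1 + \<eta>) * lam\<^sup>2 * S / 2 +
      C * exp (lam * (\<delta> * ?d)) * lam ^ 4 * (?d ^ 4 * tail n)"
    have a0: "0 \<le> a" unfolding a_def using lam \<delta> d C \<eta> S_nonneg tail_nonneg[of n]
      by (intro add_nonneg_nonneg mult_nonneg_nonneg divide_nonneg_nonneg) auto
    have t1: "real n * (lam * S / (\<delta> * ?d)) \<le> \<theta>0 * S / (2 * \<delta>)"
    proof -
      have "real n * (lam * S / (\<delta> * ?d)) = real n * \<theta> * ?l * S / (\<delta> * ?d\<^sup>2)"
        by (simp add: lam_def power2_eq_square ac_simps)
      also have "\<dots> = \<theta> * S / (2 * \<delta>)" unfolding d2 using n l by simp
      also have "\<dots> \<le> \<theta>0 * S / (2 * \<delta>)" using \<theta> S_nonneg \<delta> by (intro divide_right_mono mult_right_mono) auto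
      finally show ?thesis .
    qed
    have t2: "real n * ((1 + \<eta>) * lam\<^sup>2 * S / 2) \<le> s2 * \<theta>\<^sup>2 * ?l / 4"
    proof -
      have lam2: "real n * lam\<^sup>2 = \<theta>\<^sup>2 * ?l / 2"
        unfolding lam_def power_divide d2 using n l by (simp add: power2_eq_square)
      have "real n * ((1 + \<eta>) * lam\<^sup>2 * S / 2) = ((1 + \<eta>) * S) * (real n * lam\<^sup>2) / 2" by simp
      also have "\<dots> \<le> s2 * (real n * lam\<^sup>2) / 2" using \<eta>(2) by (intro divide_right_mono mult_right_mono) auto
      finally show ?thesis unfolding lam2 by simp
    qed
    have t3: "real n * (C * exp (lam * (\<delta> * ?d)) * lam ^ 4 * (?d ^ 4 * tail n)) \<le> C * 256 / \<delta> ^ 4"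
    proof -
      have "lam * (\<delta> * ?d) = \<delta> * (\<theta> * ?l)" using lam(2) by (simp add: mult.left_commute)
      also have "\<dots> \<le> \<delta> * (u / (2 * \<delta>))" using \<theta>l \<delta> by (intro mult_left_mono) auto
      also have "\<dots> = u / 2" using \<delta> by simp
      finally have ex: "exp (lam * (\<delta> * ?d)) \<le> exp (u / 2)" by simp
      have pw: "(\<theta> * ?l) ^ 4 \<le> (u / (2 * \<delta>)) ^ 4" using \<theta>l \<theta> l by (intro power_mono) auto
      have "real n * (C * exp (lam * (\<delta> * ?d)) * lam ^ 4 * (?d ^ 4 * tail n))
          = C * (exp (lam * (\<delta> * ?d)) * (lam ^ 4 * ?d ^ 4) * (real n * tail n))" by simp
      also have "\<dots> \<le> C * (exp (u / 2) * (u / (2 * \<delta>)) ^ 4 * exp (- u))"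
        unfolding lam4 using ex pw tail_u tail_nonneg[of n] C
        by (intro mult_left_mono mult_mono) (auto intro!: mult_nonneg_nonneg)
      also have "\<dots> = C / (16 * \<delta> ^ 4) * (u ^ 4 * (exp (u / 2) * exp (- u)))"
        by (simp add: power_divide power_mult_distrib)
      also have "exp (u / 2) * exp (- u) = exp (- u / 2)" by (simp flip: exp_add)
      also have "C / (16 * \<delta> ^ 4) * (u ^ 4 * exp (- u / 2)) \<le> C / (16 * \<delta> ^ 4) * 4096"
        using pow4_le_exp_half[of u] u C \<delta> by (intro mult_left_mono) auto
      finally show ?thesis by (simp add: ac_simps)
    qed
    have na: "real n * a \<le> (K1 - 1) + s2 * \<theta>\<^sup>2 * ?l / 4"
      unfolding a_def K1_def distrib_left using t1 t2 t3 by linarith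
    \<comment> \<open>The ramp has to end, not begin, at \<open>\<tau> * lil_norm n\<close>.\<close>
    define x where "x = \<tau> * ?d - 1 / lam"
    have "lam * x = \<tau> * (\<theta> * ?l) - 1" unfolding x_def using lam by (simp add: algebra_simps)
    then have expo: "real n * a - lam * x \<le> K1 + (s2 * \<theta>\<^sup>2 * ?l / 4 - \<tau> * \<theta> * ?l)" using na by (simp add: algebra_simps)
    have "exp (s2 * \<theta>\<^sup>2 * ?l / 4 - \<tau> * \<theta> * ?l) \<le> ?q + exp (- u)"
    proof (cases "\<theta> = \<theta>0")
      case True
      have "s2 * \<theta>\<^sup>2 * ?l / 4 - \<tau> * \<theta> * ?l = - ?l * (\<tau>\<^sup>2 / s2)"
        unfolding True \<theta>0_def using s2pos by (simp add: power2_eq_square field_simps)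
      then show ?thesis by simp
    next
      case False
      then have th: "\<theta> = u / (2 * \<delta> * ?l)" by (auto simp: \<theta>_def min_def split: if_splits)
      have "s2 * \<theta> \<le> 2 * \<tau>" using \<theta>(2) s2pos by (simp add: \<theta>0_def field_simps)
      then have "s2 * \<theta> * (\<theta> * ?l / 4) \<le> 2 * \<tau> * (\<theta> * ?l / 4)" using \<theta> l by (intro mult_right_mono) auto
      then have "s2 * \<theta>\<^sup>2 * ?l / 4 - \<tau> * \<theta> * ?l \<le> - (\<tau> * (\<theta> * ?l) / 2)" by (simp add: power2_eq_square algebra_simps)
      also have "\<tau> * (\<theta> * ?l) / 2 = (\<tau> / (4 * \<delta>)) * u" unfolding th using l \<delta> by simp
      also have "- ((\<tau> / (4 * \<delta>)) * u) \<le> - (1 * u)" using \<delta> u by (intro le_imp_neg_le mult_right_mono) auto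
      finally have "exp (s2 * \<theta>\<^sup>2 * ?l / 4 - \<tau> * \<theta> * ?l) \<le> exp (- u)" by simp
      then show ?thesis by (simp add: add_increasing)
    qed
    then have bnd: "exp (real n * a - lam * x) \<le> exp K1 * (?q + exp (- u))"
      using expo order_trans[OF _ mult_left_mono[of "exp (s2 * \<theta>\<^sup>2 * ?l / 4 - \<tau> * \<theta> * ?l)" _ "exp K1"]]
      by (simp flip: exp_add)
    let ?y = "\<delta> * ?d"
    let ?A = "{\<omega> \<in> space M. \<exists>i\<in>{1..n}. x + 1 / lam \<le> (\<Sum>l<i. clip ?y (path \<omega> l))}"
    let ?B = "\<Union>i\<in>{1..n}. {\<omega> \<in> space M. \<delta> * ?d \<le> \<bar>Y i \<omega>\<bar>}"
    have "Vhat ?A \<le> ereal (exp (real n * a - lam * x))"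
    proof (rule maximal_inequality[OF _ lam(1) a0])
      show "0 < ?y" using \<delta> d by simp
      show "e (\<lambda>t. exp (lam * clip ?y t)) \<le> exp a"
        unfolding a_def C_def by (rule exp_moment_le[OF n \<delta>(1,2) lam(1) \<eta>(1)])
    qed
    moreover have "Vhat ?B \<le> ereal (real n * (tail n / \<delta> ^ 4))"
      by (rule Vhat_finite_UN_le) (use Vhat_exceed[OF _ n \<delta>(1,2)] in auto)
    ultimately have "Vhat (?A \<union> ?B) \<le> ereal (exp (real n * a - lam * x) + real n * (tail n / \<delta> ^ 4))"
      by (rule Vhat_Un_le)
    moreover have "{\<omega> \<in> space M. \<exists>i\<in>{1..n}. \<tau> * ?d \<le> partial_sum Y i \<omega>} \<subseteq> ?A \<union> ?B"
    proof (intro subsetI UnCI)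
      fix \<omega> assume "\<omega> \<in> {\<omega> \<in> space M. \<exists>i\<in>{1..n}. \<tau> * ?d \<le> partial_sum Y i \<omega>}"
      then obtain i where i: "\<omega> \<in> space M" "i \<in> {1..n}" "\<tau> * ?d \<le> partial_sum Y i \<omega>" by auto
      assume "\<omega> \<notin> ?B"
      then have small: "\<bar>Y j \<omega>\<bar> < ?y" if "j \<in> {1..n}" for j using i(1) that by force
      have "(\<Sum>l<i. clip ?y (path \<omega> l)) = (\<Sum>l<i. path \<omega> l)"
      proof (rule sum.cong)
        fix l assume "l \<in> {..<i}"
        then have "\<bar>Y (Suc l) \<omega>\<bar> < ?y" using small[of "Suc l"] i(2) by auto
        then show "clip ?y (path \<omega> l) = path \<omega> l" by (auto simp: max_def min_def)
      qed simp
      then have "x + 1 / lam \<le> (\<Sum>l<i. clip ?y (path \<omega> l))"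
        using i(3) unfolding partial_sum_path x_def by simp
      then show "\<omega> \<in> ?A" using i by blast
    qed
    ultimately have "Vhat {\<omega> \<in> space M. \<exists>i\<in>{1..n}. \<tau> * ?d \<le> partial_sum Y i \<omega>}
        \<le> ereal (exp (real n * a - lam * x) + real n * (tail n / \<delta> ^ 4))"
      using Vhat_mono order_trans by blast
    also have "exp (real n * a - lam * x) + real n * (tail n / \<delta> ^ 4) \<le> K * (?q + exp (- u))"
    proof -
      have "real n * (tail n / \<delta> ^ 4) = 1 / \<delta> ^ 4 * (real n * tail n)" by simp
      also have "\<dots> \<le> 1 / \<delta> ^ 4 * (?q + exp (- u))"
        using tail_u \<delta> by (intro mult_left_mono) (auto simp: add_increasing)
      finally show ?thesis using bnd by (simp add: K_def distrib_right)
    qed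
    finally show ?thesis by simp
  qed
  ultimately show ?thesis by blast
qed

end

section \<open>Geometric subsequences\<close>

definition geo :: "real \<Rightarrow> nat \<Rightarrow> nat" where
  "geo \<theta> k = nat \<lceil>\<theta> ^ k\<rceil>"

lemma geo_bounds:
  assumes "1 < \<theta>"
  shows "\<theta> ^ k \<le> real (geo \<theta> k)" "real (geo \<theta> k) \<le> \<theta> ^ k + 1" "1 \<le> geo \<theta> k"
proof -
  have "1 \<le> \<theta> ^ k" using assms by (intro one_le_power) simp
  then have "1 \<le> \<lceil>\<theta> ^ k\<rceil>" by linarith
  then show "\<theta> ^ k \<le> real (geo \<theta> k)" "real (geo \<theta> k) \<le> \<theta> ^ k + 1" "1 \<le> geo \<theta> k"
    unfolding geo_def by linarith+
qed

lemma geo_mono: "1 < \<theta> \<Longrightarrow> k \<le> l \<Longrightarrow> geo \<theta> k \<le> geo \<theta> l"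
  unfolding geo_def by (intro nat_mono ceiling_mono power_increasing) auto

lemma eventually_power_ge:
  fixes \<theta> c :: real
  assumes "1 < \<theta>" shows "\<forall>\<^sub>F k in sequentially. c \<le> \<theta> ^ k"
proof -
  obtain k0 where "c < \<theta> ^ k0" using real_arch_pow[OF assms] by blast
  moreover have "\<theta> ^ k0 \<le> \<theta> ^ k" if "k0 \<le> k" for k using that assms by (intro power_increasing) auto
  ultimately show ?thesis unfolding eventually_sequentially by (meson less_imp_le order_trans)
qed

lemma eventually_geo_ge:
  assumes "1 < \<theta>" shows "\<forall>\<^sub>F k in sequentially. N \<le> geo \<theta> k"
proof -
  have "\<forall>\<^sub>F k in sequentially. real N \<le> \<theta> ^ k" by (rule eventually_power_ge[OF assms])
  then show ?thesis
  proof eventually_elim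
    case (elim k)
    then have "real N \<le> real (geo \<theta> k)" using geo_bounds(1)[OF assms, of k] by linarith
    then show ?case by simp
  qed
qed

lemma eventually_power_gap:
  fixes \<theta> c :: real
  assumes "1 < \<theta>" shows "\<forall>\<^sub>F k in sequentially. c \<le> \<theta> ^ k * (\<theta> - 1)"
proof -
  have "\<forall>\<^sub>F k in sequentially. c / (\<theta> - 1) \<le> \<theta> ^ k" by (rule eventually_power_ge[OF assms])
  then show ?thesis by eventually_elim (use assms in \<open>simp add: field_simps\<close>)
qed

text \<open>The ratio is asymptotically \<theta>; the spare factor \<theta> absorbs the
  rounding.\<close>

lemma eventually_geo_ratio:
  assumes "1 < \<theta>" shows "\<forall>\<^sub>F k in sequentially. real (geo \<theta> (Suc k)) \<le> \<theta>\<^sup>2 * real (geo \<theta> k)"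
  using eventually_power_gap[OF assms, of 1]
proof eventually_elim
  case (elim k)
  have "\<theta> ^ Suc k + 1 \<le> \<theta> ^ Suc k + \<theta> * (\<theta> ^ k * (\<theta> - 1))"
    using mult_mono[of 1 \<theta> 1 "\<theta> ^ k * (\<theta> - 1)"] elim assms by simp
  also have "\<dots> = \<theta>\<^sup>2 * \<theta> ^ k" by (simp add: power2_eq_square algebra_simps)
  also have "\<dots> \<le> \<theta>\<^sup>2 * real (geo \<theta> k)" using geo_bounds(1)[OF assms] by (intro mult_left_mono) auto
  finally show ?case using geo_bounds(2)[OF assms, of "Suc k"] by linarith
qed

text \<open>Cauchy condensation for a real ratio. Eventually the gap between consecutive terms is at
  least \<open>\<theta> ^ k * (\<theta> - 1) / 2\<close>, while the upper end is at most
  \<open>2 * \<theta> ^ Suc k\<close>; the quotient is the constant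
  \<open>4 * \<theta> / (\<theta> - 1)\<close>.\<close>

lemma summable_geo:
  fixes b :: "nat \<Rightarrow> real"
  assumes \<theta>: "1 < \<theta>" and b0: "\<And>n. 0 \<le> b n" and anti: "\<And>m n. 1 \<le> m \<Longrightarrow> m \<le> n \<Longrightarrow> b n \<le> b m"
    and sb: "summable b"
  shows "summable (\<lambda>k. real (geo \<theta> k) * b (geo \<theta> k))"
proof -
  let ?g = "geo \<theta>"
  let ?c = "\<lambda>k. (real (?g (Suc k)) - real (?g k)) * b (?g (Suc k))"
  have mono: "?g k \<le> ?g (Suc k)" for k by (rule geo_mono[OF \<theta>]) simp
  have part: "(\<Sum>k<N. ?c k) \<le> (\<Sum>n\<in>{1..?g N}. b n)" for N
  proof (induction N)
    case 0 then show ?case using b0 by (simp add: sum_nonneg)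
  next
    case (Suc N)
    have "?c N = (\<Sum>n\<in>{Suc (?g N)..?g (Suc N)}. b (?g (Suc N)))" using mono[of N] by (simp add: of_nat_diff)
    also have "\<dots> \<le> (\<Sum>n\<in>{Suc (?g N)..?g (Suc N)}. b n)" by (intro sum_mono anti) auto
    finally have "(\<Sum>k<Suc N. ?c k) \<le> (\<Sum>n\<in>{1..?g N}. b n) + (\<Sum>n\<in>{Suc (?g N)..?g (Suc N)}. b n)"
      using Suc by simp
    also have "\<dots> = (\<Sum>n\<in>{1..?g N} \<union> {Suc (?g N)..?g (Suc N)}. b n)" by (intro sum.union_disjoint[symmetric]) auto
    also have "{1..?g N} \<union> {Suc (?g N)..?g (Suc N)} = {1..?g (Suc N)}" using mono[of N] by auto
    finally show ?case .
  qed
  have "summable ?c"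
  proof (rule summableI_nonneg_bounded)
    show "0 \<le> ?c k" for k using mono[of k] b0 by simp
    show "(\<Sum>k<N. ?c k) \<le> suminf b" for N
      using part[of N] sum_le_suminf[OF sb, of "{1..?g N}"] b0 by simp
  qed
  then have sc: "summable (\<lambda>k. 4 * \<theta> / (\<theta> - 1) * ?c k)" by (rule summable_mult)
  have "summable (\<lambda>k. real (?g (Suc k)) * b (?g (Suc k)))"
  proof (rule summable_comparison_test_ev[OF _ sc])
    show "\<forall>\<^sub>F k in sequentially. norm (real (?g (Suc k)) * b (?g (Suc k))) \<le> 4 * \<theta> / (\<theta> - 1) * ?c k"
      using eventually_power_gap[OF \<theta>, of 2]
    proof eventually_elim
      case (elim k)
      have "\<theta> ^ k * (\<theta> - 1) / 2 \<le> real (?g (Suc k)) - real (?g k)"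
        using geo_bounds(1)[OF \<theta>, of "Suc k"] geo_bounds(2)[OF \<theta>, of k] elim by (simp add: field_simps)
      then have "4 * \<theta> / (\<theta> - 1) * (\<theta> ^ k * (\<theta> - 1) / 2) \<le> 4 * \<theta> / (\<theta> - 1) * (real (?g (Suc k)) - real (?g k))"
        using \<theta> by (intro mult_left_mono) auto
      moreover have "4 * \<theta> / (\<theta> - 1) * (\<theta> ^ k * (\<theta> - 1) / 2) = 2 * \<theta> ^ Suc k" using \<theta> by simp
      moreover have "1 \<le> \<theta> ^ Suc k" using \<theta> by (intro one_le_power) simp
      ultimately have "real (?g (Suc k)) \<le> 4 * \<theta> / (\<theta> - 1) * (real (?g (Suc k)) - real (?g k))"
        using geo_bounds(2)[OF \<theta>, of "Suc k"] by linarith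
      then have "real (?g (Suc k)) * b (?g (Suc k)) \<le> 4 * \<theta> / (\<theta> - 1) * (real (?g (Suc k)) - real (?g k)) * b (?g (Suc k))"
        using b0 by (intro mult_right_mono)
      then show ?case using b0[of "?g (Suc k)"] by (simp add: mult.assoc)
    qed
  qed
  then show ?thesis by (subst (asm) summable_Suc_iff)
qed

lemma ln_le_clog: "0 < x \<Longrightarrow> ln x \<le> clog x"
  unfolding clog_def by (subst ln_le_cancel_iff) auto

lemma llog_geo_ge:
  assumes "1 < \<theta>" "1 \<le> k" shows "ln (real k * ln \<theta>) \<le> llog (real (geo \<theta> k))"
proof -
  have "real k * ln \<theta> = ln (\<theta> ^ k)" using assms by (simp add: ln_realpow)
  also have "\<dots> \<le> ln (real (geo \<theta> k))"
    using geo_bounds(1,3)[OF assms(1), of k] assms by (subst ln_le_cancel_iff) auto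
  also have "\<dots> \<le> clog (real (geo \<theta> k))" using geo_bounds(3)[OF assms(1), of k] by (intro ln_le_clog) simp
  finally have le: "real k * ln \<theta> \<le> clog (real (geo \<theta> k))" .
  have pos: "0 < real k * ln \<theta>" using assms by simp
  then have "ln (real k * ln \<theta>) \<le> ln (clog (real (geo \<theta> k)))" using le by (subst ln_le_cancel_iff) auto
  also have "\<dots> \<le> llog (real (geo \<theta> k))" using pos le by (intro ln_le_clog) auto
  finally show ?thesis .
qed

lemma exp_llog_geo_le:
  assumes "1 < \<theta>" "1 \<le> k" "0 \<le> q"
  shows "exp (- llog (real (geo \<theta> k)) * q) \<le> (real k * ln \<theta>) powr - q"
proof -
  have "- llog (real (geo \<theta> k)) * q \<le> - q * ln (real k * ln \<theta>)"
    using mult_right_mono[OF llog_geo_ge[OF assms(1,2)] assms(3)] by (simp add: mult.commute)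
  then show ?thesis using assms by (simp add: powr_def)
qed

section \<open>The upper half\<close>

context lil_seq
begin

text \<open>With the norm inside, the integrand is the fourth power of
  \<open>\<bar>y\<bar> / lil_norm n\<close> capped at 1, which decreases pointwise in
  \<open>n\<close>. Condensation requires this.\<close>

lemma tail_antimono:
  assumes "1 \<le> m" "m \<le> n" shows "tail n \<le> tail m"
proof -
  have d: "0 < lil_norm m" "lil_norm m \<le> lil_norm n" "0 < lil_norm n"
    using lil_norm_pos[of m] lil_norm_pos[of n] lil_norm_mono[of m n] assms by auto
  have eq: "tail k = e (\<lambda>y. 1 / lil_norm k ^ 4 * (capped (lil_norm k) y) ^ 4)" if "0 < lil_norm k" for k
    unfolding tail_def using e_cmult_pow[of "lil_norm k" "1 / lil_norm k ^ 4" 4] that by simp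
  show ?thesis unfolding eq[OF d(1)] eq[OF d(3)]
  proof (rule e_mono)
    show "(\<lambda>y. 1 / lil_norm n ^ 4 * (capped (lil_norm n) y) ^ 4) \<in> bl line_dist"
      "(\<lambda>y. 1 / lil_norm m ^ 4 * (capped (lil_norm m) y) ^ 4) \<in> bl line_dist"
      by (intro bl_cmult bl_capped_pow less_imp_le d)+
    fix y :: real
    have "\<bar>y\<bar> * lil_norm m \<le> \<bar>y\<bar> * lil_norm n" using d by (intro mult_left_mono) auto
    moreover have "\<bar>y\<bar> * lil_norm m \<le> lil_norm n * lil_norm m" if "\<bar>y\<bar> \<le> lil_norm n"
      using that d by (intro mult_right_mono) auto
    ultimately have "capped (lil_norm n) y / lil_norm n \<le> capped (lil_norm m) y / lil_norm m"
      using d by (auto simp: min_def field_simps)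
    then have "(capped (lil_norm n) y / lil_norm n) ^ 4 \<le> (capped (lil_norm m) y / lil_norm m) ^ 4"
      using d by (intro power_mono) auto
    then show "1 / lil_norm n ^ 4 * (capped (lil_norm n) y) ^ 4 \<le> 1 / lil_norm m ^ 4 * (capped (lil_norm m) y) ^ 4"
      by (simp add: power_divide)
  qed
qed

lemma summable_tail_geo: "1 < \<theta> \<Longrightarrow> summable (\<lambda>k. real (geo \<theta> k) * tail (geo \<theta> k))"
  by (rule summable_geo[OF _ tail_nonneg tail_antimono summable_tail])

definition upper_event :: "real \<Rightarrow> nat \<Rightarrow> 'a set" where
  "upper_event \<tau> n = {\<omega> \<in> space M. \<exists>i\<in>{1..n}. \<tau> * lil_norm n \<le> partial_sum Y i \<omega>}"

lemma upper_event_sets: "upper_event \<tau> n \<in> sets M"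
proof -
  have "upper_event \<tau> n = (\<Union>i\<in>{1..n}. {\<omega> \<in> space M. \<tau> * lil_norm n \<le> partial_sum Y i \<omega>})"
    unfolding upper_event_def by auto
  also have "\<dots> \<in> sets M" by measurable
  finally show ?thesis .
qed

lemma upper_event_geo:
  assumes \<tau>: "0 < \<tau>" and s2: "S < s2" and \<theta>: "1 < \<theta>"
  shows "\<exists>a K. summable a \<and> 0 \<le> K \<and> (\<forall>\<^sub>F k in sequentially. Vhat (upper_event \<tau> (geo \<theta> k))
       \<le> ereal (K * ((real k * ln \<theta>) powr - (\<tau>\<^sup>2 / s2) + a k)))"
proof -
  \<comment> \<open>The second summand keeps \<open>a k\<close> positive when the tail vanishes, so
    that \<open>u = - ln (a k)\<close> makes sense, and it is summable.\<close>
  define a where "a = (\<lambda>k. real (geo \<theta> k) * tail (geo \<theta> k) + 1 / (real (Suc k))\<^sup>2)"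
  have a0: "0 < a k" for k unfolding a_def using tail_nonneg[of "geo \<theta> k"] by (intro add_nonneg_pos) auto
  have "summable (\<lambda>k. 1 / (real (Suc k))\<^sup>2)"
    using summable_Suc_iff[of "\<lambda>k. 1 / (real k)\<^sup>2"] inverse_power_summable[of 2, where ?'a = real] by (simp add: inverse_eq_divide)
  then have sa: "summable a" unfolding a_def by (intro summable_add summable_tail_geo[OF \<theta>])
  have s2pos: "0 < s2" using S_nonneg s2 by simp
  obtain K where K: "0 \<le> K" "\<forall>n\<ge>1. \<forall>u>0. real n * tail n \<le> exp (- u) \<longrightarrow> Vhat (upper_event \<tau> n)
      \<le> ereal (K * (exp (- llog (real n) * (\<tau>\<^sup>2 / s2)) + exp (- u)))"
    using upper_exponential_inequality[OF \<tau> s2] unfolding upper_event_def by blast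
  have "\<forall>\<^sub>F k in sequentially. a k < 1"
    using summable_LIMSEQ_zero[OF sa] by (rule order_tendstoD) simp
  then have "\<forall>\<^sub>F k in sequentially. Vhat (upper_event \<tau> (geo \<theta> k))
       \<le> ereal (K * ((real k * ln \<theta>) powr - (\<tau>\<^sup>2 / s2) + a k))"
    using eventually_ge_at_top[of 1]
  proof eventually_elim
    case (elim k)
    let ?n = "geo \<theta> k"
    have u: "0 < - ln (a k)" "exp (- (- ln (a k))) = a k" using a0[of k] elim by auto
    have "Vhat (upper_event \<tau> ?n) \<le> ereal (K * (exp (- llog (real ?n) * (\<tau>\<^sup>2 / s2)) + a k))"
      using K(2)[rule_format, OF geo_bounds(3)[OF \<theta>] u(1)] unfolding u(2) by (simp add: a_def)
    also have "\<dots> \<le> ereal (K * ((real k * ln \<theta>) powr - (\<tau>\<^sup>2 / s2) + a k))"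
      using exp_llog_geo_le[OF \<theta> elim(2), of "\<tau>\<^sup>2 / s2"] s2pos K(1) by (simp add: mult_left_mono)
    finally show ?case .
  qed
  then show ?thesis using sa K(1) by blast
qed

text \<open>If \<open>n\<close> lies between two consecutive geometric times, the event at the later
  time contains the index \<open>n\<close>. Its norm exceeds that of the earlier time, hence of
  \<open>n\<close>, by at most \<open>\<theta>\<^sup>2\<close>.\<close>

lemma upper_event_interpolation:
  assumes \<tau>: "0 < \<tau>" and \<theta>: "1 < \<theta>" and \<tau>': "\<tau> * \<theta>\<^sup>2 = \<tau>'"
  shows "{\<omega> \<in> space M. \<exists>\<^sub>\<infinity>n. \<tau>' * lil_norm n \<le> partial_sum Y n \<omega>}
      \<subseteq> {\<omega>. \<exists>\<^sub>\<infinity>k. \<omega> \<in> upper_event \<tau> (geo \<theta> k)}"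
proof (intro subsetI CollectI, elim CollectE conjE)
  fix \<omega> assume \<omega>: "\<omega> \<in> space M" and inf: "\<exists>\<^sub>\<infinity>n. \<tau>' * lil_norm n \<le> partial_sum Y n \<omega>"
  obtain k0 where k0: "\<And>k. k0 \<le> k \<Longrightarrow> real (geo \<theta> (Suc k)) \<le> \<theta>\<^sup>2 * real (geo \<theta> k)"
    using eventually_geo_ratio[OF \<theta>] unfolding eventually_sequentially by blast
  show "\<exists>\<^sub>\<infinity>k. \<omega> \<in> upper_event \<tau> (geo \<theta> k)"
    unfolding INFM_nat_le
  proof
    fix k2
    define k1 where "k1 = max k0 k2"
    obtain n where n: "Suc (geo \<theta> k1) \<le> n" "\<tau>' * lil_norm n \<le> partial_sum Y n \<omega>"
      using inf unfolding INFM_nat_le by blast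
    \<comment> \<open>The first geometric time not before \<open>n\<close>. Since \<open>n\<close>
      exceeds \<open>geo \<theta> k1\<close>, this \<open>k\<close> has a predecessor beyond
      \<open>k0\<close>, where the ratio bound holds.\<close>
    define k where "k = (LEAST k. n \<le> geo \<theta> k)"
    have "\<exists>k. n \<le> geo \<theta> k" using eventually_geo_ge[OF \<theta>, of n] unfolding eventually_sequentially by blast
    then have k: "n \<le> geo \<theta> k" unfolding k_def by (rule LeastI_ex)
    have kk1: "k1 < k"
    proof (rule ccontr)
      assume "\<not> k1 < k"
      then have "geo \<theta> k \<le> geo \<theta> k1" by (intro geo_mono[OF \<theta>]) simp
      then show False using k n by simp
    qed
    then obtain j where j: "k = Suc j" "k1 \<le> j" by (cases k) auto
    have "j < (LEAST k. n \<le> geo \<theta> k)" using j(1) unfolding k_def by simp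
    then have jn: "geo \<theta> j < n" using not_less_Least by fastforce
    have g1: "1 \<le> geo \<theta> j" by (rule geo_bounds(3)[OF \<theta>])
    have "\<tau> * lil_norm (geo \<theta> k) \<le> \<tau> * (\<theta>\<^sup>2 * lil_norm (geo \<theta> j))"
    proof (rule mult_left_mono)
      have "lil_norm (geo \<theta> k) \<le> real (geo \<theta> k) / real (geo \<theta> j) * lil_norm (geo \<theta> j)"
        by (rule lil_norm_scale[OF g1]) (use geo_mono[OF \<theta>] j in auto)
      also have "\<dots> \<le> \<theta>\<^sup>2 * lil_norm (geo \<theta> j)"
      proof (rule mult_right_mono[OF _ lil_norm_nonneg])
        have "real (geo \<theta> k) \<le> \<theta>\<^sup>2 * real (geo \<theta> j)" using k0[of j] j by (simp add: k1_def)
        then show "real (geo \<theta> k) / real (geo \<theta> j) \<le> \<theta>\<^sup>2" using g1 by (simp add: pos_divide_le_eq)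
      qed
      finally show "lil_norm (geo \<theta> k) \<le> \<theta>\<^sup>2 * lil_norm (geo \<theta> j)" .
    qed (use \<tau> in simp)
    also have "\<dots> = \<tau>' * lil_norm (geo \<theta> j)" using \<tau>' by (simp flip: mult.assoc)
    also have "\<dots> \<le> \<tau>' * lil_norm n" using jn \<tau> \<theta> \<tau>' by (intro mult_left_mono lil_norm_mono) auto
    also note n(2)
    finally have "\<omega> \<in> upper_event \<tau> (geo \<theta> k)"
      unfolding upper_event_def using \<omega> k n(1) by auto
    moreover have "k2 \<le> k" using kk1 by (simp add: k1_def)
    ultimately show "\<exists>k\<ge>k2. \<omega> \<in> upper_event \<tau> (geo \<theta> k)" by blast
  qed
qed

lemma null_upper:
  assumes "sqrt S < \<tau>'"
  shows "null {\<omega> \<in> space M. \<exists>\<^sub>\<infinity>n. \<tau>' * lil_norm n \<le> partial_sum Y n \<omega>}"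
proof -
  \<comment> \<open>The gap up to \<tau>' pays for the interpolation
    (\<open>\<theta>\<^sup>2 = \<tau>' / \<tau>\<close>). The gap above \<open>sqrt S\<close> leaves
    room for \<open>s2\<close> with \<open>q = \<tau>\<^sup>2 / s2 > 1\<close>, which makes the
    powers of \<open>k\<close> summable.\<close>
  obtain \<tau> where \<tau>: "sqrt S < \<tau>" "\<tau> < \<tau>'" using dense[OF assms] by blast
  have \<tau>pos: "0 < \<tau>" using \<tau>(1) real_sqrt_ge_zero[OF S_nonneg] by linarith
  have S\<tau>: "S < \<tau>\<^sup>2"
    using power_strict_mono[OF \<tau>(1) real_sqrt_ge_zero[OF S_nonneg], of 2] S_nonneg by simp
  then obtain s2 where s2: "S < s2" "s2 < \<tau>\<^sup>2" using dense by blast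
  have s2pos: "0 < s2" using S_nonneg s2 by simp
  define \<theta> where "\<theta> = sqrt (\<tau>' / \<tau>)"
  have "1 < \<tau>' / \<tau>" using \<tau> \<tau>pos by simp
  then have \<theta>: "1 < \<theta>" "\<theta>\<^sup>2 = \<tau>' / \<tau>" by (auto simp: \<theta>_def)
  define q where "q = \<tau>\<^sup>2 / s2"
  have q: "1 < q" using s2 s2pos by (simp add: q_def)
  obtain a K where a: "summable a" and K: "0 \<le> K"
    "\<forall>\<^sub>F k in sequentially. Vhat (upper_event \<tau> (geo \<theta> k)) \<le> ereal (K * ((real k * ln \<theta>) powr - q + a k))"
    using upper_event_geo[OF \<tau>pos s2(1) \<theta>(1)] unfolding q_def by blast
  obtain k0 where k0: "\<And>k. k0 \<le> k \<Longrightarrow> Vhat (upper_event \<tau> (geo \<theta> k)) \<le> ereal (K * ((real k * ln \<theta>) powr - q + a k))"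
    using K(2) by (auto simp: eventually_sequentially)
  have "summable (\<lambda>k. real k powr - q * (ln \<theta>) powr - q)"
    using q by (intro summable_mult2) (simp add: summable_real_powr_iff)
  then have "summable (\<lambda>k. (real k * ln \<theta>) powr - q)" using \<theta>(1) by (simp add: powr_mult)
  then have "summable (\<lambda>k. K * ((real k * ln \<theta>) powr - q + a k))" using a by (intro summable_mult summable_add)
  with k0 upper_event_sets have "null {\<omega>. \<exists>\<^sub>\<infinity>k. \<omega> \<in> upper_event \<tau> (geo \<theta> k)}"
    by (intro null_Borel_Cantelli[where start = k0 and a = "\<lambda>k. K * ((real k * ln \<theta>) powr - q + a k)"]) simp_all
  moreover have "{\<omega> \<in> space M. \<exists>\<^sub>\<infinity>n. \<tau>' * lil_norm n \<le> partial_sum Y n \<omega>}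
      \<subseteq> {\<omega>. \<exists>\<^sub>\<infinity>k. \<omega> \<in> upper_event \<tau> (geo \<theta> k)}"
    by (rule upper_event_interpolation[OF \<tau>pos \<theta>(1)]) (use \<theta>(2) \<tau>pos in simp)
  ultimately show ?thesis by (rule null_mono)
qed

text \<open>A weak law: for every positive level the bound of \<open>upper_event_geo\<close> tends
  to 0, even where it is not summable. Applied to \<open>- Y\<close>, it settles the lower half for
  \<open>s = 0\<close>.\<close>

lemma null_eventually_above:
  assumes "0 < \<epsilon>"
  shows "null {\<omega> \<in> space M. \<forall>\<^sub>F n in sequentially. \<epsilon> * lil_norm n \<le> partial_sum Y n \<omega>}"
proof -
  let ?B = "\<lambda>N. {\<omega> \<in> space M. \<forall>n. N \<le> n \<longrightarrow> \<epsilon> * lil_norm n \<le> partial_sum Y n \<omega>}"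
  have "null (?B N)" for N
  proof (rule null_of_Vhat_small)
    show "?B N \<in> sets M" by measurable
    fix r :: real assume r: "0 < r"
    have \<theta>: "1 < (2::real)" by simp
    define q where "q = \<epsilon>\<^sup>2 / (S + 1)"
    have q: "0 < q" using assms S_nonneg by (simp add: q_def)
    obtain a K where a: "summable a" and K: "0 \<le> K"
      "\<forall>\<^sub>F k in sequentially. Vhat (upper_event \<epsilon> (geo 2 k)) \<le> ereal (K * ((real k * ln 2) powr - q + a k))"
      using upper_event_geo[OF assms less_add_one \<theta>] unfolding q_def by blast
    have "((\<lambda>k. (real k * ln 2) powr - q) \<longlongrightarrow> 0) sequentially"
    proof (rule tendsto_neg_powr)
      show "- q < 0" using q by simp
      show "filterlim (\<lambda>k. real k * ln 2) at_top sequentially" by real_asymp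
    qed
    then have "((\<lambda>k. K * ((real k * ln 2) powr - q + a k)) \<longlongrightarrow> K * (0 + 0)) sequentially"
      by (rule tendsto_mult[OF tendsto_const tendsto_add[OF _ summable_LIMSEQ_zero[OF a]]])
    then have "\<forall>\<^sub>F k in sequentially. K * ((real k * ln 2) powr - q + a k) < r"
      using r by (intro order_tendstoD) auto
    then have "\<forall>\<^sub>F k in sequentially. Vhat (?B N) \<le> ereal r"
      using K(2) eventually_geo_ge[OF \<theta>, of "max 1 N"]
    proof eventually_elim
      case (elim k)
      have "?B N \<subseteq> upper_event \<epsilon> (geo 2 k)" unfolding upper_event_def using elim(3) by auto
      then have "Vhat (?B N) \<le> Vhat (upper_event \<epsilon> (geo 2 k))" by (rule Vhat_mono)
      also have "\<dots> \<le> ereal (K * ((real k * ln 2) powr - q + a k))" by (rule elim(2))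
      also have "\<dots> \<le> ereal r" using elim(1) by simp
      finally show ?case .
    qed
    then show "Vhat (?B N) \<le> ereal r" by simp
  qed
  then have "null (\<Union>N. ?B N)" by (rule null_UN)
  then show ?thesis by (rule null_mono) (auto simp: eventually_sequentially)
qed

end

section \<open>The lower exponential inequality\<close>

lemma exp_ge_cubic:
  fixes u :: real shows "1 + u + u\<^sup>2 / 2 + u ^ 3 / 6 \<le> exp u"
proof -
  obtain t where t: "exp u = (\<Sum>m<4. u ^ m / fact m) + exp t / fact 4 * u ^ 4"
    using Maclaurin_exp_le[of u 4] by auto
  have "(\<Sum>m<4. u ^ m / fact m) = 1 + u + u\<^sup>2 / 2 + u ^ 3 / 6"
    by (simp add: eval_nat_numeral fact_numeral)
  moreover have "0 \<le> exp t / fact 4 * u ^ 4" by simp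
  ultimately show ?thesis using t by linarith
qed

lemma abs_diff_bound:
  fixes A B :: real
  shows "\<bar>A\<bar> \<le> a \<Longrightarrow> 0 \<le> B \<Longrightarrow> B \<le> c \<Longrightarrow> a + c \<le> \<xi> \<Longrightarrow> \<bar>A - B\<bar> \<le> \<xi>"
  by linarith

text \<open>
  For \<open>A = z X / r\<close> and \<open>B = X\<^sup>2 / (2 r)\<close> the left-hand side is a combination of \<open>X\<close>, \<open>X\<^sup>2\<close> and \<open>X\<^sup>4\<close>.
\<close>

lemma exp_ge_square_small:
  fixes A B \<xi> :: real
  assumes "\<bar>A - B\<bar> \<le> \<xi>" "0 < \<xi>" "\<xi> \<le> 1"
  shows "1 + A - B + (1 - 2 * \<xi>) * A\<^sup>2 / 2 - B\<^sup>2 / (2 * \<xi>) \<le> exp (A - B)"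
proof -
  let ?u = "A - B"
  have "- (\<xi> * ?u\<^sup>2) \<le> ?u * ?u\<^sup>2" using mult_right_mono[of "- \<xi>" ?u "?u\<^sup>2"] assms(1) by (simp add: abs_le_iff)
  then have "- (\<xi> * ?u\<^sup>2) \<le> ?u ^ 3" by (simp add: eval_nat_numeral)
  moreover have "0 \<le> \<xi> * ?u\<^sup>2" using assms by simp
  ultimately have "1 + ?u + (1 - \<xi>) * ?u\<^sup>2 / 2 \<le> exp ?u"
  proof -
    assume 1: "- (\<xi> * ?u\<^sup>2) \<le> ?u ^ 3" and 2: "0 \<le> \<xi> * ?u\<^sup>2"
    have "(1 - \<xi>) * ?u\<^sup>2 / 2 = ?u\<^sup>2 / 2 - \<xi> * ?u\<^sup>2 / 2" by (simp add: field_simps)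
    then show ?thesis using exp_ge_cubic[of ?u] 1 2 by linarith
  qed
  moreover have "(1 - 2 * \<xi>) * A\<^sup>2 - B\<^sup>2 / \<xi> \<le> (1 - \<xi>) * ?u\<^sup>2"
  proof -
    \<comment> \<open>The cross term \<open>A * B\<close> is cubic in the truncated variable; it is
      traded for a little of \<open>A\<^sup>2\<close> and a large multiple of
      \<open>B\<^sup>2\<close>.\<close>
    have "0 \<le> (\<xi> * A - B)\<^sup>2 / \<xi>" using assms by simp
    also have "\<dots> = \<xi> * A\<^sup>2 - 2 * A * B + B\<^sup>2 / \<xi>" using assms by (simp add: power2_eq_square field_simps)
    finally have "2 * A * B \<le> \<xi> * A\<^sup>2 + B\<^sup>2 / \<xi>" by simp
    moreover have "?u\<^sup>2 = A\<^sup>2 - 2 * A * B + B\<^sup>2" by (simp add: power2_eq_square algebra_simps)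
    moreover have "(1 - \<xi>) * A\<^sup>2 = A\<^sup>2 - \<xi> * A\<^sup>2" by (simp add: algebra_simps)
    ultimately have "(1 - \<xi>) * A\<^sup>2 - B\<^sup>2 / \<xi> \<le> ?u\<^sup>2" using zero_le_power2[of B] by linarith
    then have "(1 - \<xi>) * ((1 - \<xi>) * A\<^sup>2 - B\<^sup>2 / \<xi>) \<le> (1 - \<xi>) * ?u\<^sup>2" using assms by (intro mult_left_mono) auto
    moreover have "(1 - \<xi>) * ((1 - \<xi>) * A\<^sup>2 - B\<^sup>2 / \<xi>) = (1 - 2 * \<xi>) * A\<^sup>2 - B\<^sup>2 / \<xi> + \<xi>\<^sup>2 * A\<^sup>2 + B\<^sup>2"
      using assms by (simp add: power2_eq_square field_simps)
    moreover have "0 \<le> \<xi>\<^sup>2 * A\<^sup>2 + B\<^sup>2" by simp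
    ultimately show ?thesis by linarith
  qed
  then have "(1 - 2 * \<xi>) * A\<^sup>2 / 2 - B\<^sup>2 / (2 * \<xi>) \<le> (1 - \<xi>) * ?u\<^sup>2 / 2"
    using assms by (simp add: field_simps)
  ultimately show ?thesis by linarith
qed

text \<open>Puts a one-step gain \<open>t\<close> and error \<open>x\<close> back into an exponent,
  so that the steps of a block can be multiplied; the price is \<open>t\<^sup>2\<close> and a second
  \<open>x\<close>.\<close>

lemma exp_le_one_plus_minus:
  fixes t x :: real
  assumes "0 \<le> t" "t \<le> 1" "0 \<le> x" "x \<le> 1 / 2"
  shows "exp (t - t\<^sup>2 - 2 * x) \<le> 1 + t - x"
proof -
  have "exp (t - t\<^sup>2) \<le> exp (ln (1 + t))"
    unfolding exp_le_cancel_iff using ln_one_plus_pos_lower_bound[of t] assms by blast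
  then have 1: "exp (t - t\<^sup>2) \<le> 1 + t" using assms by simp
  have "2 * x\<^sup>2 \<le> x" using mult_right_mono[of x "1/2" x] assms by (simp add: power2_eq_square)
  then have "exp (- 2 * x) \<le> exp (ln (1 - x))"
    unfolding exp_le_cancel_iff using ln_one_minus_pos_lower_bound[of x] assms by linarith
  then have 2: "exp (- 2 * x) \<le> 1 - x" using assms by simp
  have "exp (t - t\<^sup>2 - 2 * x) = exp (t - t\<^sup>2) * exp (- 2 * x)" by (simp flip: exp_add)
  also have "\<dots> \<le> (1 + t) * (1 - x)" using 1 2 assms by (intro mult_mono) auto
  also have "\<dots> \<le> 1 + t - x" using assms by (simp add: algebra_simps)
  finally show ?thesis .
qed

lemma bl_gaussian:
  assumes "0 < r" shows "(\<lambda>t. exp (- t\<^sup>2 / (2 * r))) \<in> bl line_dist"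
proof (rule blI[where K = 1 and L = "1 / r + 2"])
  show "\<bar>exp (- t\<^sup>2 / (2 * r))\<bar> \<le> 1" for t using assms by simp
  have deriv: "((\<lambda>t. exp (- t\<^sup>2 / (2 * r))) has_field_derivative (- t / r) * exp (- t\<^sup>2 / (2 * r))) (at t within UNIV)" for t
    using assms by (auto intro!: derivative_eq_intros simp: field_simps)
  have bound: "norm ((- t / r) * exp (- t\<^sup>2 / (2 * r))) \<le> 1 / r + 2" for t
  proof -
    have "\<bar>t\<bar> / r \<le> (1 / r + 2) * (1 + t\<^sup>2 / (2 * r))"
    proof -
      have "0 \<le> (\<bar>t\<bar> - 1)\<^sup>2 / r" using assms by simp
      then have "2 * \<bar>t\<bar> / r \<le> 1 / r + t\<^sup>2 / r" using assms by (simp add: power2_eq_square field_simps)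
      moreover have "0 \<le> t\<^sup>2 / r" "0 \<le> (1 / r) * (t\<^sup>2 / (2 * r))" "0 \<le> \<bar>t\<bar> / r" using assms by auto
      moreover have "(1 / r + 2) * (1 + t\<^sup>2 / (2 * r)) = 1 / r + 2 + (1 / r) * (t\<^sup>2 / (2 * r)) + t\<^sup>2 / r"
        using assms by (simp add: field_simps power2_eq_square)
      ultimately show ?thesis by linarith
    qed
    also have "\<dots> \<le> (1 / r + 2) * exp (t\<^sup>2 / (2 * r))"
      using assms by (intro mult_left_mono exp_ge_add_one_self) auto
    finally have "\<bar>t\<bar> / r * exp (- (t\<^sup>2 / (2 * r))) \<le> (1 / r + 2) * exp (t\<^sup>2 / (2 * r)) * exp (- (t\<^sup>2 / (2 * r)))"
      by (intro mult_right_mono) auto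
    also have "\<dots> = 1 / r + 2" by (simp add: mult.assoc flip: exp_add)
    finally show ?thesis using assms by (simp add: abs_mult)
  qed
  fix x y :: real
  show "\<bar>exp (- x\<^sup>2 / (2 * r)) - exp (- y\<^sup>2 / (2 * r))\<bar> \<le> (1 / r + 2) * \<bar>line_dist x y\<bar>"
    using field_differentiable_bound[OF convex_UNIV deriv bound, of x y] by (simp add: line_dist_def)
qed

context lil_seq
begin

text \<open>Relative to its value at \<open>z\<close>, the shifted Gaussian is
  \<open>exp ((z * y - y\<^sup>2 / 2) / r)\<close>. It is expanded to second order on
  \<open>\<bar>y\<bar> \<le> b\<close>; beyond \<open>b\<close> the fourth-power term makes the
  claimed lower bound nonpositive.\<close>

lemma gaussian_expectation_lower:
  assumes n: "1 \<le> n" and b: "0 < b" "b \<le> lil_norm n" and r: "0 < r"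
    and \<xi>: "0 < \<xi>" "\<xi> \<le> 1 / 4" "\<bar>z\<bar> * b / r + b\<^sup>2 / (2 * r) \<le> \<xi>"
    and v1: "v1 \<le> - e (\<lambda>y. - (capped b y)\<^sup>2)"
  defines "Err \<equiv> \<bar>z\<bar> / r * (S / lil_norm n + lil_norm n ^ 4 * tail n / b ^ 3)
      + (1 / (2 * r) + b\<^sup>2 / (8 * \<xi> * r\<^sup>2)) * S + 2 / b ^ 4 * (lil_norm n ^ 4 * tail n)"
  shows "exp (- z\<^sup>2 / (2 * r)) * (1 + (1 - 2 * \<xi>) * z\<^sup>2 / (2 * r\<^sup>2) * v1 - Err)
    \<le> - e (\<lambda>y. - exp (- (z - y)\<^sup>2 / (2 * r)))"
proof -
  let ?d = "lil_norm n"
  have d: "0 \<le> ?d" by (rule lil_norm_nonneg)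
  have b0: "0 \<le> b" using b by simp
  define G where "G = exp (- z\<^sup>2 / (2 * r))"
  define P where "P = (1 - 2 * \<xi>) * z\<^sup>2 / (2 * r\<^sup>2)"
  define Q where "Q = 1 / (2 * r) + b\<^sup>2 / (8 * \<xi> * r\<^sup>2)"
  \<comment> \<open>The sign of the linear term goes into the function, because \<open>e\<close> is
    homogeneous for nonnegative factors only.\<close>
  define \<sigma> where "\<sigma> = (if z \<le> 0 then 1 else - 1 :: real)"
  have PQ: "0 \<le> P" "0 \<le> Q" using \<xi> r by (auto simp: P_def Q_def)
  have \<sigma>z: "\<bar>z\<bar> * \<sigma> = - z" by (simp add: \<sigma>_def)
  \<comment> \<open>The two square terms stay separate: the gain, with factor \<open>P\<close>, is
    governed by the lower second moment \<open>v1\<close>, the loss, with factor \<open>Q\<close>,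
    by the upper bound \<open>S\<close>.\<close>
  define R where "R = (\<lambda>y. \<bar>z\<bar> / r * (\<sigma> * clip b y) + (P * - (capped b y)\<^sup>2 + (Q * (capped b y)\<^sup>2 + 2 / b ^ 4 * (capped ?d y) ^ 4)))"
  have bl1: "(\<lambda>y. \<bar>z\<bar> / r * (\<sigma> * clip b y)) \<in> bl line_dist" by (intro bl_cmult bl_clip b0)
  have bl1': "(\<lambda>y. \<sigma> * clip b y) \<in> bl line_dist" by (intro bl_cmult bl_clip b0)
  have bl2: "(\<lambda>y. P * - (capped b y)\<^sup>2) \<in> bl line_dist" by (intro bl_cmult bl_uminus bl_capped_pow b0)
  have bl2': "(\<lambda>y. - (capped b y)\<^sup>2) \<in> bl line_dist" by (intro bl_uminus bl_capped_pow b0)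
  have bl3: "(\<lambda>y. Q * (capped b y)\<^sup>2) \<in> bl line_dist" by (intro bl_cmult bl_capped_pow b0)
  have bl4: "(\<lambda>y. 2 / b ^ 4 * (capped ?d y) ^ 4) \<in> bl line_dist" by (intro bl_cmult bl_capped_pow d)
  have Rbl: "R \<in> bl line_dist" unfolding R_def by (intro bl_add bl1 bl2 bl3 bl4)
  have gbl: "(\<lambda>y. exp (- (z - y)\<^sup>2 / (2 * r))) \<in> bl line_dist"
    using bl_affine[OF bl_gaussian[OF r], of z "- 1"] by simp
  have point: "- exp (- (z - y)\<^sup>2 / (2 * r)) \<le> G * (- 1 + R y)" for y
  proof -
    let ?X = "clip b y" and ?A = "z * clip b y / r" and ?B = "(clip b y)\<^sup>2 / (2 * r)"
    have X: "\<bar>?X\<bar> \<le> b" using abs_clip[OF b0, of y] by simp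
    have X2: "?X\<^sup>2 = (capped b y)\<^sup>2" by (rule clip_square[OF b0])
    have X2b: "?X\<^sup>2 \<le> b\<^sup>2" using power_mono[OF X, of 2] by simp
    have "\<bar>?A\<bar> \<le> \<bar>z\<bar> * b / r" using X r by (simp add: abs_mult divide_right_mono mult_left_mono)
    moreover have "0 \<le> ?B" "?B \<le> b\<^sup>2 / (2 * r)" using X2b r by (auto simp: divide_right_mono)
    ultimately have AB: "\<bar>?A - ?B\<bar> \<le> \<xi>" using \<xi>(3) by (rule abs_diff_bound)
    have "1 + ?A - ?B + (1 - 2 * \<xi>) * ?A\<^sup>2 / 2 - ?B\<^sup>2 / (2 * \<xi>) \<le> exp (?A - ?B)"
      by (rule exp_ge_square_small[OF AB \<xi>(1)]) (use \<xi>(2) in simp)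
    moreover have "(1 - 2 * \<xi>) * ?A\<^sup>2 / 2 = P * (capped b y)\<^sup>2"
      unfolding P_def X2[symmetric] by (simp add: power_mult_distrib power_divide)
    moreover have "?B\<^sup>2 / (2 * \<xi>) \<le> b\<^sup>2 / (8 * \<xi> * r\<^sup>2) * (capped b y)\<^sup>2"
    proof -
      have "?B\<^sup>2 / (2 * \<xi>) = ?X\<^sup>2 * ?X\<^sup>2 / (8 * \<xi> * r\<^sup>2)" by (simp add: power2_eq_square)
      also have "\<dots> \<le> b\<^sup>2 * ?X\<^sup>2 / (8 * \<xi> * r\<^sup>2)"
        using X2b \<xi>(1) by (intro divide_right_mono mult_right_mono) auto
      finally show ?thesis by (simp add: X2)
    qed
    moreover have "?A = - (\<bar>z\<bar> / r * (\<sigma> * ?X))" using \<sigma>z by (simp add: mult.assoc[symmetric])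
    moreover have "?B = 1 / (2 * r) * (capped b y)\<^sup>2" by (simp add: X2)
    ultimately have main: "1 - \<bar>z\<bar> / r * (\<sigma> * ?X) + P * (capped b y)\<^sup>2 - Q * (capped b y)\<^sup>2 \<le> exp (?A - ?B)"
      unfolding Q_def distrib_right by linarith
    have R_eq: "1 - R y = (1 - \<bar>z\<bar> / r * (\<sigma> * ?X) + P * (capped b y)\<^sup>2 - Q * (capped b y)\<^sup>2) - 2 / b ^ 4 * (capped ?d y) ^ 4"
      by (simp add: R_def)
    have "G * (1 - R y) \<le> exp (- (z - y)\<^sup>2 / (2 * r))"
    proof (cases "\<bar>y\<bar> \<le> b")
      case True
      then have Xy: "?X = y" by (auto simp: max_def min_def)
      have "0 \<le> 2 / b ^ 4 * (capped ?d y) ^ 4" using b d by simp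
      then have "1 - R y \<le> exp (?A - ?B)" using main R_eq by linarith
      then have "G * (1 - R y) \<le> G * exp (?A - ?B)" by (intro mult_left_mono) (auto simp: G_def)
      also have "\<dots> = exp (- (z - y)\<^sup>2 / (2 * r))"
        unfolding G_def Xy exp_add[symmetric] using r by (simp add: power2_eq_square field_simps)
      finally show ?thesis .
    next
      case False
      \<comment> \<open>The coefficient 2 of the fourth-power term is chosen for this case: the
        expansion is below \<open>exp (1 / 2) \<le> 2\<close> everywhere.\<close>
      have "b ^ 4 \<le> (capped ?d y) ^ 4" using False b by (intro power_mono) auto
      then have "2 \<le> 2 / b ^ 4 * (capped ?d y) ^ 4" using b by (simp add: field_simps)
      moreover have "exp (?A - ?B) \<le> 2"
      proof -
        have "?A - ?B \<le> 1 / 2" using AB \<xi>(2) by linarith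
        then have "exp (?A - ?B) \<le> exp (1 / 2)" by simp
        also have "\<dots> \<le> 2" using exp_bound_half[of "1 / 2 :: real"] by simp
        finally show ?thesis .
      qed
      ultimately have "1 - R y \<le> 0" using main R_eq by linarith
      then have "G * (1 - R y) \<le> 0" by (intro mult_nonneg_nonpos) (auto simp: G_def)
      then show ?thesis by (meson exp_ge_zero order_trans)
    qed
    then show ?thesis by (simp add: algebra_simps)
  qed
  have "e (\<lambda>y. - exp (- (z - y)\<^sup>2 / (2 * r))) \<le> e (\<lambda>y. G * (- 1 + R y))"
    by (rule e_mono[OF bl_uminus[OF gbl] bl_cmult[OF bl_add[OF bl_const Rbl]] point])
  also have "\<dots> = G * e (\<lambda>y. - 1 + R y)" by (rule e_cmult[OF bl_add[OF bl_const Rbl]]) (simp add: G_def)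
  also have "e (\<lambda>y. - 1 + R y) = - 1 + e R" by (rule e_add_const[OF Rbl])
  finally have step1: "e (\<lambda>y. - exp (- (z - y)\<^sup>2 / (2 * r))) \<le> G * (- 1 + e R)" .
  have "e R \<le> e (\<lambda>y. \<bar>z\<bar> / r * (\<sigma> * clip b y)) + (e (\<lambda>y. P * - (capped b y)\<^sup>2) +
      (e (\<lambda>y. Q * (capped b y)\<^sup>2) + e (\<lambda>y. 2 / b ^ 4 * (capped ?d y) ^ 4)))"
  proof -
    have "e R \<le> e (\<lambda>y. \<bar>z\<bar> / r * (\<sigma> * clip b y)) + e (\<lambda>y. P * - (capped b y)\<^sup>2 + (Q * (capped b y)\<^sup>2 + 2 / b ^ 4 * (capped ?d y) ^ 4))"
      unfolding R_def by (intro e_add bl_add bl1 bl2 bl3 bl4)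
    moreover have "e (\<lambda>y. P * - (capped b y)\<^sup>2 + (Q * (capped b y)\<^sup>2 + 2 / b ^ 4 * (capped ?d y) ^ 4))
        \<le> e (\<lambda>y. P * - (capped b y)\<^sup>2) + e (\<lambda>y. Q * (capped b y)\<^sup>2 + 2 / b ^ 4 * (capped ?d y) ^ 4)"
      by (intro e_add bl_add bl2 bl3 bl4)
    moreover have "e (\<lambda>y. Q * (capped b y)\<^sup>2 + 2 / b ^ 4 * (capped ?d y) ^ 4)
        \<le> e (\<lambda>y. Q * (capped b y)\<^sup>2) + e (\<lambda>y. 2 / b ^ 4 * (capped ?d y) ^ 4)"
      by (intro e_add bl3 bl4)
    ultimately show ?thesis by linarith
  qed
  moreover have "e (\<lambda>y. \<bar>z\<bar> / r * (\<sigma> * clip b y)) \<le> \<bar>z\<bar> / r * (S / ?d + ?d ^ 4 * tail n / b ^ 3)"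
  proof -
    have "e (\<lambda>y. \<bar>z\<bar> / r * (\<sigma> * clip b y)) = \<bar>z\<bar> / r * e (\<lambda>y. \<sigma> * clip b y)"
      using r by (intro e_cmult[OF bl1']) simp
    moreover have "e (\<lambda>y. \<sigma> * clip b y) \<le> S / ?d + ?d ^ 4 * tail n / b ^ 3"
      by (rule clip_mean_le_tail[OF b n]) (simp add: \<sigma>_def)
    ultimately show ?thesis using r by (simp add: divide_right_mono mult_left_mono)
  qed
  moreover have "e (\<lambda>y. P * - (capped b y)\<^sup>2) \<le> - (P * v1)"
    using e_cmult[OF bl2' PQ(1)] mult_left_mono[OF v1 PQ(1)] by simp
  moreover have "e (\<lambda>y. Q * (capped b y)\<^sup>2) \<le> Q * S"
    using e_cmult_pow[OF b0 PQ(2), of 2] mult_left_mono[OF capped_second_moment[OF b0] PQ(2)] by simp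
  moreover have "e (\<lambda>y. 2 / b ^ 4 * (capped ?d y) ^ 4) = 2 / b ^ 4 * (?d ^ 4 * tail n)"
    using e_cmult_pow[OF d, of "2 / b ^ 4" 4] b fourth_moment_eq[OF n] by simp
  ultimately have "e R \<le> Err - P * v1" unfolding Err_def Q_def by linarith
  then have "G * (- 1 + e R) \<le> G * (- 1 + (Err - P * v1))" by (intro mult_left_mono) (auto simp: G_def)
  with step1 show ?thesis unfolding G_def P_def by (simp add: algebra_simps)
qed

end

section \<open>Asymptotics of the iterated logarithm and of the norming sequence\<close>

lemma eventually_llog: "\<forall>\<^sub>F n in sequentially. llog (real n) = ln (ln (real n))"
proof -
  have "\<forall>\<^sub>F n in sequentially. exp (exp 1) \<le> real n"
    using filterlim_real_sequentially unfolding filterlim_at_top by blast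
  then show ?thesis
  proof eventually_elim
    case (elim n)
    have pos: "0 < real n" using less_le_trans[OF exp_gt_zero elim] .
    have "exp 1 \<le> exp (exp (1::real))" using exp_ge_add_one_self[of 1] unfolding exp_le_cancel_iff by linarith
    then have "exp 1 \<le> real n" using elim by linarith
    then have 1: "clog (real n) = ln (real n)" by (simp add: clog_def max_absorb2)
    have "exp 1 \<le> ln (real n)" using elim pos by (simp add: ln_ge_iff)
    then show ?case unfolding 1 by (simp add: clog_def max_absorb2)
  qed
qed

lemma filterlim_llog_at_top: "filterlim (\<lambda>n. llog (real n)) at_top sequentially"
proof -
  have "filterlim (\<lambda>n. ln (ln (real n))) at_top sequentially" by real_asymp
  then show ?thesis using eventually_llog by (subst filterlim_cong[OF refl refl]) (auto elim: eventually_mono)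
qed

lemma eventually_llog_square_le: "\<forall>\<^sub>F n in sequentially. (llog (real n))\<^sup>2 \<le> real n"
proof -
  have "\<forall>\<^sub>F n in sequentially. (ln (ln (real n)))\<^sup>2 \<le> real n" by real_asymp
  with eventually_llog show ?thesis by eventually_elim simp
qed

lemma filterlim_div_lil_norm_at_top:
  assumes "0 < \<delta>" shows "filterlim (\<lambda>n. \<delta> * real n / lil_norm n) at_top sequentially"
proof -
  have "filterlim (\<lambda>n. real n / sqrt (2 * real n * ln (ln (real n)))) at_top sequentially" by real_asymp
  moreover have "\<forall>\<^sub>F n in sequentially. real n / sqrt (2 * real n * ln (ln (real n))) = real n / lil_norm n"
    using eventually_llog by eventually_elim (simp add: lil_norm_def)
  ultimately have "filterlim (\<lambda>n. real n / lil_norm n) at_top sequentially"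
    by (rule filterlim_cong[OF refl refl, THEN iffD1, rotated])
  then have "filterlim (\<lambda>n. \<delta> * (real n / lil_norm n)) at_top sequentially"
    by (rule filterlim_tendsto_pos_mult_at_top[OF tendsto_const assms])
  then show ?thesis by simp
qed

section \<open>Integrating out one block of variables\<close>

context iid_seq
begin

lemma e_path_cmult: "\<phi> \<in> bl (path_dist n) \<Longrightarrow> 0 \<le> c \<Longrightarrow> e_path (\<lambda>x. c * \<phi> x) = c * e_path \<phi>"
  unfolding e_path_def by (intro ER_cmult path_Hb)

text \<open>The past enters through \<open>Q \<ge> 0\<close> only, which is constant in the new
  coordinate and leaves the expectation by positive homogeneity. This is the form in which blocks
  are independent.\<close>

lemma block_product:
  assumes Q: "Q \<in> bl (path_dist n0)" "\<And>x. 0 \<le> Q x"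
    and F: "\<And>j. F j \<in> bl line_dist" "\<And>j u. 0 \<le> F j u"
    and step: "\<And>j u. j < m \<Longrightarrow> e (\<lambda>t. F (Suc j) (u + t)) \<le> F j u"
  shows "e_path (\<lambda>x. Q x * F m (\<Sum>l\<in>{n0..<n0 + m}. x l)) \<le> F 0 0 * e_path Q"
proof -
  let ?\<phi> = "\<lambda>i x. Q x * F (i - n0) (\<Sum>l\<in>{n0..<i}. x l)"
  have "e_path (?\<phi> (n0 + m)) \<le> e_path (?\<phi> n0)"
  proof (rule e_path_supermartingale)
    show "n0 \<le> n0 + m" by simp
    show "?\<phi> i \<in> bl (path_dist i)" if "n0 \<le> i" for i
      by (intro bl_mult bl_path_mono[OF Q(1) that] bl_path_sum[where h = "\<lambda>_ t. t" and L = 1] F) auto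
    fix i x assume i: "n0 \<le> i" "i < n0 + m"
    have "Q (x(i := t)) = Q x" for t by (rule bl_path_cong[OF Q(1)]) (use i in auto)
    moreover have "(\<Sum>l\<in>{n0..<Suc i}. (x(i := t)) l) = (\<Sum>l\<in>{n0..<i}. x l) + t" for t
    proof -
      have "(\<Sum>l\<in>{n0..<i}. (x(i := t)) l) = (\<Sum>l\<in>{n0..<i}. x l)" by (rule sum.cong) auto
      then show ?thesis using i by simp
    qed
    ultimately have "e (\<lambda>t. ?\<phi> (Suc i) (x(i := t))) = e (\<lambda>t. Q x * F (Suc (i - n0)) ((\<Sum>l\<in>{n0..<i}. x l) + t))"
      using i by (simp add: Suc_diff_le)
    also have "\<dots> = Q x * e (\<lambda>t. F (Suc (i - n0)) ((\<Sum>l\<in>{n0..<i}. x l) + t))"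
      by (intro e_cmult bl_shift F Q)
    also have "\<dots> \<le> ?\<phi> i x" using i by (intro mult_left_mono step Q) auto
    finally show "e (\<lambda>t. ?\<phi> (Suc i) (x(i := t))) \<le> ?\<phi> i x" .
  qed
  moreover have "e_path (?\<phi> n0) = F 0 0 * e_path Q"
    using e_path_cmult[OF Q(1) F(2), of 0 0] by (simp add: mult.commute)
  ultimately show ?thesis by simp
qed

end

context lil_seq
begin

text \<open>With truncation at \<open>\<delta> * n / lil_norm n\<close>, \<bar>z\<bar> of order
  \<open>lil_norm n\<close> and \<open>r\<close> at least of order \<open>n\<close>, the exponent
  stays below \<xi>, which is proportional to \<delta>. Each part of the error is of order
  \<open>1 / n\<close>; \<kappa> collects their constants and that of
  \<open>t\<^sup>2\<close>.\<close>

lemma gaussian_step: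
  fixes \<delta> r0 Cz v0 v1 z r :: real
  defines "\<xi> \<equiv> \<delta> * (Cz + 1) / r0"
  defines "\<kappa> \<equiv> (Cz\<^sup>2 * v0 / r0\<^sup>2)\<^sup>2 + 2 * (Cz * (S + 16 / \<delta> ^ 3) / r0 + (1 / (2 * r0) + \<delta>\<^sup>2 / (16 * \<xi> * r0\<^sup>2)) * S + 32 / \<delta> ^ 4)"
  assumes n: "1 \<le> n" and \<delta>: "0 < \<delta>" "\<delta> \<le> 1" and good: "real n * tail n * llog (real n) ^ 4 \<le> 1"
    and ll: "(llog (real n))\<^sup>2 \<le> real n" and r0: "0 < r0" and Cz: "0 \<le> Cz"
    and \<xi>: "\<xi> \<le> 1 / 4" and v0: "0 \<le> v0" "v0 \<le> (1 - 2 * \<xi>) * v1"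
    and v1: "v1 \<le> - e (\<lambda>y. - (capped (\<delta> * real n / lil_norm n) y)\<^sup>2)"
    and \<kappa>n: "\<kappa> \<le> real n" and r: "r0 * real n \<le> r" and z: "\<bar>z\<bar> \<le> Cz * lil_norm n"
  shows "exp (- z\<^sup>2 / (2 * (r + v0)) - \<kappa> / real n) \<le> - e (\<lambda>y. - exp (- (z - y)\<^sup>2 / (2 * r)))"
proof -
  let ?d = "lil_norm n" and ?l = "llog (real n)"
  have d: "0 < ?d" using n by (rule lil_norm_pos)
  have d2: "?d\<^sup>2 = 2 * real n * ?l" by (rule lil_norm_sq)
  have d8: "?d ^ 8 = 16 * real n ^ 4 * ?l ^ 4"
  proof -
    have "?d ^ 8 = (?d\<^sup>2) ^ 4" by (simp flip: power_mult)
    then show ?thesis unfolding d2 by (simp add: power_mult_distrib)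
  qed
  have l: "1 \<le> ?l" by (rule llog_ge_1)
  have n': "0 < real n" using n by simp
  define b where "b = \<delta> * real n / ?d"
  have b: "0 < b" using \<delta> d n' by (simp add: b_def)
  have bd: "b * ?d = \<delta> * real n" using d by (simp add: b_def)
  have "\<delta> * real n \<le> ?d\<^sup>2"
  proof -
    have "\<delta> * real n \<le> 1 * real n" using \<delta> by (intro mult_right_mono) auto
    also have "\<dots> \<le> (2 * ?l) * real n" using l by (intro mult_right_mono) auto
    finally show ?thesis unfolding d2 by (simp add: ac_simps)
  qed
  then have bled: "b \<le> ?d" unfolding b_def using d by (simp add: pos_divide_le_eq power2_eq_square)
  have b2: "b\<^sup>2 \<le> \<delta>\<^sup>2 * real n / 2"
  proof -
    have "b\<^sup>2 = \<delta>\<^sup>2 * real n / (2 * ?l)" unfolding b_def power_divide d2 using n' by (simp add: power2_eq_square)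
    also have "\<dots> \<le> \<delta>\<^sup>2 * real n / (2 * 1)" using l by (intro divide_left_mono mult_left_mono) auto
    finally show ?thesis by simp
  qed
  have rpos: "0 < r" using r r0 n' by (meson less_le_trans mult_pos_pos)
  have \<xi>pos: "0 < \<xi>" using \<delta> Cz r0 by (simp add: \<xi>_def)
  have zr: "\<bar>z\<bar> / r \<le> Cz * ?d / (r0 * real n)"
    using z r rpos r0 n' Cz d by (intro frac_le) auto
  have \<xi>3: "\<bar>z\<bar> * b / r + b\<^sup>2 / (2 * r) \<le> \<xi>"
  proof -
    have "\<bar>z\<bar> / r * b \<le> Cz * ?d / (r0 * real n) * b" using zr b by (intro mult_right_mono) auto
    also have "\<dots> = Cz * (b * ?d) / (r0 * real n)" by simp
    also have "\<dots> = Cz * \<delta> / r0" unfolding bd using n' by simp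
    finally have 1: "\<bar>z\<bar> * b / r \<le> Cz * \<delta> / r0" by simp
    have "b\<^sup>2 / (2 * r) \<le> (\<delta>\<^sup>2 * real n / 2) / (2 * (r0 * real n))"
      using b2 r r0 n' by (intro frac_le) auto
    also have "\<dots> = \<delta>\<^sup>2 / (4 * r0)" using n' by simp
    also have "\<dots> \<le> \<delta> / r0"
    proof -
      have "\<delta>\<^sup>2 \<le> \<delta>" using mult_left_mono[OF \<delta>(2), of \<delta>] \<delta>(1) by (simp add: power2_eq_square)
      then have "\<delta>\<^sup>2 / (4 * r0) \<le> \<delta> / (1 * r0)" using \<delta> r0 by (intro frac_le) auto
      then show ?thesis by simp
    qed
    finally show ?thesis using 1 unfolding \<xi>_def by (simp add: distrib_left add_divide_distrib mult.commute)
  qed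
  define Err where "Err = \<bar>z\<bar> / r * (S / ?d + ?d ^ 4 * tail n / b ^ 3)
      + (1 / (2 * r) + b\<^sup>2 / (8 * \<xi> * r\<^sup>2)) * S + 2 / b ^ 4 * (?d ^ 4 * tail n)"
  define E1 where "E1 = Cz * (S + 16 / \<delta> ^ 3) / r0 + (1 / (2 * r0) + \<delta>\<^sup>2 / (16 * \<xi> * r0\<^sup>2)) * S + 32 / \<delta> ^ 4"
  have E1: "0 \<le> E1" using Cz S_nonneg \<delta> r0 \<xi>pos unfolding E1_def by (intro add_nonneg_nonneg mult_nonneg_nonneg divide_nonneg_nonneg) auto
  have Err0: "0 \<le> Err" unfolding Err_def using rpos d b \<xi>pos S_nonneg tail_nonneg[of n]
    by (intro add_nonneg_nonneg mult_nonneg_nonneg divide_nonneg_nonneg) auto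
  \<comment> \<open>The only place where goodness of \<open>n\<close> is used:
    \<open>lil_norm n ^ 8\<close> contains exactly \<open>llog n ^ 4\<close>.\<close>
  have tb: "?d ^ 8 * tail n \<le> 16 * real n ^ 3"
  proof -
    have "?d ^ 8 * tail n = 16 * real n ^ 3 * (real n * tail n * ?l ^ 4)" unfolding d8 by (simp add: eval_nat_numeral)
    also have "\<dots> \<le> 16 * real n ^ 3 * 1" using good n' by (intro mult_left_mono) auto
    finally show ?thesis by simp
  qed
  have Err: "Err \<le> E1 / real n"
  proof -
    have "\<bar>z\<bar> / r * (S / ?d + ?d ^ 4 * tail n / b ^ 3) \<le> Cz * (S + 16 / \<delta> ^ 3) / r0 / real n"
    proof -
      have eq: "S / ?d + ?d ^ 4 * tail n / b ^ 3 = (S + ?d ^ 8 * tail n / (b * ?d) ^ 3) / ?d"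
      proof -
        have "?d ^ 8 * tail n / (b * ?d) ^ 3 = ?d ^ 5 * tail n / b ^ 3"
          using d by (simp add: power_mult_distrib eval_nat_numeral)
        moreover have "?d ^ 5 * tail n / b ^ 3 / ?d = ?d ^ 4 * tail n / b ^ 3"
          using d by (simp add: eval_nat_numeral)
        ultimately show ?thesis by (simp add: add_divide_distrib)
      qed
      have "\<bar>z\<bar> / r * (S / ?d + ?d ^ 4 * tail n / b ^ 3) \<le> Cz * ?d / (r0 * real n) * (S / ?d + ?d ^ 4 * tail n / b ^ 3)"
        using zr S_nonneg d b tail_nonneg[of n] by (intro mult_right_mono) auto
      also have "\<dots> = Cz / (r0 * real n) * (S + ?d ^ 8 * tail n / (b * ?d) ^ 3)"
        unfolding eq using d by simp
      also have "\<dots> \<le> Cz / (r0 * real n) * (S + 16 / \<delta> ^ 3)"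
      proof (intro mult_left_mono add_left_mono)
        have "?d ^ 8 * tail n / (b * ?d) ^ 3 \<le> 16 * real n ^ 3 / (b * ?d) ^ 3"
          using tb b d by (intro divide_right_mono) auto
        also have "16 * real n ^ 3 / (b * ?d) ^ 3 = 16 / \<delta> ^ 3" unfolding bd using n' by (simp add: power_mult_distrib)
        finally show "?d ^ 8 * tail n / (b * ?d) ^ 3 \<le> 16 / \<delta> ^ 3" .
      qed (use Cz r0 n' in simp)
      finally show ?thesis by simp
    qed
    moreover have "(1 / (2 * r) + b\<^sup>2 / (8 * \<xi> * r\<^sup>2)) * S \<le> (1 / (2 * r0) + \<delta>\<^sup>2 / (16 * \<xi> * r0\<^sup>2)) * S / real n"
    proof -
      have "1 / (2 * r) \<le> 1 / (2 * (r0 * real n))" using r r0 n' by (intro frac_le) auto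
      moreover have "b\<^sup>2 / (8 * \<xi> * r\<^sup>2) \<le> (\<delta>\<^sup>2 * real n / 2) / (8 * \<xi> * (r0 * real n)\<^sup>2)"
        using b2 r r0 n' \<xi>pos by (intro frac_le mult_left_mono power_mono) auto
      moreover have "(\<delta>\<^sup>2 * real n / 2) / (8 * \<xi> * (r0 * real n)\<^sup>2) = \<delta>\<^sup>2 / (16 * \<xi> * r0\<^sup>2) / real n"
        using n' by (simp add: power2_eq_square field_simps)
      moreover have "1 / (2 * (r0 * real n)) = 1 / (2 * r0) / real n" by simp
      ultimately have "1 / (2 * r) + b\<^sup>2 / (8 * \<xi> * r\<^sup>2) \<le> (1 / (2 * r0) + \<delta>\<^sup>2 / (16 * \<xi> * r0\<^sup>2)) / real n"
        by (simp add: add_divide_distrib)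
      from mult_right_mono[OF this S_nonneg] show ?thesis by simp
    qed
    moreover have "2 / b ^ 4 * (?d ^ 4 * tail n) \<le> 32 / \<delta> ^ 4 / real n"
    proof -
      have "2 / b ^ 4 * (?d ^ 4 * tail n) = 2 * (?d ^ 8 * tail n) / (b * ?d) ^ 4"
        using d b by (simp add: field_simps eval_nat_numeral)
      also have "\<dots> \<le> 2 * (16 * real n ^ 3) / (b * ?d) ^ 4"
        using tb b d by (intro divide_right_mono mult_left_mono) auto
      also have "\<dots> = 32 / \<delta> ^ 4 / real n" unfolding bd using n' \<delta> by (simp add: field_simps eval_nat_numeral)
      finally show ?thesis .
    qed
    ultimately show ?thesis unfolding Err_def E1_def by (simp add: add_divide_distrib)
  qed
  have \<kappa>: "\<kappa> = (Cz\<^sup>2 * v0 / r0\<^sup>2)\<^sup>2 + 2 * E1" unfolding \<kappa>_def E1_def ..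
  \<comment> \<open>An upper bound for the change of the exponent when the variance grows from
    \<open>r\<close> to \<open>r + v0\<close>; the quadratic gain of the expansion must cover
    it.\<close>
  define t where "t = z\<^sup>2 * v0 / (2 * r\<^sup>2)"
  have t0: "0 \<le> t" using v0 by (simp add: t_def)
  have t_le: "t \<le> (Cz\<^sup>2 * v0 / r0\<^sup>2) * (?l / real n)"
  proof -
    have "z\<^sup>2 \<le> (Cz * ?d)\<^sup>2" using power_mono[OF z, of 2] by simp
    then have "t \<le> (Cz * ?d)\<^sup>2 * v0 / (2 * (r0 * real n)\<^sup>2)"
    proof -
      assume zz: "z\<^sup>2 \<le> (Cz * ?d)\<^sup>2"
      have "(r0 * real n)\<^sup>2 \<le> r\<^sup>2" using r r0 n' by (intro power_mono) auto
      then show ?thesis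
        unfolding t_def using zz v0 r0 n' by (intro frac_le mult_right_mono mult_left_mono) auto
    qed
    also have "\<dots> = (Cz\<^sup>2 * v0 / r0\<^sup>2) * (?l / real n)"
      unfolding power_mult_distrib d2 using n' by (simp add: power2_eq_square ac_simps)
    finally show ?thesis .
  qed
  have t2: "t\<^sup>2 \<le> (Cz\<^sup>2 * v0 / r0\<^sup>2)\<^sup>2 / real n"
  proof -
    have "t\<^sup>2 \<le> ((Cz\<^sup>2 * v0 / r0\<^sup>2) * (?l / real n))\<^sup>2" using t_le t0 by (intro power_mono)
    also have "\<dots> = (Cz\<^sup>2 * v0 / r0\<^sup>2)\<^sup>2 * (?l\<^sup>2 / (real n)\<^sup>2)" by (simp add: power_mult_distrib power_divide)
    also have "\<dots> \<le> (Cz\<^sup>2 * v0 / r0\<^sup>2)\<^sup>2 * (real n / (real n)\<^sup>2)" using ll by (intro mult_left_mono divide_right_mono) auto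
    also have "\<dots> = (Cz\<^sup>2 * v0 / r0\<^sup>2)\<^sup>2 / real n" using n' by (simp add: power2_eq_square)
    finally show ?thesis .
  qed
  have sum_le: "t\<^sup>2 + 2 * Err \<le> \<kappa> / real n" using t2 Err unfolding \<kappa> by (simp add: add_divide_distrib)
  have \<kappa>1: "\<kappa> / real n \<le> 1" using \<kappa>n n' by simp
  have t1: "t \<le> 1"
  proof (rule ccontr)
    assume "\<not> t \<le> 1"
    then have "1 < t\<^sup>2" by (simp add: one_less_power)
    then show False using sum_le \<kappa>1 Err0 by linarith
  qed
  have Err1: "Err \<le> 1 / 2" using sum_le \<kappa>1 zero_le_power2[of t] by linarith
  have "exp (- z\<^sup>2 / (2 * (r + v0)) - \<kappa> / real n) \<le> exp (- z\<^sup>2 / (2 * r) + (t - t\<^sup>2 - 2 * Err))"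
  proof -
    have "z\<^sup>2 / (2 * r) - z\<^sup>2 / (2 * (r + v0)) = z\<^sup>2 * v0 / (2 * (r * (r + v0)))"
      using rpos v0 by (simp add: field_simps)
    also have "\<dots> \<le> z\<^sup>2 * v0 / (2 * (r * r))"
      using rpos v0 by (intro divide_left_mono mult_left_mono) auto
    finally have "z\<^sup>2 / (2 * r) - z\<^sup>2 / (2 * (r + v0)) \<le> t" by (simp add: t_def power2_eq_square)
    then show ?thesis using sum_le by simp
  qed
  also have "\<dots> = exp (- z\<^sup>2 / (2 * r)) * exp (t - t\<^sup>2 - 2 * Err)" by (rule exp_add)
  also have "\<dots> \<le> exp (- z\<^sup>2 / (2 * r)) * (1 + t - Err)"
    using exp_le_one_plus_minus[OF t0 t1 Err0 Err1] by (intro mult_left_mono) auto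
  also have "\<dots> \<le> exp (- z\<^sup>2 / (2 * r)) * (1 + (1 - 2 * \<xi>) * z\<^sup>2 / (2 * r\<^sup>2) * v1 - Err)"
  proof -
    have "t = z\<^sup>2 / (2 * r\<^sup>2) * v0" by (simp add: t_def)
    also have "\<dots> \<le> z\<^sup>2 / (2 * r\<^sup>2) * ((1 - 2 * \<xi>) * v1)" using v0(2) by (intro mult_left_mono) auto
    finally have "t \<le> (1 - 2 * \<xi>) * z\<^sup>2 / (2 * r\<^sup>2) * v1" by (simp add: ac_simps)
    then show ?thesis by (intro mult_left_mono) auto
  qed
  also have "\<dots> \<le> - e (\<lambda>y. - exp (- (z - y)\<^sup>2 / (2 * r)))"
    unfolding Err_def
    by (rule gaussian_expectation_lower[OF n b bled rpos \<xi>pos \<xi> \<xi>3]) (use v1 in \<open>simp add: b_def\<close>)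
  finally show ?thesis .
qed

end

context lil_seq
begin

text \<open>\<open>F\<close> is 1 minus the Gaussian subsolution \<open>w\<close>, the latter
  lowered by a floor \<phi> and cut at 0. Cutting is compatible with the recursion since
  \<open>F \<le> 1\<close>. The residual variance \<open>r0 * n\<close> keeps \<open>R j\<close> in
  the range of \<open>step\<close> up to the end of the block.\<close>

lemma gaussian_block:
  fixes \<kappa> v0 r0 y0 :: real
  assumes n: "1 \<le> n" and m: "1 \<le> m" "m \<le> n" and r0: "0 < r0" and v0: "0 < v0" and \<kappa>: "0 \<le> \<kappa>"
    and step: "\<And>r z. r0 * real n \<le> r \<Longrightarrow> \<bar>z\<bar> \<le> sqrt (2 * (v0 + r0)) * lil_norm n \<Longrightarrow>
      exp (- z\<^sup>2 / (2 * (r + v0)) - \<kappa> / real n) \<le> - e (\<lambda>y. - exp (- (z - y)\<^sup>2 / (2 * r)))"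
  shows "\<exists>F. (\<forall>j. F j \<in> bl line_dist) \<and> (\<forall>j u. 0 \<le> F j u \<and> F j u \<le> 1)
    \<and> (\<forall>j u. j < m \<longrightarrow> e (\<lambda>t. F (Suc j) (u + t)) \<le> F j u)
    \<and> (\<forall>u. 4 * llog (real n) * (r0 * real n) \<le> (y0 - u)\<^sup>2 \<longrightarrow> F m u = 1)
    \<and> F 0 0 \<le> 1 - (exp (- \<kappa> - y0\<^sup>2 / (2 * (v0 * real m))) - exp (- 2 * llog (real n)))"
proof -
  let ?l = "llog (real n)" and ?d = "lil_norm n"
  have n': "0 < real n" using n by simp
  define R where "R = (\<lambda>j. v0 * real (m - j) + r0 * real n)"
  define c where "c = (\<lambda>j. exp (- (\<kappa> * real (m - j) / real n)))"
  define w where "w = (\<lambda>j u. c j * exp (- (y0 - u)\<^sup>2 / (2 * R j)))"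
  \<comment> \<open>Of smaller order than the target \<open>exp (- llog n)\<close>, yet large enough
    that \<open>w > \<phi>\<close> confines \<open>z\<close> to the range where \<open>step\<close>
    applies.\<close>
  define \<phi> where "\<phi> = exp (- 2 * ?l)"
  define F where "F = (\<lambda>j u. 1 - max (w j u - \<phi>) 0)"
  have R: "0 < R j" "r0 * real n \<le> R j" for j using r0 v0 n' by (auto simp: R_def add_nonneg_pos)
  have R_le: "j \<le> m \<Longrightarrow> R j \<le> (v0 + r0) * real n" for j
  proof -
    have "v0 * real (m - j) \<le> v0 * real n" using m v0 by (intro mult_left_mono) auto
    then show ?thesis by (simp add: R_def distrib_right)
  qed
  have c01: "0 < c j" "c j \<le> 1" for j using \<kappa> by (auto simp: c_def)
  have w01: "0 \<le> w j u" "w j u \<le> 1" for j u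
  proof -
    have "exp (- (y0 - u)\<^sup>2 / (2 * R j)) \<le> 1" using R[of j] by simp
    then have "c j * exp (- (y0 - u)\<^sup>2 / (2 * R j)) \<le> 1 * 1" using c01[of j] by (intro mult_mono) auto
    then show "0 \<le> w j u" "w j u \<le> 1" using c01[of j] by (auto simp: w_def)
  qed
  have w_bl: "w j \<in> bl line_dist" for j
    unfolding w_def using bl_cmult[OF bl_affine[OF bl_gaussian[OF R(1)], of y0 "- 1"], where c = "c j"] by simp
  have F_bl: "F j \<in> bl line_dist" for j
    unfolding F_def by (intro bl_diff bl_max bl_const w_bl)
  have F01: "0 \<le> F j u" "F j u \<le> 1" for j u
  proof -
    have "0 \<le> \<phi>" by (simp add: \<phi>_def)
    then show "0 \<le> F j u" "F j u \<le> 1" using w01[of j u] by (auto simp: F_def)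
  qed
  have F_step: "e (\<lambda>t. F (Suc j) (u + t)) \<le> F j u" if j: "j < m" for j u
  proof (cases "w j u \<le> \<phi>")
    case True
    have "e (\<lambda>t. F (Suc j) (u + t)) \<le> e (\<lambda>_. 1)" by (rule e_mono[OF bl_shift[OF F_bl] bl_const]) (rule F01)
    then show ?thesis using True by (simp add: F_def)
  next
    case False
    define z where "z = y0 - u"
    have "\<phi> < c j * exp (- z\<^sup>2 / (2 * R j))" using False by (simp add: w_def z_def)
    also have "\<dots> \<le> 1 * exp (- z\<^sup>2 / (2 * R j))" using c01[of j] by (intro mult_right_mono) auto
    finally have "- 2 * ?l < - z\<^sup>2 / (2 * R j)" by (simp add: \<phi>_def)
    then have "z\<^sup>2 < 4 * ?l * R j" using R(1)[of j] by (simp add: field_simps)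
    also have "\<dots> \<le> 4 * ?l * ((v0 + r0) * real n)" using R_le[of j] j llog_pos[of "real n"] by (intro mult_left_mono) auto
    also have "\<dots> = (sqrt (2 * (v0 + r0)) * ?d)\<^sup>2"
      unfolding power_mult_distrib lil_norm_sq using v0 r0 by simp
    finally have "\<bar>z\<bar>\<^sup>2 \<le> (sqrt (2 * (v0 + r0)) * ?d)\<^sup>2" by simp
    then have z: "\<bar>z\<bar> \<le> sqrt (2 * (v0 + r0)) * ?d"
      by (rule power2_le_imp_le) (use v0 r0 lil_norm_nonneg in simp)
    have mj: "real (m - j) = real (m - Suc j) + 1" using j by (simp add: of_nat_diff)
    have Rj: "R j = R (Suc j) + v0" unfolding R_def mj by (simp add: distrib_left)
    have cj: "c j = c (Suc j) * exp (- \<kappa> / real n)"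
    proof -
      have "- (\<kappa> * (real (m - Suc j) + 1) / real n) = - (\<kappa> * real (m - Suc j) / real n) + - \<kappa> / real n"
        by (simp add: distrib_left add_divide_distrib)
      then show ?thesis unfolding c_def mj by (simp only: exp_add)
    qed
    have gbl: "(\<lambda>t. exp (- (z - t)\<^sup>2 / (2 * R (Suc j)))) \<in> bl line_dist"
      using bl_affine[OF bl_gaussian[OF R(1)], of z "- 1"] by simp
    have w_Suc: "w (Suc j) (u + t) = c (Suc j) * exp (- (z - t)\<^sup>2 / (2 * R (Suc j)))" for t
      by (simp add: w_def z_def diff_diff_eq)
    have "w j u \<le> c (Suc j) * - e (\<lambda>t. - exp (- (z - t)\<^sup>2 / (2 * R (Suc j))))"
    proof -
      have "w j u = c (Suc j) * exp (- z\<^sup>2 / (2 * (R (Suc j) + v0)) - \<kappa> / real n)"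
        unfolding w_def cj Rj z_def[symmetric] by (simp add: mult.assoc flip: exp_add)
      also have "\<dots> \<le> c (Suc j) * - e (\<lambda>t. - exp (- (z - t)\<^sup>2 / (2 * R (Suc j))))"
        by (intro mult_left_mono step[OF R(2) z] less_imp_le[OF c01(1)])
      finally show ?thesis .
    qed
    moreover have "e (\<lambda>t. c (Suc j) * - exp (- (z - t)\<^sup>2 / (2 * R (Suc j)))) =
        c (Suc j) * e (\<lambda>t. - exp (- (z - t)\<^sup>2 / (2 * R (Suc j))))"
      by (rule e_cmult[OF bl_uminus[OF gbl]]) (simp add: less_imp_le[OF c01(1)])
    ultimately have key: "e (\<lambda>t. - w (Suc j) (u + t)) \<le> - w j u" unfolding w_Suc by simp
    have "e (\<lambda>t. F (Suc j) (u + t)) \<le> e (\<lambda>t. (1 + \<phi>) + - w (Suc j) (u + t))"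
      by (rule e_mono[OF bl_shift[OF F_bl] bl_add[OF bl_const bl_uminus[OF bl_shift[OF w_bl]]]]) (simp add: F_def)
    also have "\<dots> = (1 + \<phi>) + e (\<lambda>t. - w (Suc j) (u + t))"
      by (rule e_add_const[OF bl_uminus[OF bl_shift[OF w_bl]]])
    also have "\<dots> \<le> F j u" using key False by (simp add: F_def)
    finally show ?thesis .
  qed
  have F_end: "F m u = 1" if "4 * ?l * (r0 * real n) \<le> (y0 - u)\<^sup>2" for u
  proof -
    have "R m = r0 * real n" by (simp add: R_def)
    then have "w m u = exp (- (y0 - u)\<^sup>2 / (2 * (r0 * real n)))" by (simp add: w_def c_def)
    also have "\<dots> \<le> \<phi>"
    proof -
      have "2 * ?l \<le> (y0 - u)\<^sup>2 / (2 * (r0 * real n))" using that r0 n' by (simp add: field_simps)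
      then show ?thesis by (simp add: \<phi>_def)
    qed
    finally show ?thesis by (simp add: F_def)
  qed
  have "exp (- \<kappa> - y0\<^sup>2 / (2 * (v0 * real m))) \<le> w 0 0"
  proof -
    have "\<kappa> * real m / real n \<le> \<kappa> * real n / real n" using m \<kappa> by (intro divide_right_mono mult_left_mono) auto
    then have "\<kappa> * real m / real n \<le> \<kappa>" using n' by simp
    moreover have "y0\<^sup>2 / (2 * R 0) \<le> y0\<^sup>2 / (2 * (v0 * real m))"
      using m v0 r0 n' by (intro divide_left_mono) (auto simp: R_def intro!: mult_pos_pos add_pos_pos)
    ultimately show ?thesis unfolding w_def c_def by (simp flip: exp_add)
  qed
  then have F_0: "F 0 0 \<le> 1 - (exp (- \<kappa> - y0\<^sup>2 / (2 * (v0 * real m))) - exp (- 2 * ?l))"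
    by (simp add: F_def \<phi>_def)
  show ?thesis
    by (intro exI[of _ F] conjI allI impI) (rule F_bl F01 F_step F_end F_0; assumption?)+
qed

definition good :: "nat \<Rightarrow> bool" where
  "good n \<longleftrightarrow> real n * tail n * llog (real n) ^ 4 \<le> 1"

text \<open>The Gaussian is centred at \<open>sqrt (v0 * p) * lil_norm n\<close>, slightly above the
  level sought. The exponent at the start is then at most \<open>llog n\<close> for a block of
  length at least \<open>p * n\<close>.\<close>

lemma lower_block:
  assumes \<tau>: "0 < \<tau>" and p: "0 < p" "\<tau>\<^sup>2 < s * p"
  shows "\<exists>\<kappa>. \<forall>\<^sub>F n in sequentially. good n \<longrightarrow> (\<forall>m\<ge>1. m \<le> n \<longrightarrow> p * real n \<le> real m \<longrightarrow>
    (\<exists>F. (\<forall>j. F j \<in> bl line_dist) \<and> (\<forall>j u. 0 \<le> F j u \<and> F j u \<le> 1)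
      \<and> (\<forall>j u. j < m \<longrightarrow> e (\<lambda>t. F (Suc j) (u + t)) \<le> F j u)
      \<and> (\<forall>u. u < \<tau> * lil_norm n \<longrightarrow> F m u = 1)
      \<and> F 0 0 \<le> 1 - exp (- \<kappa> - llog (real n))))"
proof -
  have "\<tau>\<^sup>2 / p < s" using p by (simp add: field_simps)
  then obtain v0 where v0: "\<tau>\<^sup>2 / p < v0" "v0 < s" using dense by blast
  have v0pos: "0 < v0" using v0(1) p \<tau> by (meson divide_nonneg_pos le_less_trans zero_le_power2)
  obtain v1 where v1: "v0 < v1" "v1 < s" using dense[OF v0(2)] by blast
  define x where "x = sqrt (v0 * p)"
  \<comment> \<open>The room between \<open>\<tau>\<^sup>2 / p\<close> and \<open>s\<close> is used
    three times: \<tau> below \<open>x\<close> absorbs the residual variance, \<open>v0\<close>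
    below \<open>v1\<close> the factor \<open>1 - 2 * \<xi>\<close>, and \<open>v1\<close> below
    \<open>s\<close> the truncation of the second moment.\<close>
  have x2: "x\<^sup>2 = v0 * p" using v0pos p by (simp add: x_def)
  have "\<tau>\<^sup>2 < x\<^sup>2" unfolding x2 using v0(1) p by (simp add: field_simps)
  then have \<tau>x: "\<tau> < x" by (rule power_less_imp_less_base) (use v0pos p in \<open>simp add: x_def\<close>)
  define \<mu> where "\<mu> = x - \<tau>"
  have \<mu>: "0 < \<mu>" using \<tau>x by (simp add: \<mu>_def)
  \<comment> \<open>Chosen so that \<open>4 * llog n * (r0 * n)\<close> is exactly the square of
    \<open>\<mu> * lil_norm n\<close>, the distance from the centre to the level.\<close>
  define r0 where "r0 = \<mu>\<^sup>2 / 2"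
  have r0: "0 < r0" using \<mu> by (simp add: r0_def)
  define Cz where "Cz = sqrt (2 * (v0 + r0))"
  have Cz: "0 \<le> Cz" using v0pos r0 by (simp add: Cz_def)
  have v1pos: "0 < v1" using v1 v0pos by simp
  obtain q where q: "q = v0 / v1" by simp
  have q1: "q < 1" using v1 v1pos unfolding q by simp
  \<comment> \<open>The bound \<open>(1 - q) / 2\<close> is what
    \<open>v0 \<le> (1 - 2 * \<xi>) * v1\<close> requires; \<delta> is then made small enough for
    \<xi> to respect it.\<close>
  define \<xi>0 where "\<xi>0 = min (1 / 4) ((1 - q) / 2)"
  have \<xi>0: "0 < \<xi>0" "\<xi>0 \<le> 1 / 4" "\<xi>0 \<le> (1 - q) / 2"
  proof -
    show "0 < \<xi>0" using q1 by (simp add: \<xi>0_def)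
    show "\<xi>0 \<le> 1 / 4" unfolding \<xi>0_def by (rule min.cobounded1)
    show "\<xi>0 \<le> (1 - q) / 2" unfolding \<xi>0_def by (rule min.cobounded2)
  qed
  define \<delta> where "\<delta> = min 1 (\<xi>0 * r0 / (Cz + 1))"
  have \<delta>: "0 < \<delta>" "\<delta> \<le> 1" using \<xi>0 r0 Cz by (auto simp: \<delta>_def)
  define \<xi> where "\<xi> = \<delta> * (Cz + 1) / r0"
  have "\<delta> * (Cz + 1) \<le> \<xi>0 * r0 / (Cz + 1) * (Cz + 1)" using Cz by (intro mult_right_mono) (auto simp: \<delta>_def)
  then have \<xi>\<xi>0: "\<xi> \<le> \<xi>0" using Cz r0 by (simp add: \<xi>_def pos_divide_le_eq)
  have \<xi>pos: "0 < \<xi>" using \<delta> Cz r0 by (simp add: \<xi>_def)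
  have \<xi>14: "\<xi> \<le> 1 / 4" using \<xi>\<xi>0 \<xi>0 by linarith
  have "q \<le> 1 - 2 * \<xi>" using \<xi>\<xi>0 \<xi>0(3) by argo
  then have v01: "v0 \<le> (1 - 2 * \<xi>) * v1" using v1pos unfolding q by (simp add: pos_divide_le_eq)
  define \<kappa> where "\<kappa> = (Cz\<^sup>2 * v0 / r0\<^sup>2)\<^sup>2 + 2 * (Cz * (S + 16 / \<delta> ^ 3) / r0 + (1 / (2 * r0) + \<delta>\<^sup>2 / (16 * \<xi> * r0\<^sup>2)) * S + 32 / \<delta> ^ 4)"
  have \<kappa>0: "0 \<le> \<kappa>" unfolding \<kappa>_def using Cz S_nonneg \<delta> r0 \<xi>pos
    by (intro add_nonneg_nonneg mult_nonneg_nonneg divide_nonneg_nonneg) auto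
  have ev1: "\<forall>\<^sub>F n in sequentially. v1 < - e (\<lambda>y. - (capped (\<delta> * real n / lil_norm n) y)\<^sup>2)"
    using order_tendstoD(1)[OF lower_second_moment v1(2)] filterlim_div_lil_norm_at_top[OF \<delta>(1)]
    by (rule eventually_compose_filterlim)
  \<comment> \<open>The floor \<open>exp (- 2 * llog n)\<close> eats at most half of the bound; this
    is the \<open>ln 2\<close> added to \<kappa>.\<close>
  have ev2: "\<forall>\<^sub>F n in sequentially. \<kappa> + ln 2 \<le> llog (real n)"
    using filterlim_llog_at_top unfolding filterlim_at_top by blast
  have ev3: "\<forall>\<^sub>F n in sequentially. \<kappa> \<le> real n"
    using filterlim_real_sequentially unfolding filterlim_at_top by blast
  have "\<forall>\<^sub>F n in sequentially. good n \<longrightarrow> (\<forall>m\<ge>1. m \<le> n \<longrightarrow> p * real n \<le> real m \<longrightarrow>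
    (\<exists>F. (\<forall>j. F j \<in> bl line_dist) \<and> (\<forall>j u. 0 \<le> F j u \<and> F j u \<le> 1)
      \<and> (\<forall>j u. j < m \<longrightarrow> e (\<lambda>t. F (Suc j) (u + t)) \<le> F j u)
      \<and> (\<forall>u. u < \<tau> * lil_norm n \<longrightarrow> F m u = 1)
      \<and> F 0 0 \<le> 1 - exp (- (\<kappa> + ln 2) - llog (real n))))"
    using ev1 ev2 ev3 eventually_llog_square_le eventually_ge_at_top[of 1]
  proof eventually_elim
    case (elim n)
    show ?case
    proof (intro impI allI)
      fix m :: nat
      assume gd: "good n" and m: "1 \<le> m" "m \<le> n" "p * real n \<le> real m"
      let ?l = "llog (real n)" and ?d = "lil_norm n"
      have n': "0 < real n" using elim(5) by simp
      have d: "0 < ?d" using elim(5) by (rule lil_norm_pos)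
      have l: "0 < ?l" by (rule llog_pos)
      have step: "exp (- z\<^sup>2 / (2 * (r + v0)) - \<kappa> / real n) \<le> - e (\<lambda>y. - exp (- (z - y)\<^sup>2 / (2 * r)))"
        if "r0 * real n \<le> r" "\<bar>z\<bar> \<le> sqrt (2 * (v0 + r0)) * ?d" for r z
        unfolding \<kappa>_def \<xi>_def
        by (rule gaussian_step[OF elim(5) \<delta> gd[unfolded good_def] elim(4) r0 Cz \<xi>14[unfolded \<xi>_def]
            less_imp_le[OF v0pos] v01[unfolded \<xi>_def] less_imp_le[OF elim(1)] elim(3)[unfolded \<kappa>_def \<xi>_def]
            that(1) that(2)[folded Cz_def]])
      define y0 where "y0 = (\<tau> + \<mu>) * ?d"
      have y02: "y0\<^sup>2 = v0 * p * (2 * real n * ?l)"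
        unfolding y0_def power_mult_distrib lil_norm_sq using x2 by (simp add: \<mu>_def)
      obtain F where F: "\<forall>j. F j \<in> bl line_dist" "\<forall>j u. 0 \<le> F j u \<and> F j u \<le> 1"
        "\<forall>j u. j < m \<longrightarrow> e (\<lambda>t. F (Suc j) (u + t)) \<le> F j u"
        "\<forall>u. 4 * ?l * (r0 * real n) \<le> (y0 - u)\<^sup>2 \<longrightarrow> F m u = 1"
        "F 0 0 \<le> 1 - (exp (- \<kappa> - y0\<^sup>2 / (2 * (v0 * real m))) - exp (- 2 * ?l))"
        using gaussian_block[OF elim(5) m(1,2) r0 v0pos \<kappa>0 step, of y0] by blast
      have "F m u = 1" if u: "u < \<tau> * ?d" for u
      proof -
        have "\<mu> * ?d \<le> y0 - u" using u by (simp add: y0_def distrib_right)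
        then have "(\<mu> * ?d)\<^sup>2 \<le> (y0 - u)\<^sup>2" using \<mu> d by (intro power_mono) auto
        moreover have "(\<mu> * ?d)\<^sup>2 = 4 * ?l * (r0 * real n)" unfolding power_mult_distrib lil_norm_sq r0_def by simp
        ultimately show ?thesis using F(4) by simp
      qed
      moreover have "F 0 0 \<le> 1 - exp (- (\<kappa> + ln 2) - ?l)"
      proof -
        have "y0\<^sup>2 / (2 * (v0 * real m)) \<le> ?l"
        proof -
          have "y0\<^sup>2 = (2 * v0 * ?l) * (p * real n)" unfolding y02 by simp
          also have "\<dots> \<le> (2 * v0 * ?l) * real m" using m v0pos l by (intro mult_left_mono) auto
          finally show ?thesis using v0pos m(1) by (simp add: pos_divide_le_eq ac_simps)
        qed
        then have "exp (- \<kappa> - ?l) \<le> exp (- \<kappa> - y0\<^sup>2 / (2 * (v0 * real m)))" by simp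
        moreover have "exp (- 2 * ?l) \<le> exp (- (\<kappa> + ln 2) - ?l)" using elim(2) by simp
        moreover have "exp (- \<kappa> - ?l) = 2 * exp (- (\<kappa> + ln 2) - ?l)"
        proof -
          have "exp (- \<kappa> - ?l) = exp (ln 2 + (- (\<kappa> + ln 2) - ?l))" by simp
          also have "\<dots> = 2 * exp (- (\<kappa> + ln 2) - ?l)" by (subst exp_add) simp
          finally show ?thesis .
        qed
        ultimately show ?thesis using F(5) by linarith
      qed
      ultimately show "\<exists>F. (\<forall>j. F j \<in> bl line_dist) \<and> (\<forall>j u. 0 \<le> F j u \<and> F j u \<le> 1)
        \<and> (\<forall>j u. j < m \<longrightarrow> e (\<lambda>t. F (Suc j) (u + t)) \<le> F j u)
        \<and> (\<forall>u. u < \<tau> * lil_norm n \<longrightarrow> F m u = 1)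
        \<and> F 0 0 \<le> 1 - exp (- (\<kappa> + ln 2) - ?l)"
        using F(1-3) by (intro exI[of _ F]) blast
    qed
  qed
  then show ?thesis by blast
qed

end

section \<open>The lower half\<close>

lemma geo_of_nat: "2 \<le> B \<Longrightarrow> geo (real B) k = B ^ k"
  by (simp add: geo_def flip: of_nat_power)

lemma filterlim_power_nat_at_top:
  fixes B :: nat assumes "2 \<le> B" shows "filterlim (\<lambda>k. B ^ k) at_top sequentially"
  unfolding filterlim_at_top
proof
  fix N
  have "1 < real B" using assms by simp
  from eventually_geo_ge[OF this, of N] show "\<forall>\<^sub>F k in sequentially. N \<le> B ^ k"
    unfolding geo_of_nat[OF assms] .
qed

lemma eventually_llog_power:
  fixes B :: nat assumes "2 \<le> B"
  shows "\<forall>\<^sub>F k in sequentially. llog (real (B ^ k)) = ln (real k * ln (real B))"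
  using eventually_compose_filterlim[OF eventually_llog filterlim_power_nat_at_top[OF assms]]
  by eventually_elim (use assms in \<open>simp add: ln_realpow\<close>)

lemma eventually_llog_power_pow4_le:
  fixes B :: nat assumes "2 \<le> B"
  shows "\<forall>\<^sub>F k in sequentially. llog (real (B ^ k)) ^ 4 \<le> real k"
proof -
  have L: "0 < ln (real B)" using assms by simp
  have "\<forall>\<^sub>F k in sequentially. ln (real k * ln (real B)) ^ 4 \<le> real k"
    using L by real_asymp
  with eventually_llog_power[OF assms] show ?thesis by eventually_elim simp
qed

context lil_seq
begin

text \<open>Eventually \<open>1 / k\<close> is at most a multiple of the \<open>k\<close>-th term if
  \<open>B ^ k\<close> is good, and at most \<open>B ^ k * tail (B ^ k)\<close> if not. The latter
  is summable, so convergence would contradict divergence of the harmonic series.\<close>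

lemma not_summable_good:
  fixes B :: nat assumes B: "2 \<le> B" and c: "0 < c"
  shows "\<not> summable (\<lambda>k. if good (B ^ k) then c * exp (- llog (real (B ^ k))) else 0)"
proof
  assume sg: "summable (\<lambda>k. if good (B ^ k) then c * exp (- llog (real (B ^ k))) else 0)"
  let ?L = "ln (real B)"
  let ?g = "\<lambda>k. if good (B ^ k) then c * exp (- llog (real (B ^ k))) else 0"
  let ?a = "\<lambda>k. real (B ^ k) * tail (B ^ k)"
  have L: "0 < ?L" using B by simp
  have "1 < real B" using B by simp
  from summable_tail_geo[OF this] have sa: "summable ?a" unfolding geo_of_nat[OF B] .
  have "summable (\<lambda>k. ?L / c * ?g k + ?a k)" by (intro summable_add summable_mult sg sa)
  then have "summable (\<lambda>k. 1 / real k)"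
  proof (rule summable_comparison_test_ev[rotated])
    show "\<forall>\<^sub>F k in sequentially. norm (1 / real k) \<le> ?L / c * ?g k + ?a k"
      using eventually_llog_power[OF B] eventually_llog_power_pow4_le[OF B] eventually_ge_at_top[of 1]
    proof eventually_elim
      case (elim k)
      have a0: "0 \<le> ?a k" using tail_nonneg by simp
      show ?case
      proof (cases "good (B ^ k)")
        case True
        have pos: "0 < real k * ?L" using elim(3) L by simp
        have "exp (- llog (real (B ^ k))) = 1 / (real k * ?L)"
          unfolding elim(1) using pos by (simp add: exp_minus inverse_eq_divide)
        then have "?L / c * ?g k = 1 / real k" using True c L by simp
        then show ?thesis using a0 by simp
      next
        case False
        then have "1 < ?a k * llog (real (B ^ k)) ^ 4" by (simp add: good_def)
        also have "\<dots> \<le> ?a k * real k" using elim(2) a0 by (intro mult_left_mono)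
        finally have "1 / real k \<le> ?a k" using elim(3) by (simp add: pos_divide_le_eq)
        then show ?thesis using False by simp
      qed
    qed
  qed
  then show False using not_summable_harmonic[where ?'a = real] by (simp add: inverse_eq_divide)
qed

text \<open>A certificate that a block of \<open>m\<close> variables has a sum of at least
  \<open>x\<close> with lower capacity at least \<open>h\<close>: \<open>F m\<close> dominates the
  indicator of a sum below \<open>x\<close>, and its expectation is at most
  \<open>F 0 0 \<le> 1 - h\<close>.\<close>

definition block_function :: "(nat \<Rightarrow> real \<Rightarrow> real) \<Rightarrow> nat \<Rightarrow> real \<Rightarrow> real \<Rightarrow> bool" where
  "block_function F m x h \<longleftrightarrow> (\<forall>j. F j \<in> bl line_dist) \<and> (\<forall>j u. 0 \<le> F j u \<and> F j u \<le> 1)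
    \<and> (\<forall>j u. j < m \<longrightarrow> e (\<lambda>t. F (Suc j) (u + t)) \<le> F j u)
    \<and> (\<forall>u. u < x \<longrightarrow> F m u = 1) \<and> F 0 0 \<le> 1 - h"

lemma block_functions:
  fixes B :: nat
  assumes \<tau>: "0 < \<tau>" and B: "2 \<le> B" and s: "\<tau>\<^sup>2 < s * (1 - 1 / real B)"
  shows "\<exists>c>0. \<forall>\<^sub>F k in sequentially. \<exists>F. block_function F (B ^ Suc k - B ^ k) (\<tau> * lil_norm (B ^ Suc k))
     (if good (B ^ Suc k) then c * exp (- llog (real (B ^ Suc k))) else 0)"
proof -
  define p where "p = 1 - 1 / real B"
  have p: "0 < p" "\<tau>\<^sup>2 < s * p" using B s by (auto simp: p_def)
  obtain \<kappa> where \<kappa>: "\<forall>\<^sub>F n in sequentially. good n \<longrightarrow> (\<forall>m\<ge>1. m \<le> n \<longrightarrow> p * real n \<le> real m \<longrightarrow>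
    (\<exists>F. (\<forall>j. F j \<in> bl line_dist) \<and> (\<forall>j u. 0 \<le> F j u \<and> F j u \<le> 1)
      \<and> (\<forall>j u. j < m \<longrightarrow> e (\<lambda>t. F (Suc j) (u + t)) \<le> F j u)
      \<and> (\<forall>u. u < \<tau> * lil_norm n \<longrightarrow> F m u = 1)
      \<and> F 0 0 \<le> 1 - exp (- \<kappa> - llog (real n))))"
    using lower_block[OF \<tau> p] by blast
  have fl: "filterlim (\<lambda>k. B ^ Suc k) at_top sequentially"
    using filterlim_compose[OF filterlim_power_nat_at_top[OF B] filterlim_Suc] .
  have "\<forall>\<^sub>F k in sequentially. \<exists>F. block_function F (B ^ Suc k - B ^ k) (\<tau> * lil_norm (B ^ Suc k))
     (if good (B ^ Suc k) then exp (- \<kappa>) * exp (- llog (real (B ^ Suc k))) else 0)"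
    using eventually_compose_filterlim[OF \<kappa> fl]
  proof eventually_elim
    case (elim k)
    let ?n = "B ^ Suc k" and ?m = "B ^ Suc k - B ^ k"
    show ?case
    proof (cases "good ?n")
      case False
      \<comment> \<open>At bad times nothing is claimed (\<open>h = 0\<close>), so the constant 1 is
        a valid certificate.\<close>
      then have "block_function (\<lambda>_ _. 1) ?m (\<tau> * lil_norm ?n) (if good ?n then exp (- \<kappa>) * exp (- llog (real ?n)) else 0)"
        by (simp add: block_function_def)
      then show ?thesis by (intro exI[of _ "\<lambda>_ _. 1"])
    next
      case True
      have "B ^ k < ?n" using B by simp
      then have m: "1 \<le> ?m" "?m \<le> ?n" by (simp_all del: power_Suc)
      have "real ?m = real ?n - real (B ^ k)" using \<open>B ^ k < ?n\<close> by (simp add: of_nat_diff)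
      also have "\<dots> = p * real ?n" using B by (simp add: p_def field_simps)
      finally have pm: "p * real ?n \<le> real ?m" by simp
      obtain F where "(\<forall>j. F j \<in> bl line_dist) \<and> (\<forall>j u. 0 \<le> F j u \<and> F j u \<le> 1)
        \<and> (\<forall>j u. j < ?m \<longrightarrow> e (\<lambda>t. F (Suc j) (u + t)) \<le> F j u)
        \<and> (\<forall>u. u < \<tau> * lil_norm ?n \<longrightarrow> F ?m u = 1)
        \<and> F 0 0 \<le> 1 - exp (- \<kappa> - llog (real ?n))"
        using elim[rule_format, OF True m pm] by blast
      then have "block_function F ?m (\<tau> * lil_norm ?n) (exp (- \<kappa> - llog (real ?n)))"
        unfolding block_function_def by blast
      moreover have "exp (- \<kappa> - llog (real ?n)) = exp (- \<kappa>) * exp (- llog (real ?n))"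
        by (simp flip: exp_add)
      ultimately show ?thesis using True by (intro exI[of _ F]) (simp only: if_True)
    qed
  qed
  then show ?thesis by (intro exI[of _ "exp (- \<kappa>)"]) simp
qed

text \<open>If all blocks from \<open>a\<close> on fail, finitely many certificates all equal 1.
  Their product integrates, last block first, to at most the product of the \<open>1 - h k\<close>,
  and \<open>1 - h \<le> exp (- h)\<close>. With a divergent sum this does the work of the second
  Borel-Cantelli lemma.\<close>

lemma blocks_product_bound:
  fixes B :: nat
  assumes B: "2 \<le> B" and h: "\<And>k. a \<le> k \<Longrightarrow> 0 \<le> h k"
    and F: "\<And>k. a \<le> k \<Longrightarrow> block_function (F k) (B ^ Suc k - B ^ k) (x k) (h k)"
  shows "Vhat {\<omega> \<in> space M. \<forall>k\<ge>a. partial_sum Y (B ^ Suc k) \<omega> - partial_sum Y (B ^ k) \<omega> < x k}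
    \<le> ereal (exp (- (\<Sum>k\<in>{a..<a + N}. h k)))"
proof -
  let ?m = "\<lambda>k. B ^ Suc k - B ^ k" and ?U = "\<lambda>k p. \<Sum>l\<in>{B ^ k..<B ^ Suc k}. p l"
  define Q where "Q = (\<lambda>N p. \<Prod>k\<in>{a..<a + N}. F k (?m k) (?U k p))"
  have Bm: "B ^ k + ?m k = B ^ Suc k" for k using B by simp
  have F_bl: "F k j \<in> bl line_dist" and F01: "0 \<le> F k j u" "F k j u \<le> 1"
    and F_step: "j < ?m k \<Longrightarrow> e (\<lambda>t. F k (Suc j) (u + t)) \<le> F k j u"
    and F_end: "u < x k \<Longrightarrow> F k (?m k) u = 1" and F_0: "F k 0 0 \<le> 1 - h k"
    if "a \<le> k" for k j u
    using F[OF that] unfolding block_function_def by blast+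
  have Q_bl: "Q N \<in> bl (path_dist (B ^ (a + N)))" for N
    unfolding Q_def
  proof (rule bl_prod)
    fix k assume k: "k \<in> {a..<a + N}"
    have "B ^ Suc k \<le> B ^ (a + N)" using k B by (intro power_increasing) auto
    then show "(\<lambda>p. F k (?m k) (?U k p)) \<in> bl (path_dist (B ^ (a + N)))"
      using k by (intro bl_path_sum[where h = "\<lambda>_ t. t" and L = 1] F_bl) auto
  qed
  have Q0: "0 \<le> Q N p" for N p unfolding Q_def using F01 by (intro prod_nonneg) auto
  have eQ: "0 \<le> e_path (Q N)" for N using e_path_mono[OF bl_const Q_bl, of 0 N] Q0 by simp
  have bound: "e_path (Q N) \<le> exp (- (\<Sum>k\<in>{a..<a + N}. h k))" for N
  proof (induction N)
    case 0 then show ?case by (simp add: Q_def)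
  next
    case (Suc N)
    let ?K = "a + N"
    have "a \<le> ?K" by simp
    have "Q (Suc N) = (\<lambda>p. Q N p * F ?K (?m ?K) (\<Sum>l\<in>{B ^ ?K..<B ^ ?K + ?m ?K}. p l))"
      unfolding Q_def Bm by simp
    then have "e_path (Q (Suc N)) = e_path (\<lambda>p. Q N p * F ?K (?m ?K) (\<Sum>l\<in>{B ^ ?K..<B ^ ?K + ?m ?K}. p l))" by simp
    also have "\<dots> \<le> F ?K 0 0 * e_path (Q N)"
      by (rule block_product[OF Q_bl Q0]) (use F_bl[OF \<open>a \<le> ?K\<close>] F01[OF \<open>a \<le> ?K\<close>] F_step[OF \<open>a \<le> ?K\<close>] in auto)
    also have "\<dots> \<le> exp (- h ?K) * exp (- (\<Sum>k\<in>{a..<a + N}. h k))"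
    proof (rule mult_mono[OF _ Suc _ eQ])
      show "F ?K 0 0 \<le> exp (- h ?K)" using F_0[OF \<open>a \<le> ?K\<close>] exp_ge_add_one_self[of "- h ?K"] by linarith
    qed simp
    also have "\<dots> = exp (- (\<Sum>k\<in>{a..<a + Suc N}. h k))" by (simp flip: exp_add)
    finally show ?case .
  qed
  have "Vhat {\<omega> \<in> space M. \<forall>k\<ge>a. partial_sum Y (B ^ Suc k) \<omega> - partial_sum Y (B ^ k) \<omega> < x k} \<le> ereal (e_path (Q N))"
  proof (rule Vhat_le_e_path[OF Q_bl])
    fix \<omega>
    let ?A = "{\<omega> \<in> space M. \<forall>k\<ge>a. partial_sum Y (B ^ Suc k) \<omega> - partial_sum Y (B ^ k) \<omega> < x k}"
    have "Q N (path \<omega>) = 1" if "\<omega> \<in> ?A"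
      unfolding Q_def
    proof (rule prod.neutral, rule ballI)
      fix k assume k: "k \<in> {a..<a + N}"
      then have ak: "a \<le> k" by simp
      have "B ^ k \<le> B ^ Suc k" using B by simp
      then have "{..<B ^ Suc k} = {..<B ^ k} \<union> {B ^ k..<B ^ Suc k}" by (auto simp del: power_Suc)
      then have "partial_sum Y (B ^ Suc k) \<omega> = partial_sum Y (B ^ k) \<omega> + ?U k (path \<omega>)"
        unfolding partial_sum_path by (simp add: sum.union_disjoint[symmetric] ivl_disj_int)
      then have "?U k (path \<omega>) < x k" using that ak by force
      then show "F k (?m k) (?U k (path \<omega>)) = 1" by (rule F_end[OF ak])
    qed
    then show "indicator ?A \<omega> \<le> Q N (path \<omega>)" using Q0[of N "path \<omega>"] by (cases "\<omega> \<in> ?A") auto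
  qed
  also have "\<dots> \<le> ereal (exp (- (\<Sum>k\<in>{a..<a + N}. h k)))" using bound by simp
  finally show ?thesis .
qed

lemma null_blocks_small:
  fixes B :: nat
  assumes \<tau>: "0 < \<tau>" and B: "2 \<le> B" and s: "\<tau>\<^sup>2 < s * (1 - 1 / real B)"
  shows "null {\<omega> \<in> space M. \<forall>\<^sub>F k in sequentially.
    partial_sum Y (B ^ Suc k) \<omega> - partial_sum Y (B ^ k) \<omega> < \<tau> * lil_norm (B ^ Suc k)}"
proof -
  let ?D = "\<lambda>a. {\<omega> \<in> space M. \<forall>k\<ge>a. partial_sum Y (B ^ Suc k) \<omega> - partial_sum Y (B ^ k) \<omega> < \<tau> * lil_norm (B ^ Suc k)}"
  obtain c where c: "0 < c" "\<forall>\<^sub>F k in sequentially. \<exists>F. block_function F (B ^ Suc k - B ^ k) (\<tau> * lil_norm (B ^ Suc k))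
     (if good (B ^ Suc k) then c * exp (- llog (real (B ^ Suc k))) else 0)"
    using block_functions[OF \<tau> B s] by blast
  define h where "h = (\<lambda>k. if good (B ^ Suc k) then c * exp (- llog (real (B ^ Suc k))) else 0)"
  have h0: "0 \<le> h k" for k using c(1) by (simp add: h_def)
  have h_div: "\<not> summable h"
    unfolding h_def using not_summable_good[OF B c(1)]
    by (subst summable_Suc_iff[where f = "\<lambda>k. if good (B ^ k) then c * exp (- llog (real (B ^ k))) else 0"])
  obtain k0 where k0: "\<And>k. k0 \<le> k \<Longrightarrow> \<exists>F. block_function F (B ^ Suc k - B ^ k) (\<tau> * lil_norm (B ^ Suc k)) (h k)"
    using c(2) unfolding eventually_sequentially h_def by blast
  then obtain F where F: "\<And>k. k0 \<le> k \<Longrightarrow> block_function (F k) (B ^ Suc k - B ^ k) (\<tau> * lil_norm (B ^ Suc k)) (h k)"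
    by metis
  have "null (?D a)" for a
  proof (rule null_of_Vhat_small)
    show "?D a \<in> sets M" by measurable
    fix r :: real assume r: "0 < r"
    let ?a = "max a k0"
    have "\<exists>N. - ln r < (\<Sum>i<N. h (?a + i))"
    proof (rule ccontr)
      assume "\<nexists>N. - ln r < (\<Sum>i<N. h (?a + i))"
      then have "summable (\<lambda>i. h (?a + i))" using h0 by (intro summableI_nonneg_bounded[where x = "- ln r"]) (auto simp: not_less)
      then have "summable (\<lambda>i. h (i + ?a))" by (simp add: add.commute)
      then show False using h_div by (simp only: summable_iff_shift)
    qed
    then obtain N where N: "- ln r < (\<Sum>i<N. h (?a + i))" by blast
    have "(\<Sum>k\<in>{?a..<?a + N}. h k) = (\<Sum>i<N. h (?a + i))"
      using sum.shift_bounds_nat_ivl[of h 0 ?a N] by (simp add: lessThan_atLeast0 add.commute)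
    then have "exp (- (\<Sum>k\<in>{?a..<?a + N}. h k)) \<le> exp (ln r)" using N by simp
    also have "\<dots> = r" using r by simp
    finally have er: "exp (- (\<Sum>k\<in>{?a..<?a + N}. h k)) \<le> r" .
    have "Vhat (?D a) \<le> Vhat (?D ?a)" by (intro Vhat_mono) auto
    also have "\<dots> \<le> ereal (exp (- (\<Sum>k\<in>{?a..<?a + N}. h k)))"
      using F h0 by (intro blocks_product_bound[OF B]) auto
    also have "\<dots> \<le> ereal r" using er by simp
    finally show "Vhat (?D a) \<le> ereal r" .
  qed
  then have "null (\<Union>a. ?D a)" by (rule null_UN)
  then show ?thesis by (rule null_mono) (auto simp: eventually_sequentially)
qed

text \<open>The sum at \<open>B ^ Suc k\<close> is the block increment plus the sum at
  \<open>B ^ k\<close>. By \<open>minus\<close> the latter is eventually no worse than a multiple of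
  \<open>lil_norm (B ^ k)\<close>, which is at most \<open>lil_norm (B ^ Suc k) / sqrt B\<close>. A
  large base makes this loss and the loss \<open>1 - 1 / B\<close> in the block length
  negligible.\<close>

lemma null_lower:
  assumes s: "0 < s" and \<tau>': "\<tau>' < sqrt s"
    and minus: "null {\<omega> \<in> space M. \<exists>\<^sub>\<infinity>n. (sqrt S + 1) * lil_norm n \<le> - partial_sum Y n \<omega>}"
  shows "null {\<omega> \<in> space M. \<forall>\<^sub>F n in sequentially. partial_sum Y n \<omega> < \<tau>' * lil_norm n}"
proof -
  have "max 0 \<tau>' < sqrt s" using s \<tau>' by simp
  then obtain \<tau> where \<tau>: "max 0 \<tau>' < \<tau>" "\<tau> < sqrt s" using dense by blast
  then have \<tau>0: "0 < \<tau>" "\<tau>' < \<tau>" by auto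
  have \<tau>s: "\<tau>\<^sup>2 < s" using power_strict_mono[OF \<tau>(2), of 2] \<tau>0 s by simp
  have "((\<lambda>B. s * (1 - 1 / real B)) \<longlongrightarrow> s * (1 - 0)) sequentially"
    by (intro tendsto_intros lim_1_over_n)
  then have ev1: "\<forall>\<^sub>F B in sequentially. \<tau>\<^sup>2 < s * (1 - 1 / real B)"
    using \<tau>s by (intro order_tendstoD(1)) auto
  have "((\<lambda>B. (sqrt S + 1) * (1 / sqrt (real B))) \<longlongrightarrow> (sqrt S + 1) * 0) sequentially"
    by (intro tendsto_mult tendsto_const) real_asymp
  then have ev2: "\<forall>\<^sub>F B in sequentially. (sqrt S + 1) * (1 / sqrt (real B)) < \<tau> - \<tau>'"
    using \<tau>0 by (intro order_tendstoD(2)) auto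
  obtain B :: nat where B: "2 \<le> B" "\<tau>\<^sup>2 < s * (1 - 1 / real B)" "(sqrt S + 1) * (1 / sqrt (real B)) < \<tau> - \<tau>'"
    using eventually_happens[OF eventually_conj[OF eventually_conj[OF ev1 ev2] eventually_ge_at_top[of 2]]] by auto
  have "null ({\<omega> \<in> space M. \<forall>\<^sub>F k in sequentially.
      partial_sum Y (B ^ Suc k) \<omega> - partial_sum Y (B ^ k) \<omega> < \<tau> * lil_norm (B ^ Suc k)} \<union>
      {\<omega> \<in> space M. \<exists>\<^sub>\<infinity>n. (sqrt S + 1) * lil_norm n \<le> - partial_sum Y n \<omega>})" (is "null (?N1 \<union> ?N2)")
    by (rule null_Un[OF null_blocks_small[OF \<tau>0(1) B(1,2)] minus])
  then show ?thesis
  proof (rule null_mono, intro subsetI UnCI)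
    fix \<omega> assume "\<omega> \<in> {\<omega> \<in> space M. \<forall>\<^sub>F n in sequentially. partial_sum Y n \<omega> < \<tau>' * lil_norm n}"
    then have \<omega>: "\<omega> \<in> space M" "\<forall>\<^sub>F n in sequentially. partial_sum Y n \<omega> < \<tau>' * lil_norm n" by auto
    assume "\<omega> \<notin> ?N2"
    then have ev: "\<forall>\<^sub>F n in sequentially. - partial_sum Y n \<omega> < (sqrt S + 1) * lil_norm n"
      using \<omega>(1) by (simp add: frequently_def cofinite_eq_sequentially not_le)
    have fl: "filterlim (\<lambda>k. B ^ k) at_top sequentially" by (rule filterlim_power_nat_at_top[OF B(1)])
    have flS: "filterlim (\<lambda>k. B ^ Suc k) at_top sequentially" by (rule filterlim_compose[OF fl filterlim_Suc])
    have "\<forall>\<^sub>F k in sequentially. partial_sum Y (B ^ Suc k) \<omega> - partial_sum Y (B ^ k) \<omega> < \<tau> * lil_norm (B ^ Suc k)"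
      using eventually_compose_filterlim[OF \<omega>(2) flS] eventually_compose_filterlim[OF ev fl]
    proof eventually_elim
      case (elim k)
      have "lil_norm (B ^ k) \<le> 1 / sqrt (real B) * lil_norm (B ^ Suc k)"
      proof (rule power2_le_imp_le)
        have "llog (real (B ^ k)) \<le> llog (real (B ^ Suc k))" using B(1) by (intro llog_mono) simp
        then have "2 * real (B ^ k) * llog (real (B ^ k)) \<le> 2 * real (B ^ k) * llog (real (B ^ Suc k))" by (intro mult_left_mono) auto
        also have "\<dots> = (1 / sqrt (real B) * lil_norm (B ^ Suc k))\<^sup>2"
          unfolding power_mult_distrib lil_norm_sq power_divide using B(1) by simp
        finally show "(lil_norm (B ^ k))\<^sup>2 \<le> (1 / sqrt (real B) * lil_norm (B ^ Suc k))\<^sup>2" unfolding lil_norm_sq .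
      qed (simp add: lil_norm_nonneg)
      then have "(sqrt S + 1) * lil_norm (B ^ k) \<le> (sqrt S + 1) * (1 / sqrt (real B) * lil_norm (B ^ Suc k))"
        using S_nonneg by (intro mult_left_mono) auto
      also have "\<dots> = ((sqrt S + 1) * (1 / sqrt (real B))) * lil_norm (B ^ Suc k)" by simp
      also have "\<dots> \<le> (\<tau> - \<tau>') * lil_norm (B ^ Suc k)"
        using B(3) lil_norm_nonneg by (intro mult_right_mono) auto
      finally show ?case using elim by (simp add: left_diff_distrib)
    qed
    then show "\<omega> \<in> ?N1" using \<omega>(1) by simp
  qed
qed

end

section \<open>The cluster set of a slowly varying sequence\<close>

lemma frequently_limit_subseq:
  fixes x :: "nat \<Rightarrow> real"
  assumes "\<And>\<epsilon>. 0 < \<epsilon> \<Longrightarrow> \<exists>\<^sub>\<infinity>n. \<bar>x n - c\<bar> < \<epsilon>"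
  shows "\<exists>r. strict_mono r \<and> (x \<circ> r) \<longlonglongrightarrow> c"
proof -
  let ?z = "\<lambda>n. ereal \<bar>x n - c\<bar>"
  have "0 \<le> liminf ?z" by (rule Liminf_bounded) simp
  moreover have "liminf ?z \<le> ereal \<epsilon>" if "0 < \<epsilon>" for \<epsilon>
  proof (rule ccontr)
    assume "\<not> liminf ?z \<le> ereal \<epsilon>"
    then have "ereal \<epsilon> < liminf ?z" by simp
    then have "\<forall>\<^sub>F n in sequentially. ereal \<epsilon> < ?z n" by (rule less_LiminfD)
    then have "\<forall>\<^sub>F n in sequentially. \<not> \<bar>x n - c\<bar> < \<epsilon>" by eventually_elim simp
    then show False using assms[OF that] by (simp add: frequently_def cofinite_eq_sequentially)
  qed
  then have "liminf ?z \<le> 0" using ereal_le_epsilon2[of "liminf ?z" 0] by simp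
  ultimately have z: "liminf ?z = 0" by (intro antisym)
  obtain r :: "nat \<Rightarrow> nat" where r: "strict_mono r" "(?z \<circ> r) \<longlonglongrightarrow> liminf ?z"
    using liminf_subseq_lim by blast
  have "(\<lambda>n. \<bar>x (r n) - c\<bar>) \<longlonglongrightarrow> 0" using r(2) unfolding z zero_ereal_def comp_def lim_ereal .
  then have "(\<lambda>n. x (r n) - c) \<longlonglongrightarrow> 0" by (simp only: tendsto_rabs_zero_iff)
  then have "(x \<circ> r) \<longlonglongrightarrow> c" unfolding comp_def by (rule Lim_null[THEN iffD2])
  then show ?thesis using r(1) by blast
qed

text \<open>A discrete intermediate value argument: steps shorter than \<epsilon> cannot jump over a
  gap of length \<open>2 * \<epsilon>\<close>, so a sequence avoiding it would stay above for ever
  once it is above.\<close>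

lemma frequently_near_crossing:
  fixes x :: "nat \<Rightarrow> real"
  assumes step: "(\<lambda>n. x (Suc n) - x n) \<longlonglongrightarrow> 0" and \<epsilon>: "0 < \<epsilon>"
    and above: "\<exists>\<^sub>\<infinity>n. c - \<epsilon> < x n" and below: "\<exists>\<^sub>\<infinity>n. x n < c + \<epsilon>"
  shows "\<exists>\<^sub>\<infinity>n. \<bar>x n - c\<bar> < \<epsilon>"
proof (rule ccontr)
  assume "\<not> (\<exists>\<^sub>\<infinity>n. \<bar>x n - c\<bar> < \<epsilon>)"
  then have "\<forall>\<^sub>F n in sequentially. \<epsilon> \<le> \<bar>x n - c\<bar>"
    by (simp add: frequently_def cofinite_eq_sequentially not_less)
  moreover have "\<forall>\<^sub>F n in sequentially. \<bar>x (Suc n) - x n\<bar> < \<epsilon>"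
    using tendstoD[OF step \<epsilon>] by (simp add: dist_real_def)
  ultimately have "\<forall>\<^sub>F n in sequentially. \<epsilon> \<le> \<bar>x n - c\<bar> \<and> \<bar>x (Suc n) - x n\<bar> < \<epsilon>" by (rule eventually_conj)
  then obtain N where N: "\<And>n. N \<le> n \<Longrightarrow> \<epsilon> \<le> \<bar>x n - c\<bar> \<and> \<bar>x (Suc n) - x n\<bar> < \<epsilon>"
    unfolding eventually_sequentially by blast
  obtain p where p: "N \<le> p" "c - \<epsilon> < x p" using above unfolding INFM_nat_le by blast
  have up: "c + \<epsilon> \<le> x p" using N[OF p(1)] p(2) by (auto simp: abs_if split: if_splits)
  have "c + \<epsilon> \<le> x n" if "p \<le> n" for n using that
  proof (induction n rule: dec_induct)
    case base show ?case by (rule up)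
  next
    case (step n)
    then have "N \<le> n" "N \<le> Suc n" using p(1) by auto
    then show ?case using N[of n] N[of "Suc n"] step.IH by (auto simp: abs_if split: if_splits)
  qed
  moreover obtain q where "p \<le> q" "x q < c + \<epsilon>" using below unfolding INFM_nat_le by blast
  ultimately show False by force
qed

lemma cluster_set_interval:
  fixes x :: "nat \<Rightarrow> real"
  assumes S: "\<And>\<epsilon>. 0 < \<epsilon> \<Longrightarrow> \<forall>\<^sub>F n in sequentially. x n < S + \<epsilon>"
    and S': "\<And>\<epsilon>. 0 < \<epsilon> \<Longrightarrow> \<forall>\<^sub>F n in sequentially. - x n < S + \<epsilon>"
    and s: "\<And>\<epsilon>. 0 < \<epsilon> \<Longrightarrow> \<exists>\<^sub>\<infinity>n. s - \<epsilon> \<le> x n"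
    and s': "\<And>\<epsilon>. 0 < \<epsilon> \<Longrightarrow> \<exists>\<^sub>\<infinity>n. s - \<epsilon> \<le> - x n"
    and step: "(\<lambda>n. x (Suc n) - x n) \<longlonglongrightarrow> 0"
  defines "L \<equiv> limsup (\<lambda>n. ereal (x n))" and "l \<equiv> liminf (\<lambda>n. ereal (x n))"
  shows "ereal s \<le> L" "L \<le> ereal S" "ereal (- S) \<le> l" "l \<le> ereal (- s)"
    "cluster_set x \<subseteq> {- S..S}" "ereal ` cluster_set x = {l..L}" "{- s..s} \<subseteq> cluster_set x"
proof -
  show 1: "L \<le> ereal S"
  proof (rule ereal_le_epsilon2)
    fix \<epsilon> :: real assume "0 < \<epsilon>"
    show "L \<le> ereal S + ereal \<epsilon>" unfolding L_def
      by (rule Limsup_bounded) (use S[OF \<open>0 < \<epsilon>\<close>] in \<open>eventually_elim, simp\<close>)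
  qed
  show 2: "ereal (- S) \<le> l"
  proof (rule ereal_le_epsilon2)
    fix \<epsilon> :: real assume e: "0 < \<epsilon>"
    have "ereal (- S - \<epsilon>) \<le> l" unfolding l_def
      by (rule Liminf_bounded) (use S'[OF e] in \<open>eventually_elim, simp\<close>)
    then show "ereal (- S) \<le> l + ereal \<epsilon>" by (cases l) auto
  qed
  show 3: "ereal s \<le> L"
  proof (rule ccontr)
    assume "\<not> ereal s \<le> L"
    then have "L < ereal s" by (simp only: not_le)
    then obtain b where b: "L < ereal b" "ereal b < ereal s"
      using ereal_dense2[of L "ereal s"] by blast
    have "\<forall>\<^sub>F n in sequentially. ereal (x n) < ereal b" using b(1) unfolding L_def by (rule Limsup_lessD)
    then have "\<forall>\<^sub>F n in sequentially. \<not> s - (s - b) \<le> x n" by eventually_elim simp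
    then show False using s[of "s - b"] b(2) by (simp add: frequently_def cofinite_eq_sequentially)
  qed
  show 4: "l \<le> ereal (- s)"
  proof (rule ccontr)
    assume "\<not> l \<le> ereal (- s)"
    then have "ereal (- s) < l" by (simp only: not_le)
    then obtain b where b: "ereal b < l" "ereal (- s) < ereal b"
      using ereal_dense2[of "ereal (- s)" l] by blast
    have "\<forall>\<^sub>F n in sequentially. ereal b < ereal (x n)" using b(1) unfolding l_def by (rule less_LiminfD)
    then have "\<forall>\<^sub>F n in sequentially. \<not> s - (s + b) \<le> - x n" by eventually_elim simp
    then show False using s'[of "s + b"] b(2) by (simp add: frequently_def cofinite_eq_sequentially)
  qed
  have sub: "l \<le> ereal c \<and> ereal c \<le> L" if c: "c \<in> cluster_set x" for c
  proof -
    obtain r where r: "strict_mono r" "(x \<circ> r) \<longlonglongrightarrow> c" using c unfolding cluster_set_def by blast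
    have lim: "((\<lambda>n. ereal (x n)) \<circ> r) \<longlonglongrightarrow> ereal c" using r(2) by (simp add: comp_def)
    have "l \<le> liminf ((\<lambda>n. ereal (x n)) \<circ> r)" unfolding l_def by (rule liminf_subseq_mono[OF r(1)])
    moreover have "limsup ((\<lambda>n. ereal (x n)) \<circ> r) \<le> L" unfolding L_def by (rule limsup_subseq_mono[OF r(1)])
    ultimately show ?thesis
      using lim_imp_Liminf[OF _ lim] lim_imp_Limsup[OF _ lim] by simp
  qed
  have sup: "c \<in> cluster_set x" if c: "l \<le> ereal c" "ereal c \<le> L" for c
  proof -
    have "\<exists>\<^sub>\<infinity>n. \<bar>x n - c\<bar> < \<epsilon>" if e: "0 < \<epsilon>" for \<epsilon>
    proof (rule frequently_near_crossing[OF step e])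
      show "\<exists>\<^sub>\<infinity>n. c - \<epsilon> < x n"
      proof (rule ccontr)
        assume "\<not> (\<exists>\<^sub>\<infinity>n. c - \<epsilon> < x n)"
        then have "\<forall>\<^sub>F n in sequentially. ereal (x n) \<le> ereal (c - \<epsilon>)"
          by (simp add: frequently_def cofinite_eq_sequentially not_less)
        then have "L \<le> ereal (c - \<epsilon>)" unfolding L_def by (rule Limsup_bounded)
        then have "ereal c \<le> ereal (c - \<epsilon>)" using c(2) by (rule order_trans[rotated])
        then show False using e by simp
      qed
      show "\<exists>\<^sub>\<infinity>n. x n < c + \<epsilon>"
      proof (rule ccontr)
        assume "\<not> (\<exists>\<^sub>\<infinity>n. x n < c + \<epsilon>)"
        then have "\<forall>\<^sub>F n in sequentially. ereal (c + \<epsilon>) \<le> ereal (x n)"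
          by (simp add: frequently_def cofinite_eq_sequentially not_less)
        then have "ereal (c + \<epsilon>) \<le> l" unfolding l_def by (rule Liminf_bounded)
        then have "ereal (c + \<epsilon>) \<le> ereal c" using c(1) by (rule order_trans)
        then show False using e by simp
      qed
    qed
    then show ?thesis unfolding cluster_set_def using frequently_limit_subseq[of x c] by blast
  qed
  show "cluster_set x \<subseteq> {- S..S}"
  proof
    fix c assume "c \<in> cluster_set x"
    then have "ereal (- S) \<le> ereal c" "ereal c \<le> ereal S" using sub 1 2 by (blast intro: order_trans)+
    then show "c \<in> {- S..S}" by simp
  qed
  show "{- s..s} \<subseteq> cluster_set x"
  proof
    fix c assume "c \<in> {- s..s}"
    then have "ereal (- s) \<le> ereal c" "ereal c \<le> ereal s" by auto
    then show "c \<in> cluster_set x" using sup 3 4 by (blast intro: order_trans)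
  qed
  show "ereal ` cluster_set x = {l..L}"
  proof (intro subset_antisym subsetI)
    fix y assume "y \<in> ereal ` cluster_set x"
    then obtain c where c: "c \<in> cluster_set x" "y = ereal c" by blast
    show "y \<in> {l..L}" using sub[OF c(1)] c(2) by simp
  next
    fix y assume "y \<in> {l..L}"
    then have y: "l \<le> y" "y \<le> L" by auto
    \<comment> \<open>The bounds exclude infinite values, so \<open>y\<close> comes from a real
      number.\<close>
    have "ereal (- S) \<le> y" "y \<le> ereal S" using y 1 2 by (blast intro: order_trans)+
    then obtain c where c: "y = ereal c" by (cases y) auto
    then have "c \<in> cluster_set x" using y by (intro sup) simp_all
    then show "y \<in> ereal ` cluster_set x" using c by simp
  qed
qed

section \<open>Reflection\<close>

lemma vec_append_uminus: "vec_append m (\<lambda>i. - x i) (\<lambda>i. - y i) = (\<lambda>i. - vec_append m x y i)"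
  by (auto simp: vec_append_def)

lemma C_lLip_uminus:
  assumes "\<phi> \<in> C_lLip n" shows "(\<lambda>x. \<phi> (\<lambda>i. - x i)) \<in> C_lLip n"
proof -
  obtain C m where C: "0 < C" "\<And>x y. \<bar>\<phi> x - \<phi> y\<bar> \<le> C * (1 + L2_set x {..<n} ^ m + L2_set y {..<n} ^ m)
      * L2_set (\<lambda>i. x i - y i) {..<n}"
    using assms unfolding C_lLip_def by blast
  have neg: "L2_set (\<lambda>i. - x i) {..<n} = L2_set x {..<n}" for x :: "nat \<Rightarrow> real"
    by (simp add: L2_set_def)
  have "\<bar>\<phi> (\<lambda>i. - x i) - \<phi> (\<lambda>i. - y i)\<bar> \<le> C * (1 + L2_set x {..<n} ^ m + L2_set y {..<n} ^ m)
      * L2_set (\<lambda>i. x i - y i) {..<n}" for x y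
  proof -
    have "L2_set (\<lambda>i. - x i - - y i) {..<n} = L2_set (\<lambda>i. x i - y i) {..<n}"
      using neg[of "\<lambda>i. x i - y i"] by simp
    then show ?thesis using C(2)[of "\<lambda>i. - x i" "\<lambda>i. - y i"] unfolding neg by simp
  qed
  then show ?thesis unfolding C_lLip_def using C(1) by blast
qed

text \<open>Every term for \<phi> and the reflected vectors is the corresponding term for
  \<open>\<phi> (- x)\<close> and the original ones, and \<open>C_lLip\<close> is closed under this
  reflection.\<close>

lemma independent_to_uminus:
  assumes ind: "independent_to H E n Y m X"
    and "\<And>j. j < n \<Longrightarrow> (\<lambda>\<omega>. - Y j \<omega>) \<in> H" "\<And>j. j < m \<Longrightarrow> (\<lambda>\<omega>. - X j \<omega>) \<in> H"
  shows "independent_to H E n (\<lambda>j \<omega>. - Y j \<omega>) m (\<lambda>j \<omega>. - X j \<omega>)"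
  unfolding independent_to_def Let_def
proof (intro conjI ballI allI impI)
  fix \<phi> assume \<phi>: "\<phi> \<in> C_lLip (m + n)"
  define \<psi> where "\<psi> = (\<lambda>x. \<phi> (\<lambda>i. - x i))"
  have app: "\<phi> (vec_append m (\<lambda>i. - x i) (\<lambda>j. - y j)) = \<psi> (vec_append m x y)" for x y
    by (simp add: \<psi>_def vec_append_uminus)
  assume fin: "\<forall>x. E (\<lambda>\<omega>. \<bar>\<phi> (vec_append m x (\<lambda>j. - Y j \<omega>))\<bar>) < \<infinity>"
  assume h: "(\<lambda>\<omega>. \<bar>real_of_ereal (E (\<lambda>\<omega>'. \<bar>\<phi> (vec_append m (\<lambda>i. - X i \<omega>) (\<lambda>j. - Y j \<omega>'))\<bar>))\<bar>) \<in> H"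
    "E (\<lambda>\<omega>. \<bar>real_of_ereal (E (\<lambda>\<omega>'. \<bar>\<phi> (vec_append m (\<lambda>i. - X i \<omega>) (\<lambda>j. - Y j \<omega>'))\<bar>))\<bar>) < \<infinity>"
    "(\<lambda>\<omega>. real_of_ereal (E (\<lambda>\<omega>'. \<phi> (vec_append m (\<lambda>i. - X i \<omega>) (\<lambda>j. - Y j \<omega>'))))) \<in> H"
  have "E (\<lambda>\<omega>. \<bar>\<psi> (vec_append m x (\<lambda>j. Y j \<omega>))\<bar>) < \<infinity>" for x
    using fin[rule_format, of "\<lambda>i. - x i"] unfolding app .
  moreover have "\<psi> \<in> C_lLip (m + n)" unfolding \<psi>_def by (rule C_lLip_uminus[OF \<phi>])
  ultimately show "E (\<lambda>\<omega>. \<phi> (vec_append m (\<lambda>i. - X i \<omega>) (\<lambda>j. - Y j \<omega>))) =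
      E (\<lambda>\<omega>. real_of_ereal (E (\<lambda>\<omega>'. \<phi> (vec_append m (\<lambda>i. - X i \<omega>) (\<lambda>j. - Y j \<omega>')))))"
    using ind h unfolding independent_to_def Let_def app by blast
qed (use assms in auto)

lemma (in iid_seq) iid_seq_uminus: "iid_seq M H E (\<lambda>n \<omega>. - Y n \<omega>)"
proof unfold_locales
  show neg: "(\<lambda>\<omega>. - Y n \<omega>) \<in> H" if "1 \<le> n" for n using H_scale[OF Y_H[OF that], of "- 1"] by simp
  show "independent_seq H E (\<lambda>n \<omega>. - Y n \<omega>)"
    unfolding independent_seq_def
  proof (intro allI impI)
    fix i :: nat assume "1 \<le> i"
    then have "independent_to H E 1 (\<lambda>_. Y (i + 1)) i (\<lambda>j. Y (j + 1))"
      using Y_independent unfolding independent_seq_def by blast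
    then show "independent_to H E 1 (\<lambda>_ \<omega>. - Y (i + 1) \<omega>) i (\<lambda>j \<omega>. - Y (j + 1) \<omega>)"
      by (rule independent_to_uminus) (use neg in auto)
  qed
  show "identically_distributed_seq E (\<lambda>n \<omega>. - Y n \<omega>)"
    unfolding identically_distributed_seq_def
  proof (intro allI impI)
    fix i :: nat and \<phi> :: "real \<Rightarrow> real"
    assume i: "1 \<le> i" and b: "bounded (range \<phi>)" and "\<exists>L. L-lipschitz_on UNIV \<phi>"
    then obtain L where L: "L-lipschitz_on UNIV \<phi>" by blast
    have "bounded (range (\<lambda>y. \<phi> (- y)))" by (rule bounded_subset[OF b]) auto
    moreover have "L-lipschitz_on UNIV (\<lambda>y. \<phi> (- y))"
    proof (rule lipschitz_onI)
      show "0 \<le> L" using L by (rule lipschitz_on_nonneg)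
      show "dist (\<phi> (- x)) (\<phi> (- y)) \<le> L * dist x y" for x y
        using lipschitz_onD[OF L, of "- x" "- y"] by (simp add: dist_minus)
    qed
    ultimately show "E (\<lambda>\<omega>. \<phi> (- Y i \<omega>)) = E (\<lambda>\<omega>. \<phi> (- Y 1 \<omega>))"
      using Y_identical[unfolded identically_distributed_seq_def, rule_format, OF i, of "\<lambda>y. \<phi> (- y)"] by blast
  qed
qed

lemma clip_uminus: "0 \<le> c \<Longrightarrow> clip c (- y) = - clip c y"
  by (auto simp: max_def min_def)

text \<open>\<open>capped\<close> is even and \<open>clip\<close> is odd, so the moment conditions
  are unchanged and the two mean conditions change places.\<close>

lemma (in lil_seq) lil_seq_uminus: "lil_seq M H E (\<lambda>n \<omega>. - Y n \<omega>) S s"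
proof -
  interpret neg: iid_seq M H E "\<lambda>n \<omega>. - Y n \<omega>" by (rule iid_seq_uminus)
  have e_neg: "neg.e f = e (\<lambda>y. f (- y))" for f by (simp add: neg.e_def e_def)
  show ?thesis
  proof unfold_locales
    show "neg.e (\<lambda>y. (capped c y)\<^sup>2) \<le> S" if "0 \<le> c" for c
      unfolding e_neg using capped_second_moment[OF that] by simp
    show "((\<lambda>c. - neg.e (\<lambda>y. - (capped c y)\<^sup>2)) \<longlongrightarrow> s) at_top"
      unfolding e_neg using lower_second_moment by simp
    have ev: "\<forall>\<^sub>F c :: real in at_top. 0 \<le> c" by (rule eventually_ge_at_top)
    show "((\<lambda>c. neg.e (clip c)) \<longlongrightarrow> 0) at_top"
      by (rule Lim_transform_eventually[OF mean_zero_uminus]) (use ev in \<open>eventually_elim, simp add: e_neg clip_uminus\<close>)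
    show "((\<lambda>c. neg.e (\<lambda>y. - clip c y)) \<longlongrightarrow> 0) at_top"
      by (rule Lim_transform_eventually[OF mean_zero]) (use ev in \<open>eventually_elim, simp add: e_neg clip_uminus\<close>)
    show "summable (\<lambda>n. neg.e (\<lambda>y. (capped (lil_norm n) y) ^ 4) / lil_norm n ^ 4)"
      unfolding e_neg using summable_fourth_moments by simp
  qed
qed

section \<open>The Choquet integrability condition\<close>

lemma capacity_mono:
  "capacity M V \<Longrightarrow> A \<in> sets M \<Longrightarrow> B \<in> sets M \<Longrightarrow> A \<subseteq> B \<Longrightarrow> V A \<le> V B"
  unfolding capacity_def by blast

text \<open>An integral test: the capacity is nonincreasing in \<open>t\<close>, so its value at
  \<open>j\<close> is at most its integral over the unit interval ending at
  \<open>j\<close>.\<close>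

lemma choquet_sum_le:
  fixes X :: "'a \<Rightarrow> real"
  assumes V: "capacity M V" and X: "X \<in> borel_measurable M" "\<And>\<omega>. 0 \<le> X \<omega>" and fin: "choquet M V X < \<infinity>"
  shows "\<exists>J. \<forall>N. (\<Sum>j=1..N. V {\<omega> \<in> space M. real j \<le> X \<omega>}) \<le> J"
proof -
  define G where "G = (\<lambda>t. {\<omega> \<in> space M. t \<le> X \<omega>})"
  have G: "G t \<in> sets M" for t unfolding G_def using X(1) by measurable
  have V0: "0 \<le> V (G t)" for t using V G unfolding capacity_def by blast
  have V_anti: "V (G t) \<le> V (G u)" if "u \<le> t" for t u
  proof (rule capacity_mono[OF V G G])
    show "G t \<subseteq> G u" using that unfolding G_def by auto
  qed
  define I where "I = (\<integral>\<^sup>+t\<in>{0..}. ennreal (V (G t)) \<partial>lborel)"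
  \<comment> \<open>As \<open>X\<close> is nonnegative, the part of the Choquet integral over the
    negative half-line vanishes and finiteness concerns the first part alone.\<close>
  have neg: "(\<integral>\<^sup>+t\<in>{..0}. ennreal (1 - V (G t)) \<partial>lborel) = 0"
  proof -
    have "G t = space M" if "t \<le> 0" for t unfolding G_def using that X(2) order_trans by blast
    then have "ennreal (1 - V (G t)) * indicator {..0} t = 0" for t
      using V unfolding capacity_def by (cases "t \<le> 0") auto
    then show ?thesis by (simp only: nn_integral_const mult_zero_left)
  qed
  have "I < \<infinity>"
  proof -
    have "enn2ereal I - enn2ereal 0 < \<infinity>" using fin neg unfolding choquet_def I_def G_def by simp
    then have "enn2ereal I < \<infinity>" by (simp add: zero_ennreal.rep_eq)
    then have "I \<noteq> top" by (auto simp: top_ennreal.rep_eq)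
    then show ?thesis by (simp add: less_top)
  qed
  then have I: "I = ennreal (enn2real I)" by (simp add: ennreal_enn2real less_top)
  have "(\<Sum>j=1..N. V (G (real j))) \<le> enn2real I" for N
  proof -
    have "ennreal (\<Sum>j=1..N. V (G (real j))) = (\<Sum>j=1..N. ennreal (V (G (real j))))"
      using V0 by (intro sum_ennreal[symmetric])
    also have "\<dots> = (\<Sum>j=1..N. \<integral>\<^sup>+t. ennreal (V (G (real j))) * indicator {real j - 1<..real j} t \<partial>lborel)"
      by (intro sum.cong refl) (simp add: nn_integral_cmult_indicator)
    also have "\<dots> = (\<integral>\<^sup>+t. (\<Sum>j=1..N. ennreal (V (G (real j))) * indicator {real j - 1<..real j} t) \<partial>lborel)"
      by (intro nn_integral_sum[symmetric]) auto
    also have "\<dots> \<le> I"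
      unfolding I_def
    proof (rule nn_integral_mono)
      fix t :: real
      show "(\<Sum>j=1..N. ennreal (V (G (real j))) * indicator {real j - 1<..real j} t) \<le> ennreal (V (G t)) * indicator {0..} t"
      proof (cases "0 < t")
        case True
        \<comment> \<open>The half-open intervals partition the positive half-line, so at most one
          summand is nonzero, the one for the ceiling of \<open>t\<close>.\<close>
        have "indicator {real j - 1<..real j} t = (if nat \<lceil>t\<rceil> = j then 1 else 0 :: ennreal)" if "1 \<le> j" for j
        proof -
          have "t \<in> {real j - 1<..real j} \<longleftrightarrow> nat \<lceil>t\<rceil> = j"
          proof
            assume "t \<in> {real j - 1<..real j}"
            then have "\<lceil>t\<rceil> = int j" by (intro ceiling_unique) auto
            then show "nat \<lceil>t\<rceil> = j" by simp
          next
            assume "nat \<lceil>t\<rceil> = j"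
            then have "\<lceil>t\<rceil> = int j" using that by linarith
            then show "t \<in> {real j - 1<..real j}" using ceiling_correct[of t] by simp
          qed
          then show ?thesis by (simp add: indicator_def)
        qed
        then have "(\<Sum>j=1..N. ennreal (V (G (real j))) * indicator {real j - 1<..real j} t)
            = (\<Sum>j=1..N. if nat \<lceil>t\<rceil> = j then ennreal (V (G (real j))) else 0)"
          by (intro sum.cong refl) simp
        also have "\<dots> \<le> ennreal (V (G (real (nat \<lceil>t\<rceil>))))" by (simp add: sum.delta')
        also have "\<dots> \<le> ennreal (V (G t))"
        proof (intro ennreal_leI V_anti)
          show "t \<le> real (nat \<lceil>t\<rceil>)" by (rule real_nat_ceiling_ge)
        qed
        finally show ?thesis using True by simp
      next
        case False
        then have "indicator {real j - 1<..real j} t = (0 :: ennreal)" if "j \<in> {1..N}" for j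
          using that by (auto simp: indicator_def)
        then have "(\<Sum>j=1..N. ennreal (V (G (real j))) * indicator {real j - 1<..real j} t) = 0"
          by (intro sum.neutral ballI) simp
        then show ?thesis by simp
      qed
    qed
    also have "I = ennreal (enn2real I)" by (rule I)
    finally show ?thesis by (simp add: ennreal_le_iff)
  qed
  then show ?thesis unfolding G_def by blast
qed

section \<open>From capacities to truncated fourth moments\<close>

context iid_seq
begin

lemma e_sum_le:
  assumes "finite A" "\<And>i. i \<in> A \<Longrightarrow> f i \<in> bl line_dist"
  shows "(\<lambda>y. \<Sum>i\<in>A. f i y) \<in> bl line_dist \<and> e (\<lambda>y. \<Sum>i\<in>A. f i y) \<le> (\<Sum>i\<in>A. e (f i))"
  using assms
proof (induction A rule: finite_induct)
  case empty then show ?case by simp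
next
  case (insert a A)
  then have IH: "(\<lambda>y. \<Sum>i\<in>A. f i y) \<in> bl line_dist" "e (\<lambda>y. \<Sum>i\<in>A. f i y) \<le> (\<Sum>i\<in>A. e (f i))" by auto
  have fa: "f a \<in> bl line_dist" using insert by simp
  have "e (\<lambda>y. f a y + (\<Sum>i\<in>A. f i y)) \<le> e (f a) + e (\<lambda>y. \<Sum>i\<in>A. f i y)" by (rule e_add[OF fa IH(1)])
  moreover have "(\<lambda>y. f a y + (\<Sum>i\<in>A. f i y)) \<in> bl line_dist" by (rule bl_add[OF fa IH(1)])
  ultimately show ?case using insert.hyps IH(2) by simp
qed

lemma e_le_capacity:
  assumes C: "property_C M H E V" and f: "f \<in> bl line_dist" "\<And>y. f y \<le> indicator A y" and A: "A \<in> sets borel"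
  shows "e f \<le> V {\<omega> \<in> space M. Y 1 \<omega> \<in> A}"
proof -
  have Y1: "Y 1 \<in> borel_measurable M" by (intro H_measurable Y_H) simp
  have fH: "(\<lambda>\<omega>. f (Y 1 \<omega>)) \<in> Hb" by (rule Y_Hb[OF f(1)]) simp
  let ?A = "{\<omega> \<in> space M. Y 1 \<omega> \<in> A}"
  have "?A \<in> sets M" using Y1 A by measurable
  moreover have "\<forall>\<omega>\<in>space M. f (Y 1 \<omega>) \<le> indicator ?A \<omega> \<and> indicator ?A \<omega> \<le> (1::real)"
  proof
    fix \<omega> assume "\<omega> \<in> space M"
    then show "f (Y 1 \<omega>) \<le> indicator ?A \<omega> \<and> indicator ?A \<omega> \<le> (1::real)"
      using f(2)[of "Y 1 \<omega>"] by (simp add: indicator_def)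
  qed
  moreover have "(\<lambda>\<omega>. f (Y 1 \<omega>)) \<in> H" "(\<lambda>_. 1) \<in> H" using fH const_H by (auto simp: Hb_def)
  ultimately have "E (\<lambda>\<omega>. f (Y 1 \<omega>)) \<le> ereal (V ?A)"
  proof -
    assume A: "?A \<in> sets M" and le: "\<forall>\<omega>\<in>space M. f (Y 1 \<omega>) \<le> indicator ?A \<omega> \<and> indicator ?A \<omega> \<le> (1::real)"
      and H: "(\<lambda>\<omega>. f (Y 1 \<omega>)) \<in> H" "(\<lambda>_. 1) \<in> H"
    show ?thesis
      using C[unfolded property_C_def, THEN bspec, OF H(1), THEN bspec, OF H(2), THEN bspec, OF A, THEN mp, OF le] ..
  qed
  then show ?thesis using E_ER[OF fH] by (simp add: e_def)
qed

text \<open>Divided by \<open>b ^ 4 - a ^ 4\<close>, the increment is at most 1 and vanishes below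
  level \<open>a\<close>, so it lies under the indicator of \<open>a \<le> \<bar>y\<bar>\<close> and
  property (C) applies.\<close>

lemma fourth_moment_increment:
  assumes C: "property_C M H E V" and ab: "0 \<le> a" "a \<le> b"
  shows "e (\<lambda>y. (capped b y) ^ 4 - (capped a y) ^ 4) \<le> (b ^ 4 - a ^ 4) * V {\<omega> \<in> space M. a \<le> \<bar>Y 1 \<omega>\<bar>}"
proof (cases "a = b")
  case True then show ?thesis by simp
next
  case False
  then have lt: "a ^ 4 < b ^ 4" using ab by (intro power_strict_mono) auto
  let ?f = "\<lambda>y. (capped b y) ^ 4 - (capped a y) ^ 4"
  have f_bl: "?f \<in> bl line_dist" using ab by (intro bl_diff bl_power bl_capped) auto
  have "e (\<lambda>y. 1 / (b ^ 4 - a ^ 4) * ?f y) \<le> V {\<omega> \<in> space M. Y 1 \<omega> \<in> {y. a \<le> \<bar>y\<bar>}}"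
  proof (rule e_le_capacity[OF C bl_cmult[OF f_bl]])
    fix y :: real
    show "1 / (b ^ 4 - a ^ 4) * ?f y \<le> indicator {y. a \<le> \<bar>y\<bar>} y"
    proof (cases "a \<le> \<bar>y\<bar>")
      case True
      have "(capped b y) ^ 4 \<le> b ^ 4" using ab by (intro power_mono) auto
      moreover have "capped a y = a" using True by simp
      ultimately show ?thesis using True lt by (simp add: divide_le_eq)
    next
      case False
      then have "capped a y = \<bar>y\<bar>" "capped b y = \<bar>y\<bar>" using ab by auto
      then show ?thesis using False by simp
    qed
  qed measurable
  moreover have "e (\<lambda>y. 1 / (b ^ 4 - a ^ 4) * ?f y) = 1 / (b ^ 4 - a ^ 4) * e ?f"
    using lt by (intro e_cmult f_bl) simp
  ultimately show ?thesis using lt by (simp add: divide_le_eq mult.commute)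
qed

text \<open>The capped fourth power is telescoped over the levels \<open>lil_norm m\<close>.
  Sub-additivity and \<open>fourth_moment_increment\<close> bound its expectation by a weighted sum
  of capacities, whose unweighted sum is controlled by the Choquet integral.\<close>

lemma summable_fourth_moments_of_choquet:
  assumes V: "capacity M V" and C: "property_C M H E V"
    and fin: "choquet M V (\<lambda>\<omega>. (Y 1 \<omega>)\<^sup>2 / llog \<bar>Y 1 \<omega>\<bar>) < \<infinity>"
  shows "summable (\<lambda>n. e (\<lambda>y. (capped (lil_norm n) y) ^ 4) / lil_norm n ^ 4)"
proof -
  let ?X = "\<lambda>\<omega>. (Y 1 \<omega>)\<^sup>2 / llog \<bar>Y 1 \<omega>\<bar>"
  have Y1 [measurable]: "Y 1 \<in> borel_measurable M" by (intro H_measurable Y_H) simp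
  have "?X \<in> borel_measurable M" unfolding clog_def by measurable
  moreover have "0 \<le> ?X \<omega>" for \<omega> using llog_pos[of "\<bar>Y 1 \<omega>\<bar>"] by simp
  ultimately obtain J where J: "\<And>N. (\<Sum>j=1..N. V {\<omega> \<in> space M. real j \<le> ?X \<omega>}) \<le> J"
    using choquet_sum_le[OF V _ _ fin] by blast
  have X_sets: "{\<omega> \<in> space M. t \<le> ?X \<omega>} \<in> sets M" for t unfolding clog_def by measurable
  \<comment> \<open>The index shift puts the lower end of the \<open>m\<close>-th layer into the
    event. So \<open>w 1\<close> has level 0 and is bounded by 1, while \<open>w (Suc j)\<close> is
    compared with the event at the integer \<open>j\<close>.\<close>
  define w where "w = (\<lambda>m. V {\<omega> \<in> space M. lil_norm (m - 1) \<le> \<bar>Y 1 \<omega>\<bar>})"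
  have A_sets: "{\<omega> \<in> space M. a \<le> \<bar>Y 1 \<omega>\<bar>} \<in> sets M" for a by measurable
  have w0: "0 \<le> w m" "w m \<le> 1" for m using V A_sets unfolding capacity_def w_def by blast+
  have w_le: "w (Suc j) \<le> V {\<omega> \<in> space M. real j \<le> ?X \<omega>}" if "1 \<le> j" for j
  proof -
    have "{\<omega> \<in> space M. lil_norm j \<le> \<bar>Y 1 \<omega>\<bar>} \<subseteq> {\<omega> \<in> space M. real j \<le> ?X \<omega>}"
    proof (intro subsetI CollectI conjI, elim CollectE conjE)
      fix \<omega> assume "\<omega> \<in> {\<omega> \<in> space M. lil_norm j \<le> \<bar>Y 1 \<omega>\<bar>}"
      then have "lil_norm j \<le> \<bar>Y 1 \<omega>\<bar>" by simp
      then have "(lil_norm j)\<^sup>2 / llog (lil_norm j) \<le> \<bar>Y 1 \<omega>\<bar>\<^sup>2 / llog \<bar>Y 1 \<omega>\<bar>"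
        by (rule square_div_llog_mono[OF lil_norm_nonneg])
      then show "real j \<le> ?X \<omega>" using lil_norm_square_div_llog[OF that] by simp
    qed simp
    then show ?thesis using V A_sets X_sets unfolding capacity_def w_def by simp
  qed
  have w_sum: "(\<Sum>m=1..N. w m) \<le> 1 + J" for N
  proof (cases N)
    case 0 then show ?thesis using J[of 0] by simp
  next
    case (Suc N')
    have "(\<Sum>m=1..Suc N'. w m) = w 1 + (\<Sum>j=1..N'. w (Suc j))"
      by (induction N') simp_all
    also have "\<dots> \<le> 1 + (\<Sum>j=1..N'. V {\<omega> \<in> space M. real j \<le> ?X \<omega>})"
      using w0(2)[of 1] w_le by (intro add_mono sum_mono) auto
    also have "\<dots> \<le> 1 + J" using J by simp
    finally show ?thesis using Suc by simp
  qed
  define b where "b = (\<lambda>n. e (\<lambda>y. (capped (lil_norm n) y) ^ 4) / lil_norm n ^ 4)"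
  have b0: "0 \<le> b n" for n
  proof -
    have "e (\<lambda>_. 0) \<le> e (\<lambda>y. (capped (lil_norm n) y) ^ 4)"
      by (rule e_mono[OF bl_const bl_power[OF bl_capped[OF lil_norm_nonneg]]]) simp
    then show ?thesis by (simp add: b_def lil_norm_nonneg)
  qed
  have b_le: "b n \<le> (\<Sum>m=1..n. (lil_norm m ^ 4 - lil_norm (m - 1) ^ 4) * w m) / lil_norm n ^ 4" for n
  proof -
    let ?f = "\<lambda>m y. (capped (lil_norm m) y) ^ 4 - (capped (lil_norm (m - 1)) y) ^ 4"
    have tele: "(capped (lil_norm n) y) ^ 4 = (\<Sum>m=1..n. ?f m y)" for y
    proof (induction n)
      case 0 then show ?case by (simp add: min_absorb2)
    next
      case (Suc n) then show ?case by simp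
    qed
    have fbl: "?f m \<in> bl line_dist" for m by (intro bl_diff bl_power bl_capped lil_norm_nonneg)
    have "e (\<lambda>y. (capped (lil_norm n) y) ^ 4) \<le> (\<Sum>m=1..n. e (?f m))"
      unfolding tele using e_sum_le[of "{1..n}" ?f] fbl by blast
    also have "\<dots> \<le> (\<Sum>m=1..n. (lil_norm m ^ 4 - lil_norm (m - 1) ^ 4) * w m)"
      unfolding w_def by (intro sum_mono fourth_moment_increment[OF C] lil_norm_nonneg lil_norm_mono) simp
    finally show ?thesis unfolding b_def by (intro divide_right_mono zero_le_power lil_norm_nonneg)
  qed
  have "(\<Sum>n=1..N. b n) \<le> 8 * (1 + J)" for N
    by (rule lil_norm_weighted_sum[OF w0(1) w_sum b_le])
  moreover have "(\<Sum>n<N. b n) \<le> (\<Sum>n=1..N. b n)" for N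
  proof -
    have "b 0 = 0" by (simp add: b_def)
    then have "(\<Sum>n<N. b n) = (\<Sum>n\<in>{..<N} - {0}. b n)" by (intro sum.mono_neutral_right) auto
    also have "\<dots> \<le> (\<Sum>n=1..N. b n)" using b0 by (intro sum_mono2) auto
    finally show ?thesis .
  qed
  ultimately have "summable b" using b0 by (intro summableI_nonneg_bounded[where x = "8 * (1 + J)"]) (auto intro: order_trans)
  then show ?thesis by (simp add: b_def)
qed

end

section \<open>The law of the iterated logarithm\<close>

context lil_seq
begin

text \<open>For \<open>s = 0\<close> the level \<tau> is negative and the weak law for
  \<open>- Y\<close> suffices; for \<open>s > 0\<close> the block argument applies, with the upper
  half for \<open>- Y\<close> as its input.\<close>

lemma null_eventually_below:
  assumes "0 \<le> s" "\<tau> < sqrt s"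
  shows "null {\<omega> \<in> space M. \<forall>\<^sub>F n in sequentially. partial_sum Y n \<omega> < \<tau> * lil_norm n}"
proof -
  interpret neg: lil_seq M H E "\<lambda>n \<omega>. - Y n \<omega>" S s by (rule lil_seq_uminus)
  have ps: "partial_sum (\<lambda>n \<omega>. - Y n \<omega>) n \<omega> = - partial_sum Y n \<omega>" for n \<omega>
    by (simp add: partial_sum_def sum_negf)
  show ?thesis
  proof (cases "s = 0")
    case True
    then have "0 < - \<tau>" using assms by simp
    from neg.null_eventually_above[OF this] show ?thesis
    proof (rule null_mono, intro subsetI CollectI, elim CollectE conjE)
      fix \<omega> assume \<omega>: "\<omega> \<in> space M" "\<forall>\<^sub>F n in sequentially. partial_sum Y n \<omega> < \<tau> * lil_norm n"
      from \<omega>(2) have "\<forall>\<^sub>F n in sequentially. - \<tau> * lil_norm n \<le> partial_sum (\<lambda>n \<omega>. - Y n \<omega>) n \<omega>"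
        by eventually_elim (simp add: ps)
      then show "\<omega> \<in> space M \<and> (\<forall>\<^sub>F n in sequentially. - \<tau> * lil_norm n \<le> partial_sum (\<lambda>n \<omega>. - Y n \<omega>) n \<omega>)"
        using \<omega>(1) by blast
    qed
  next
    case False
    then have "0 < s" using assms by simp
    moreover have "null {\<omega> \<in> space M. \<exists>\<^sub>\<infinity>n. (sqrt S + 1) * lil_norm n \<le> - partial_sum Y n \<omega>}"
      using neg.null_upper[of "sqrt S + 1"] by (simp add: ps)
    ultimately show ?thesis using null_lower assms(2) by blast
  qed
qed

lemma lil_limits_almost_surely:
  assumes s0: "0 \<le> s"
  shows "\<exists>N. null N \<and> (\<forall>\<omega>\<in>space M - N.
      (\<forall>\<epsilon>>0. \<forall>\<^sub>F n in sequentially. partial_sum Y n \<omega> / lil_norm n < sqrt S + \<epsilon>) \<and>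
      (\<forall>\<epsilon>>0. \<exists>\<^sub>\<infinity>n. sqrt s - \<epsilon> \<le> partial_sum Y n \<omega> / lil_norm n))"
proof -
  define r where "r = (\<lambda>k. 1 / real (Suc k))"
  have r: "0 < r k" for k by (simp add: r_def)
  let ?A = "\<lambda>k. {\<omega> \<in> space M. \<exists>\<^sub>\<infinity>n. (sqrt S + r k) * lil_norm n \<le> partial_sum Y n \<omega>}"
  let ?B = "\<lambda>k. {\<omega> \<in> space M. \<forall>\<^sub>F n in sequentially. partial_sum Y n \<omega> < (sqrt s - r k) * lil_norm n}"
  define N where "N = (\<Union>k. ?A k \<union> ?B k)"
  have "null (?A k \<union> ?B k)" for k
    by (intro null_Un null_upper null_eventually_below s0) (use r[of k] in auto)
  then have "null N" unfolding N_def by (rule null_UN)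
  moreover have "(\<forall>\<epsilon>>0. \<forall>\<^sub>F n in sequentially. partial_sum Y n \<omega> / lil_norm n < sqrt S + \<epsilon>) \<and>
      (\<forall>\<epsilon>>0. \<exists>\<^sub>\<infinity>n. sqrt s - \<epsilon> \<le> partial_sum Y n \<omega> / lil_norm n)" if \<omega>: "\<omega> \<in> space M - N" for \<omega>
  proof (intro conjI allI impI)
    fix \<epsilon> :: real assume "0 < \<epsilon>"
    then obtain k where "r k < \<epsilon>" unfolding r_def using nat_approx_posE by blast
    have "\<not> (\<exists>\<^sub>\<infinity>n. (sqrt S + r k) * lil_norm n \<le> partial_sum Y n \<omega>)" using \<omega> unfolding N_def by blast
    then have "\<forall>\<^sub>F n in sequentially. \<not> (sqrt S + r k) * lil_norm n \<le> partial_sum Y n \<omega>"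
      unfolding frequently_def not_not cofinite_eq_sequentially .
    then show "\<forall>\<^sub>F n in sequentially. partial_sum Y n \<omega> / lil_norm n < sqrt S + \<epsilon>"
      using eventually_ge_at_top[of 1]
    proof eventually_elim
      case (elim n)
      then have "partial_sum Y n \<omega> / lil_norm n < sqrt S + r k"
        using lil_norm_pos[of n] by (simp add: pos_divide_less_eq)
      then show ?case using \<open>r k < \<epsilon>\<close> by linarith
    qed
  next
    fix \<epsilon> :: real assume "0 < \<epsilon>"
    then obtain k where "r k < \<epsilon>" unfolding r_def using nat_approx_posE by blast
    have nB: "\<not> (\<forall>\<^sub>F n in sequentially. partial_sum Y n \<omega> < (sqrt s - r k) * lil_norm n)"
      using \<omega> unfolding N_def by blast
    show "\<exists>\<^sub>\<infinity>n. sqrt s - \<epsilon> \<le> partial_sum Y n \<omega> / lil_norm n"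
    proof (rule ccontr)
      assume "\<not> (\<exists>\<^sub>\<infinity>n. sqrt s - \<epsilon> \<le> partial_sum Y n \<omega> / lil_norm n)"
      then have "\<forall>\<^sub>F n in sequentially. \<not> sqrt s - \<epsilon> \<le> partial_sum Y n \<omega> / lil_norm n"
        unfolding frequently_def not_not cofinite_eq_sequentially .
      then have "\<forall>\<^sub>F n in sequentially. partial_sum Y n \<omega> < (sqrt s - r k) * lil_norm n"
        using eventually_ge_at_top[of 1]
      proof eventually_elim
        case (elim n)
        then have "partial_sum Y n \<omega> / lil_norm n < sqrt s - r k" using \<open>r k < \<epsilon>\<close> by linarith
        then show ?case using lil_norm_pos[of n] elim(2) by (simp add: pos_divide_less_eq)
      qed
      then show False using nB by blast
    qed
  qed
  ultimately show ?thesis by blast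
qed

text \<open>With \<open>q\<close> the quotient of consecutive norms, the increment is the normed new
  variable minus \<open>1 - q\<close> times the bounded old value, and \<open>lil_norm_scale\<close>
  gives \<open>1 - q \<le> 1 / (n + 1)\<close>.\<close>

lemma normed_increment_tendsto_0:
  fixes \<omega>
  assumes Y: "(\<lambda>n. Y n \<omega> / lil_norm n) \<longlonglongrightarrow> 0"
    and C: "\<forall>\<^sub>F n in sequentially. \<bar>partial_sum Y n \<omega> / lil_norm n\<bar> \<le> C"
  shows "(\<lambda>n. partial_sum Y (Suc n) \<omega> / lil_norm (Suc n) - partial_sum Y n \<omega> / lil_norm n) \<longlonglongrightarrow> 0"
proof (rule Lim_null_comparison)
  have "(\<lambda>n. \<bar>Y (Suc n) \<omega> / lil_norm (Suc n)\<bar>) \<longlonglongrightarrow> 0"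
    using tendsto_rabs_zero[OF LIMSEQ_Suc[OF Y]] .
  moreover have "(\<lambda>n. C * (1 / real (Suc n))) \<longlonglongrightarrow> C * 0"
    by (intro tendsto_mult tendsto_const) real_asymp
  ultimately show "(\<lambda>n. \<bar>Y (Suc n) \<omega> / lil_norm (Suc n)\<bar> + C * (1 / real (Suc n))) \<longlonglongrightarrow> 0"
    using tendsto_add by fastforce
  show "\<forall>\<^sub>F n in sequentially. norm (partial_sum Y (Suc n) \<omega> / lil_norm (Suc n) - partial_sum Y n \<omega> / lil_norm n)
      \<le> \<bar>Y (Suc n) \<omega> / lil_norm (Suc n)\<bar> + C * (1 / real (Suc n))"
    using C eventually_ge_at_top[of 1]
  proof eventually_elim
    case (elim n)
    let ?d = "lil_norm n" and ?d' = "lil_norm (Suc n)" and ?T = "partial_sum Y n \<omega>"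
    have d: "0 < ?d" "0 < ?d'" using elim(2) by (auto intro: lil_norm_pos)
    define q where "q = ?d / ?d'"
    have q1: "q \<le> 1" using lil_norm_mono[of n "Suc n"] d by (simp add: q_def)
    have "?d' \<le> real (Suc n) / real n * ?d" by (rule lil_norm_scale) (use elim(2) in auto)
    then have "real n * ?d' \<le> real (Suc n) * ?d" using elim(2) by (simp add: field_simps)
    then have "real n / real (Suc n) \<le> q" unfolding q_def using d by (simp add: frac_le_eq divide_simps mult.commute)
    moreover have "real n / real (Suc n) = 1 - 1 / real (Suc n)" by (simp add: field_simps)
    ultimately have q2: "1 - q \<le> 1 / real (Suc n)" by linarith
    have T: "partial_sum Y (Suc n) \<omega> = ?T + Y (Suc n) \<omega>" by (simp add: partial_sum_def)
    have "?T / ?d' = q * (?T / ?d)" using d by (simp add: q_def)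
    then have "partial_sum Y (Suc n) \<omega> / ?d' - ?T / ?d = Y (Suc n) \<omega> / ?d' - (1 - q) * (?T / ?d)"
      unfolding T add_divide_distrib left_diff_distrib by linarith
    then have "\<bar>partial_sum Y (Suc n) \<omega> / ?d' - ?T / ?d\<bar> \<le> \<bar>Y (Suc n) \<omega> / ?d'\<bar> + \<bar>(1 - q) * (?T / ?d)\<bar>"
      by (simp only: abs_triangle_ineq4)
    also have "\<bar>(1 - q) * (?T / ?d)\<bar> \<le> (1 / real (Suc n)) * C"
      unfolding abs_mult using q1 q2 elim(1) by (intro mult_mono) auto
    finally show ?case by (simp add: mult.commute)
  qed
qed

lemma lil_exceptional_null:
  assumes s0: "0 \<le> s"
  shows "\<exists>N. null N \<and> (\<forall>\<omega>\<in>space M - N.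
      (\<forall>\<epsilon>>0. \<forall>\<^sub>F n in sequentially. partial_sum Y n \<omega> / lil_norm n < sqrt S + \<epsilon>) \<and>
      (\<forall>\<epsilon>>0. \<forall>\<^sub>F n in sequentially. - (partial_sum Y n \<omega> / lil_norm n) < sqrt S + \<epsilon>) \<and>
      (\<forall>\<epsilon>>0. \<exists>\<^sub>\<infinity>n. sqrt s - \<epsilon> \<le> partial_sum Y n \<omega> / lil_norm n) \<and>
      (\<forall>\<epsilon>>0. \<exists>\<^sub>\<infinity>n. sqrt s - \<epsilon> \<le> - (partial_sum Y n \<omega> / lil_norm n)) \<and>
      (\<lambda>n. partial_sum Y (Suc n) \<omega> / lil_norm (Suc n) - partial_sum Y n \<omega> / lil_norm n) \<longlonglongrightarrow> 0)"
proof -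
  interpret neg: lil_seq M H E "\<lambda>n \<omega>. - Y n \<omega>" S s by (rule lil_seq_uminus)
  have ps: "partial_sum (\<lambda>n \<omega>. - Y n \<omega>) n \<omega> / lil_norm n = - (partial_sum Y n \<omega> / lil_norm n)" for n \<omega>
    by (simp add: partial_sum_def sum_negf)
  obtain N1 where N1: "null N1" "\<forall>\<omega>\<in>space M - N1.
      (\<forall>\<epsilon>>0. \<forall>\<^sub>F n in sequentially. partial_sum Y n \<omega> / lil_norm n < sqrt S + \<epsilon>) \<and>
      (\<forall>\<epsilon>>0. \<exists>\<^sub>\<infinity>n. sqrt s - \<epsilon> \<le> partial_sum Y n \<omega> / lil_norm n)"
    using lil_limits_almost_surely[OF s0] by blast
  obtain N2 where N2: "null N2" "\<forall>\<omega>\<in>space M - N2.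
      (\<forall>\<epsilon>>0. \<forall>\<^sub>F n in sequentially. - (partial_sum Y n \<omega> / lil_norm n) < sqrt S + \<epsilon>) \<and>
      (\<forall>\<epsilon>>0. \<exists>\<^sub>\<infinity>n. sqrt s - \<epsilon> \<le> - (partial_sum Y n \<omega> / lil_norm n))"
    using neg.lil_limits_almost_surely[OF s0] unfolding ps by blast
  define N where "N = N1 \<union> N2 \<union> {\<omega> \<in> space M. \<not> (\<lambda>n. Y n \<omega> / lil_norm n) \<longlonglongrightarrow> 0}"
  have "null N" unfolding N_def by (intro null_Un N1(1) N2(1) null_large_jumps)
  moreover have "(\<lambda>n. partial_sum Y (Suc n) \<omega> / lil_norm (Suc n) - partial_sum Y n \<omega> / lil_norm n) \<longlonglongrightarrow> 0"
    if \<omega>: "\<omega> \<in> space M - N" for \<omega>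
  proof (rule normed_increment_tendsto_0)
    show "(\<lambda>n. Y n \<omega> / lil_norm n) \<longlonglongrightarrow> 0" using \<omega> unfolding N_def by blast
    have "\<forall>\<^sub>F n in sequentially. partial_sum Y n \<omega> / lil_norm n < sqrt S + 1"
      "\<forall>\<^sub>F n in sequentially. - (partial_sum Y n \<omega> / lil_norm n) < sqrt S + 1"
      using N1(2) N2(2) \<omega> zero_less_one unfolding N_def by blast+
    then show "\<forall>\<^sub>F n in sequentially. \<bar>partial_sum Y n \<omega> / lil_norm n\<bar> \<le> sqrt S + 1"
      by eventually_elim linarith
  qed
  ultimately show ?thesis using N1(2) N2(2) unfolding N_def by (intro exI[of _ N]) (simp add: N_def)
qed

end

section \<open>From the limits in the hypotheses to real truncated moments\<close>

context iid_seq
begin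

lemma trunc_expectation_eq:
  assumes "f \<in> bl line_dist" "\<And>\<omega>. max (- c) (min (X \<omega>) c) = f (Y 1 \<omega>)"
  shows "trunc_expectation E X c = ereal (e f)"
  unfolding trunc_expectation_def assms(2) e_def by (rule E_ER[OF Y_Hb[OF assms(1)]]) simp

lemma breve_zero_tendsto:
  assumes "breve_exists E X" "breve_expectation E X = 0"
    and "\<And>c. 0 \<le> c \<Longrightarrow> trunc_expectation E X c = ereal (h c)"
  shows "(h \<longlongrightarrow> 0) at_top"
proof -
  obtain l where l: "(trunc_expectation E X \<longlongrightarrow> l) at_top" using assms(1) unfolding breve_exists_def by blast
  then have "l = 0" using tendsto_Lim[OF trivial_limit_at_top_linorder l] assms(2) by (simp add: breve_expectation_def)
  have "((\<lambda>c. ereal (h c)) \<longlongrightarrow> l) at_top"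
  proof (rule Lim_transform_eventually[OF l])
    show "\<forall>\<^sub>F c in at_top. trunc_expectation E X c = ereal (h c)"
      using eventually_ge_at_top[of 0] by eventually_elim (rule assms(3))
  qed
  then show ?thesis unfolding \<open>l = 0\<close> zero_ereal_def lim_ereal .
qed

lemma capped_moment_mono:
  assumes "0 \<le> a" "a \<le> b"
  shows "e (\<lambda>y. (capped a y)\<^sup>2) \<le> e (\<lambda>y. (capped b y)\<^sup>2)"
    "- e (\<lambda>y. - (capped a y)\<^sup>2) \<le> - e (\<lambda>y. - (capped b y)\<^sup>2)"
proof -
  have bl: "(\<lambda>y. (capped a y)\<^sup>2) \<in> bl line_dist" "(\<lambda>y. (capped b y)\<^sup>2) \<in> bl line_dist"
    using assms by (auto intro!: bl_power bl_capped)
  have le: "(capped a y)\<^sup>2 \<le> (capped b y)\<^sup>2" for y using assms by (intro power_mono) auto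
  show "e (\<lambda>y. (capped a y)\<^sup>2) \<le> e (\<lambda>y. (capped b y)\<^sup>2)" by (rule e_mono[OF bl le])
  have "e (\<lambda>y. - (capped b y)\<^sup>2) \<le> e (\<lambda>y. - (capped a y)\<^sup>2)"
    by (rule e_mono[OF bl_uminus[OF bl(2)] bl_uminus[OF bl(1)]]) (use le in simp)
  then show "- e (\<lambda>y. - (capped a y)\<^sup>2) \<le> - e (\<lambda>y. - (capped b y)\<^sup>2)" by simp
qed

text \<open>Truncating the square at \<open>c\<close> is capping \<bar>Y\<bar> at
  \<open>sqrt c\<close>. Monotonicity turns the limit into a supremum, which dominates every
  truncated moment.\<close>

lemma upper_variance_eq:
  assumes fin: "upper_variance E (Y 1) < \<infinity>" and c: "0 \<le> c"
  shows "e (\<lambda>y. (capped c y)\<^sup>2) \<le> real_of_ereal (upper_variance E (Y 1))"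
proof -
  define F where "F = trunc_expectation E (\<lambda>\<omega>. (Y 1 \<omega>)\<^sup>2)"
  have F: "F c = ereal (e (\<lambda>y. (capped (sqrt c) y)\<^sup>2))" if "0 \<le> c" for c
    unfolding F_def
  proof (rule trunc_expectation_eq)
    show "(\<lambda>y. (capped (sqrt c) y)\<^sup>2) \<in> bl line_dist" using that by (intro bl_power bl_capped) simp
    show "max (- c) (min ((Y 1 \<omega>)\<^sup>2) c) = (capped (sqrt c) (Y 1 \<omega>))\<^sup>2" for \<omega>
    proof -
      have "0 \<le> min ((Y 1 \<omega>)\<^sup>2) c" using that by simp
      then have "- c \<le> min ((Y 1 \<omega>)\<^sup>2) c" using that by linarith
      then have "max (- c) (min ((Y 1 \<omega>)\<^sup>2) c) = min ((Y 1 \<omega>)\<^sup>2) c" by (rule max_absorb2)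
      then show ?thesis using capped_square[of "sqrt c" "Y 1 \<omega>"] that by simp
    qed
  qed
  have lim: "(F \<longlongrightarrow> (SUP c\<in>{0..}. F c)) at_top"
    by (rule tendsto_SUP_at_top) (simp add: F capped_moment_mono)
  have U: "upper_variance E (Y 1) = (SUP c\<in>{0..}. F c)"
    unfolding upper_variance_def breve_expectation_def F_def[symmetric]
    by (rule tendsto_Lim[OF trivial_limit_at_top_linorder lim])
  have "F (c\<^sup>2) \<le> upper_variance E (Y 1)" unfolding U by (rule SUP_upper) simp
  then have "ereal (e (\<lambda>y. (capped c y)\<^sup>2)) \<le> upper_variance E (Y 1)" using c by (simp add: F)
  then show ?thesis using fin by (cases "upper_variance E (Y 1)") auto
qed

lemma lower_variance_tendsto:
  assumes S: "\<And>c. 0 \<le> c \<Longrightarrow> e (\<lambda>y. (capped c y)\<^sup>2) \<le> S"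
  shows "((\<lambda>c. - e (\<lambda>y. - (capped c y)\<^sup>2)) \<longlongrightarrow> real_of_ereal (lower_variance E (Y 1))) at_top"
    "0 \<le> real_of_ereal (lower_variance E (Y 1))"
proof -
  define h where "h = (\<lambda>c. - e (\<lambda>y. - (capped c y)\<^sup>2))"
  define F where "F = (\<lambda>c::real. conj_expectation E (\<lambda>\<omega>. min ((Y 1 \<omega>)\<^sup>2) c))"
  have F: "F c = ereal (h (sqrt c))" if "0 \<le> c" for c
  proof -
    have bl: "(\<lambda>y. - (capped (sqrt c) y)\<^sup>2) \<in> bl line_dist" using that by (intro bl_uminus bl_power bl_capped) simp
    have "E (\<lambda>\<omega>. - (capped (sqrt c) (Y 1 \<omega>))\<^sup>2) = ereal (e (\<lambda>y. - (capped (sqrt c) y)\<^sup>2))"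
      unfolding e_def by (rule E_ER[OF Y_Hb[OF bl]]) simp
    moreover have "(capped (sqrt c) (Y 1 \<omega>))\<^sup>2 = min ((Y 1 \<omega>)\<^sup>2) c" for \<omega>
      using capped_square[of "sqrt c" "Y 1 \<omega>"] that by simp
    ultimately show ?thesis unfolding F_def conj_expectation_def h_def by simp
  qed
  have h_mono: "h a \<le> h b" if "0 \<le> a" "a \<le> b" for a b
    unfolding h_def by (rule capped_moment_mono(2)[OF that])
  have lim: "(F \<longlongrightarrow> (SUP c\<in>{0..}. F c)) at_top"
    by (rule tendsto_SUP_at_top) (simp add: F h_mono)
  have U: "lower_variance E (Y 1) = (SUP c\<in>{0..}. F c)"
    unfolding lower_variance_def F_def[symmetric]
    by (rule tendsto_Lim[OF trivial_limit_at_top_linorder lim])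
  have hS: "h c \<le> S" if "0 \<le> c" for c
  proof -
    have "(\<lambda>y. (capped c y)\<^sup>2) \<in> bl line_dist" using that by (intro bl_power bl_capped)
    from e_uminus[OF this] show ?thesis unfolding h_def using S[OF that] by linarith
  qed
  have "lower_variance E (Y 1) \<le> ereal S" unfolding U by (rule SUP_least) (simp add: F hS)
  moreover have h0: "h 0 = 0" by (simp add: h_def min_absorb2)
  have "F 0 \<le> lower_variance E (Y 1)" unfolding U by (rule SUP_upper) simp
  then have nn: "ereal 0 \<le> lower_variance E (Y 1)" using F[of 0] h0 by simp
  ultimately obtain s where s: "lower_variance E (Y 1) = ereal s" by (cases "lower_variance E (Y 1)") auto
  show "0 \<le> real_of_ereal (lower_variance E (Y 1))" using nn s by simp
  have "((\<lambda>c. ereal (h (sqrt c))) \<longlongrightarrow> ereal s) at_top"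
  proof (rule Lim_transform_eventually)
    show "(F \<longlongrightarrow> ereal s) at_top" using lim unfolding U[symmetric] s .
    show "\<forall>\<^sub>F c in at_top. F c = ereal (h (sqrt c))"
      using eventually_ge_at_top[of 0] by eventually_elim (rule F)
  qed
  then have "((\<lambda>c. h (sqrt c)) \<longlongrightarrow> s) at_top" unfolding lim_ereal .
  \<comment> \<open>Substituting a square for the level passes from truncating the square to capping
    the variable itself.\<close>
  moreover have "filterlim (\<lambda>x::real. x\<^sup>2) at_top at_top" by real_asymp
  ultimately have "((\<lambda>x. h (sqrt (x\<^sup>2))) \<longlongrightarrow> s) at_top" by (rule filterlim_compose)
  then have "(h \<longlongrightarrow> s) at_top"
  proof (rule Lim_transform_eventually)
    show "\<forall>\<^sub>F x in at_top. h (sqrt (x\<^sup>2)) = h x"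
      using eventually_ge_at_top[of 0] by eventually_elim simp
  qed
  then show "((\<lambda>c. - e (\<lambda>y. - (capped c y)\<^sup>2)) \<longlongrightarrow> real_of_ereal (lower_variance E (Y 1))) at_top"
    unfolding h_def s by simp
qed

end

theorem theorem5p5:
  fixes M :: "'a measure" and H :: "('a \<Rightarrow> real) set" and E :: "('a \<Rightarrow> real) \<Rightarrow> ereal"
    and V :: "'a set \<Rightarrow> real" and Y :: "nat \<Rightarrow> 'a \<Rightarrow> real"
  assumes "sublinear_expectation_space M H E"
    and "\<forall>n\<ge>1. Y n \<in> H"
    and "independent_seq H E Y"
    and "identically_distributed_seq E Y"
    and "capacity M V" and "subadditive_on_sets M V" and "property_C M H E V"
    and "choquet M V (\<lambda>\<omega>. (Y 1 \<omega>)\<^sup>2 / clog (clog \<bar>Y 1 \<omega>\<bar>)) < \<infinity>"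
    and "breve_exists E (Y 1)" and "breve_expectation E (Y 1) = 0"
    and "breve_exists E (\<lambda>\<omega>. - Y 1 \<omega>)" and "breve_expectation E (\<lambda>\<omega>. - Y 1 \<omega>) = 0"
    and "upper_variance E (Y 1) = Lim at_top (\<lambda>c::real. E (\<lambda>\<omega>. min ((Y 1 \<omega>)\<^sup>2) c))"
    and "upper_variance E (Y 1) < \<infinity>"
  shows "V_hat_star_lower M H E
           {\<omega>\<in>space M.
              ereal (lower_sigma E (Y 1)) \<le> limsup (\<lambda>n. ereal (partial_sum Y n \<omega> / lil_norm n)) \<and>
              limsup (\<lambda>n. ereal (partial_sum Y n \<omega> / lil_norm n)) \<le> ereal (upper_sigma E (Y 1))} = 1
       \<and> V_hat_star_lower M H E
           {\<omega>\<in>space M.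
              ereal (- upper_sigma E (Y 1)) \<le> liminf (\<lambda>n. ereal (partial_sum Y n \<omega> / lil_norm n)) \<and>
              liminf (\<lambda>n. ereal (partial_sum Y n \<omega> / lil_norm n)) \<le> ereal (- lower_sigma E (Y 1))} = 1
       \<and> V_hat_star_lower M H E
           {\<omega>\<in>space M.
              cluster_set (\<lambda>n. partial_sum Y n \<omega> / lil_norm n) \<subseteq> {- upper_sigma E (Y 1)..upper_sigma E (Y 1)} \<and>
              ereal ` cluster_set (\<lambda>n. partial_sum Y n \<omega> / lil_norm n) =
                {liminf (\<lambda>n. ereal (partial_sum Y n \<omega> / lil_norm n))..
                 limsup (\<lambda>n. ereal (partial_sum Y n \<omega> / lil_norm n))} \<and>
              {- lower_sigma E (Y 1)..lower_sigma E (Y 1)} \<subseteq> cluster_set (\<lambda>n. partial_sum Y n \<omega> / lil_norm n)} = 1"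
proof -
  interpret iid_seq M H E Y
    using assms(1-4) by (intro iid_seq.intro iid_seq_axioms.intro) auto
  define S where "S = real_of_ereal (upper_variance E (Y 1))"
  define s where "s = real_of_ereal (lower_variance E (Y 1))"
  have second: "e (\<lambda>y. (capped c y)\<^sup>2) \<le> S" if "0 \<le> c" for c
    unfolding S_def by (rule upper_variance_eq[OF assms(14) that])
  note low = lower_variance_tendsto[OF second, folded s_def]
  have clip_bl: "0 \<le> c \<Longrightarrow> clip c \<in> bl line_dist" "0 \<le> c \<Longrightarrow> (\<lambda>y. - clip c y) \<in> bl line_dist" for c
    by (auto intro: bl_clip bl_uminus)
  interpret lil_seq M H E Y S s
  proof unfold_locales
    show "((\<lambda>c. e (clip c)) \<longlongrightarrow> 0) at_top"
      by (rule breve_zero_tendsto[OF assms(9,10)], rule trunc_expectation_eq[OF clip_bl(1)]) simp_all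
    show "((\<lambda>c. e (\<lambda>y. - clip c y)) \<longlongrightarrow> 0) at_top"
      by (rule breve_zero_tendsto[OF assms(11,12)], rule trunc_expectation_eq[OF clip_bl(2)])
         (simp_all add: clip_uminus)
    show "summable (\<lambda>n. e (\<lambda>y. (capped (lil_norm n) y) ^ 4) / lil_norm n ^ 4)"
      by (rule summable_fourth_moments_of_choquet[OF assms(5,7,8)])
  qed (use second low in auto)
  obtain N where N: "null N" and lim: "\<forall>\<omega>\<in>space M - N.
      (\<forall>\<epsilon>>0. \<forall>\<^sub>F n in sequentially. partial_sum Y n \<omega> / lil_norm n < sqrt S + \<epsilon>) \<and>
      (\<forall>\<epsilon>>0. \<forall>\<^sub>F n in sequentially. - (partial_sum Y n \<omega> / lil_norm n) < sqrt S + \<epsilon>) \<and>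
      (\<forall>\<epsilon>>0. \<exists>\<^sub>\<infinity>n. sqrt s - \<epsilon> \<le> partial_sum Y n \<omega> / lil_norm n) \<and>
      (\<forall>\<epsilon>>0. \<exists>\<^sub>\<infinity>n. sqrt s - \<epsilon> \<le> - (partial_sum Y n \<omega> / lil_norm n)) \<and>
      (\<lambda>n. partial_sum Y (Suc n) \<omega> / lil_norm (Suc n) - partial_sum Y n \<omega> / lil_norm n) \<longlonglongrightarrow> 0"
    using lil_exceptional_null[OF low(2)] by blast
  have \<sigma>: "upper_sigma E (Y 1) = sqrt S" "lower_sigma E (Y 1) = sqrt s"
    by (simp_all add: upper_sigma_def lower_sigma_def S_def s_def)
  \<comment> \<open>One exceptional set \<open>N\<close> serves all three events, since the limits
    on its complement determine everything else.\<close>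
  have one: "V_hat_star_lower M H E {\<omega> \<in> space M. P \<omega>} = 1" if "\<And>\<omega>. \<omega> \<in> space M - N \<Longrightarrow> P \<omega>" for P
    by (rule null_lower_eq_1, rule null_mono[OF N]) (use that in blast)
  note interval = cluster_set_interval[where S = "sqrt S" and s = "sqrt s"]
  have L: "ereal (sqrt s) \<le> limsup (\<lambda>n. ereal (partial_sum Y n \<omega> / lil_norm n)) \<and>
      limsup (\<lambda>n. ereal (partial_sum Y n \<omega> / lil_norm n)) \<le> ereal (sqrt S)"
    and l: "ereal (- sqrt S) \<le> liminf (\<lambda>n. ereal (partial_sum Y n \<omega> / lil_norm n)) \<and>
      liminf (\<lambda>n. ereal (partial_sum Y n \<omega> / lil_norm n)) \<le> ereal (- sqrt s)"
    and C: "cluster_set (\<lambda>n. partial_sum Y n \<omega> / lil_norm n) \<subseteq> {- sqrt S..sqrt S} \<and>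
      ereal ` cluster_set (\<lambda>n. partial_sum Y n \<omega> / lil_norm n) =
        {liminf (\<lambda>n. ereal (partial_sum Y n \<omega> / lil_norm n))..
         limsup (\<lambda>n. ereal (partial_sum Y n \<omega> / lil_norm n))} \<and>
      {- sqrt s..sqrt s} \<subseteq> cluster_set (\<lambda>n. partial_sum Y n \<omega> / lil_norm n)"
    if "\<omega> \<in> space M - N" for \<omega>
  proof -
    let ?x = "\<lambda>n. partial_sum Y n \<omega> / lil_norm n"
    have *: "\<forall>\<^sub>F n in sequentially. ?x n < sqrt S + \<epsilon>" "\<forall>\<^sub>F n in sequentially. - ?x n < sqrt S + \<epsilon>"
      "\<exists>\<^sub>\<infinity>n. sqrt s - \<epsilon> \<le> ?x n" "\<exists>\<^sub>\<infinity>n. sqrt s - \<epsilon> \<le> - ?x n" if "0 < \<epsilon>" for \<epsilon>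
      using lim \<open>\<omega> \<in> space M - N\<close> that by blast+
    have **: "(\<lambda>n. ?x (Suc n) - ?x n) \<longlonglongrightarrow> 0" using lim that by blast
    note r = interval[of ?x, OF *(1) *(2) *(3) *(4) **]
    show "ereal (sqrt s) \<le> limsup (\<lambda>n. ereal (?x n)) \<and> limsup (\<lambda>n. ereal (?x n)) \<le> ereal (sqrt S)"
      using r(1,2) by blast
    show "ereal (- sqrt S) \<le> liminf (\<lambda>n. ereal (?x n)) \<and> liminf (\<lambda>n. ereal (?x n)) \<le> ereal (- sqrt s)"
      using r(3,4) by blast
    show "cluster_set ?x \<subseteq> {- sqrt S..sqrt S} \<and>
      ereal ` cluster_set ?x = {liminf (\<lambda>n. ereal (?x n))..limsup (\<lambda>n. ereal (?x n))} \<and>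
      {- sqrt s..sqrt s} \<subseteq> cluster_set ?x"
      using r(5-7) by blast
  qed
  show ?thesis unfolding \<sigma> by (intro conjI one L l C)
qed

end
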